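(* Let $J$ be the principal ideal of strange Bousfield classes in $\mathbf{B}$. If $\langle X\rangle\equiv\langle Y\rangle\pmod{J}$, then $r\langle X\rangle=r\langle Y\rangle$.
   Context: Fix a prime $p$; "spectrum" means object of the $p$-local stable homotopy category. For a spectrum $E$, the Bousfield class $\langle E\rangle$ is the collection of spectra $Z$ with $E\wedge Z=0$. Order Bousfield classes by $\langle E\rangle\ge\langle F\rangle$ iff $E\wedge Z=0$ implies $F\wedge Z=0$ for all $Z$. By Ohkawa's theorem the Bousfield classes form a set $\mathbf{B}$; it is a complete lattice with joins $\bigvee\langle E_i\rangle=\langle\bigvee E_i\rangle$. The smash product of classes is $\langle E\rangle\wedge\langle F\rangle=\langle E\wedge F\rangle$. $\mathbf{DL}\subseteq\mathbf{B}$ is the sub-poset of classes with $\langle E\rangle=\langle E\rangle\wedge\langle E\rangle$, and $r\colon\mathbf{B}\to\mathbf{DL}$ is $r\langle X\rangle=\bigvee\{\langle Y\rangle\in\mathbf{DL} : \langle Y\rangle\le\langle X\rangle\}$. A spectrum $E$ (or its class) is strange if $\langle E\rangle<\langle H\mathbf{F}_p\rangle$, where $H\mathbf{F}_p$ is the mod $p$ Eilenberg-Mac Lane spectrum. The strange classes form an ideal $J$ closed under arbitrary joins, hence principal (all elements below its largest element). For a complete ideal $J$, $x\equiv y\pmod J$ means there is $z\in J$ with $x\vee z=y\vee z$. *)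

theory Defs
  imports "HOL-Homology.Homology" "HOL-Computational_Algebra.Primes"
begin

section \<open>Categories with the structure of a stable homotopy category\<close>

text \<open>
  Arrows know their source and target.  \<open>Sus\<close> is the suspension, \<open>Tri\<close> the class of distinguished
  triangles \<open>X \<rightarrow> Y \<rightarrow> Z \<rightarrow> Sus X\<close>, \<open>\<odot>\<close> the smash product of objects and \<open>\<star>\<close> that of arrows,
  \<open>Sph\<close> the unit (the sphere spectrum), and \<open>Sex A X : Sus A \<odot> X \<rightarrow> Sus (A \<odot> X)\<close> the exchange
  isomorphism.  Objects and arrows of the category of spectra form proper classes, so "set-indexed"
  needs a meaning: \<open>Small\<close> singles out the index sets over which coproducts are formed.
\<close>

record ('o, 'm, 'i) stable_data =
  Ob :: "'o set"
  Ar :: "'m set"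
  Dom :: "'m \<Rightarrow> 'o"
  Cod :: "'m \<Rightarrow> 'o"
  Id :: "'o \<Rightarrow> 'm"
  Cmp :: "'m \<Rightarrow> 'm \<Rightarrow> 'm" (infixl "\<cdot>\<index>" 70)
  Plus :: "'m \<Rightarrow> 'm \<Rightarrow> 'm"
  Zer :: "'o \<Rightarrow> 'o \<Rightarrow> 'm"
  Sus :: "'o \<Rightarrow> 'o"
  SusM :: "'m \<Rightarrow> 'm"
  Tri :: "('m \<times> 'm \<times> 'm) set"
  Smash :: "'o \<Rightarrow> 'o \<Rightarrow> 'o" (infixl "\<odot>\<index>" 75)
  SmashM :: "'m \<Rightarrow> 'm \<Rightarrow> 'm" (infixl "\<star>\<index>" 75)
  Sph :: "'o"
  Asc :: "'o \<Rightarrow> 'o \<Rightarrow> 'o \<Rightarrow> 'm"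
  Lun :: "'o \<Rightarrow> 'm"
  Sym :: "'o \<Rightarrow> 'o \<Rightarrow> 'm"
  Sex :: "'o \<Rightarrow> 'o \<Rightarrow> 'm"
  Small :: "'i set \<Rightarrow> bool"

definition homset :: "('o, 'm, 'i) stable_data \<Rightarrow> 'o \<Rightarrow> 'o \<Rightarrow> 'm set" where
  "homset C X Y = {f \<in> Ar C. Dom C f = X \<and> Cod C f = Y}"

text \<open>The additive groups of arrows, in the multiplicative notation of \<open>HOL-Algebra\<close>:
  \<open>n\<close>-fold sums are powers, finite sums are \<open>finprod\<close>.\<close>

definition hom_group :: "('o, 'm, 'i) stable_data \<Rightarrow> 'o \<Rightarrow> 'o \<Rightarrow> 'm monoid" where
  "hom_group C X Y = \<lparr>carrier = homset C X Y, monoid.mult = Plus C, one = Zer C X Y\<rparr>"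

definition multiple :: "('o, 'm, 'i) stable_data \<Rightarrow> nat \<Rightarrow> 'm \<Rightarrow> 'm" where
  "multiple C n f = f [^]\<^bsub>hom_group C (Dom C f) (Cod C f)\<^esub> n"

definition neg :: "('o, 'm, 'i) stable_data \<Rightarrow> 'm \<Rightarrow> 'm" where
  "neg C f = inv\<^bsub>hom_group C (Dom C f) (Cod C f)\<^esub> f"

definition iso_arrow :: "('o, 'm, 'i) stable_data \<Rightarrow> 'm \<Rightarrow> bool" where
  "iso_arrow C f \<longleftrightarrow> f \<in> Ar C \<and>
     (\<exists>g \<in> homset C (Cod C f) (Dom C f).
        Cmp C g f = Id C (Dom C f) \<and> Cmp C f g = Id C (Cod C f))"

definition iso_in :: "('o, 'm, 'i) stable_data \<Rightarrow> 'm \<Rightarrow> 'o \<Rightarrow> 'o \<Rightarrow> bool" where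
  "iso_in C f X Y \<longleftrightarrow> f \<in> homset C X Y \<and> iso_arrow C f"

definition zero_object :: "('o, 'm, 'i) stable_data \<Rightarrow> 'o \<Rightarrow> bool" where
  "zero_object C X \<longleftrightarrow> X \<in> Ob C \<and>
     (\<forall>Y \<in> Ob C. (\<exists>!f. f \<in> homset C X Y) \<and> (\<exists>!f. f \<in> homset C Y X))"

definition is_coproduct ::
    "('o, 'm, 'i) stable_data \<Rightarrow> 'i set \<Rightarrow> ('i \<Rightarrow> 'o) \<Rightarrow> 'o \<Rightarrow> ('i \<Rightarrow> 'm) \<Rightarrow> bool" where
  "is_coproduct C I X Q j \<longleftrightarrow>
     Q \<in> Ob C \<and> (\<forall>i\<in>I. j i \<in> homset C (X i) Q) \<and>
     (\<forall>Y \<in> Ob C. \<forall>f. (\<forall>i\<in>I. f i \<in> homset C (X i) Y) \<longrightarrow>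
        (\<exists>!g. g \<in> homset C Q Y \<and> (\<forall>i\<in>I. Cmp C g (j i) = f i)))"

text \<open>\<open>\<pi>\<^sub>n X\<close>.  The suspension is only an equivalence, not a bijection on objects; so for \<open>n < 0\<close> the
  target is suspended instead of desuspending the source.\<close>

definition homotopy_group :: "('o, 'm, 'i) stable_data \<Rightarrow> int \<Rightarrow> 'o \<Rightarrow> 'm monoid" where
  "homotopy_group C n X =
     (if 0 \<le> n then hom_group C ((Sus C ^^ nat n) (Sph C)) X
      else hom_group C (Sph C) ((Sus C ^^ nat (- n)) X))"

subsection \<open>Additive structure and coproducts\<close>

locale additive_category_with_coproducts =
  fixes C :: "('o, 'm, 'i) stable_data" (structure)
  assumes dom_cod: "f \<in> Ar C \<Longrightarrow> Dom C f \<in> Ob C \<and> Cod C f \<in> Ob C"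
    and id_hom: "X \<in> Ob C \<Longrightarrow> Id C X \<in> homset C X X"
    and comp_hom: "\<lbrakk>f \<in> homset C X Y; g \<in> homset C Y Z\<rbrakk> \<Longrightarrow> g \<cdot> f \<in> homset C X Z"
    and comp_id: "f \<in> homset C X Y \<Longrightarrow> f \<cdot> Id C X = f \<and> Id C Y \<cdot> f = f"
    and comp_assoc: "\<lbrakk>f \<in> homset C W X; g \<in> homset C X Y; h \<in> homset C Y Z\<rbrakk>
          \<Longrightarrow> h \<cdot> (g \<cdot> f) = (h \<cdot> g) \<cdot> f"
    and hom_group: "\<lbrakk>X \<in> Ob C; Y \<in> Ob C\<rbrakk> \<Longrightarrow> comm_group (hom_group C X Y)"
    and comp_plus_left: "\<lbrakk>f \<in> homset C X Y; g \<in> homset C Y Z; h \<in> homset C Y Z\<rbrakk>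
          \<Longrightarrow> Plus C g h \<cdot> f = Plus C (g \<cdot> f) (h \<cdot> f)"
    and comp_plus_right: "\<lbrakk>f \<in> homset C X Y; g \<in> homset C X Y; h \<in> homset C Y Z\<rbrakk>
          \<Longrightarrow> h \<cdot> Plus C f g = Plus C (h \<cdot> f) (h \<cdot> g)"
    and small_infinite: "\<exists>I. Small C I \<and> infinite I"
    and small_lepoll: "\<lbrakk>Small C I'; I \<lesssim> I'\<rbrakk> \<Longrightarrow> Small C I"
    and small_Union: "\<lbrakk>Small C I; \<And>i. i \<in> I \<Longrightarrow> Small C (S i)\<rbrakk> \<Longrightarrow> Small C (\<Union>i\<in>I. S i)"
    and coproducts: "\<lbrakk>Small C I; \<And>i. i \<in> I \<Longrightarrow> D i \<in> Ob C\<rbrakk> \<Longrightarrow> \<exists>Q j. is_coproduct C I D Q j"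

subsection \<open>Triangulated structure\<close>

locale triangulated_category = additive_category_with_coproducts +
  assumes sus_ob: "X \<in> Ob C \<Longrightarrow> Sus C X \<in> Ob C"
    and sus_hom: "f \<in> homset C X Y \<Longrightarrow> SusM C f \<in> homset C (Sus C X) (Sus C Y)"
    and sus_id: "X \<in> Ob C \<Longrightarrow> SusM C (Id C X) = Id C (Sus C X)"
    and sus_comp: "\<lbrakk>f \<in> homset C X Y; g \<in> homset C Y Z\<rbrakk> \<Longrightarrow> SusM C (g \<cdot> f) = SusM C g \<cdot> SusM C f"
    and sus_plus: "\<lbrakk>f \<in> homset C X Y; g \<in> homset C X Y\<rbrakk>
          \<Longrightarrow> SusM C (Plus C f g) = Plus C (SusM C f) (SusM C g)"
    and sus_fully_faithful: "\<lbrakk>X \<in> Ob C; Y \<in> Ob C\<rbrakk>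
          \<Longrightarrow> bij_betw (SusM C) (homset C X Y) (homset C (Sus C X) (Sus C Y))"
    and sus_ess_surj: "Y \<in> Ob C \<Longrightarrow> \<exists>X\<in>Ob C. \<exists>f. iso_in C f (Sus C X) Y"
    and tri_typed: "(f, g, h) \<in> Tri C \<Longrightarrow> f \<in> Ar C \<and> g \<in> Ar C \<and> h \<in> Ar C \<and>
          Dom C g = Cod C f \<and> Dom C h = Cod C g \<and> Cod C h = Sus C (Dom C f)"
    and tri_iso: "\<lbrakk>(f, g, h) \<in> Tri C; iso_in C a (Dom C f) X; iso_in C b (Cod C f) Y;
            iso_in C c (Cod C g) Z; f' \<in> homset C X Y; g' \<in> homset C Y Z;
            h' \<in> homset C Z (Sus C X); f' \<cdot> a = b \<cdot> f; g' \<cdot> b = c \<cdot> g; h' \<cdot> c = SusM C a \<cdot> h\<rbrakk>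
          \<Longrightarrow> (f', g', h') \<in> Tri C"
    and tri_id: "\<lbrakk>X \<in> Ob C; zero_object C Z\<rbrakk> \<Longrightarrow> (Id C X, Zer C X Z, Zer C Z (Sus C X)) \<in> Tri C"
    and tri_complete: "f \<in> Ar C \<Longrightarrow> \<exists>g h. (f, g, h) \<in> Tri C"
    and tri_rotate: "\<lbrakk>f \<in> homset C X Y; g \<in> homset C Y Z; h \<in> homset C Z (Sus C X)\<rbrakk>
          \<Longrightarrow> (f, g, h) \<in> Tri C \<longleftrightarrow> (g, h, neg C (SusM C f)) \<in> Tri C"
    and tri_fill: "\<lbrakk>(f, g, h) \<in> Tri C; (f', g', h') \<in> Tri C; a \<in> homset C (Dom C f) (Dom C f');
            b \<in> homset C (Cod C f) (Cod C f'); f' \<cdot> a = b \<cdot> f\<rbrakk>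
          \<Longrightarrow> \<exists>c \<in> homset C (Cod C g) (Cod C g'). g' \<cdot> b = c \<cdot> g \<and> h' \<cdot> c = SusM C a \<cdot> h"
    and octahedron: "\<lbrakk>(f, a, b) \<in> Tri C; (g, c, d) \<in> Tri C; Cod C f = Dom C g; (g \<cdot> f, e, h) \<in> Tri C\<rbrakk>
          \<Longrightarrow> \<exists>u \<in> homset C (Cod C a) (Cod C e). \<exists>v \<in> homset C (Cod C e) (Cod C c).
                (u, v, SusM C a \<cdot> d) \<in> Tri C \<and> u \<cdot> a = e \<cdot> g \<and> v \<cdot> e = c \<and>
                h \<cdot> u = b \<and> d \<cdot> v = SusM C f \<cdot> h"

subsection \<open>Compatible symmetric monoidal structure\<close>

definition run :: "('o, 'm, 'i) stable_data \<Rightarrow> 'o \<Rightarrow> 'm" where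
  "run C A = Cmp C (Lun C A) (Sym C A (Sph C))"

definition sex_right :: "('o, 'm, 'i) stable_data \<Rightarrow> 'o \<Rightarrow> 'o \<Rightarrow> 'm" where
  "sex_right C A B = Cmp C (SusM C (Sym C B A)) (Cmp C (Sex C B A) (Sym C A (Sus C B)))"

locale tensor_triangulated_category = triangulated_category +
  assumes sph_ob: "Sph C \<in> Ob C"
    and smash_ob: "\<lbrakk>X \<in> Ob C; Y \<in> Ob C\<rbrakk> \<Longrightarrow> X \<odot> Y \<in> Ob C"
    and smash_hom: "\<lbrakk>f \<in> homset C X X'; g \<in> homset C Y Y'\<rbrakk> \<Longrightarrow> f \<star> g \<in> homset C (X \<odot> Y) (X' \<odot> Y')"
    and smash_id: "\<lbrakk>X \<in> Ob C; Y \<in> Ob C\<rbrakk> \<Longrightarrow> Id C X \<star> Id C Y = Id C (X \<odot> Y)"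
    and smash_comp: "\<lbrakk>f \<in> homset C X X'; f' \<in> homset C X' X''; g \<in> homset C Y Y'; g' \<in> homset C Y' Y''\<rbrakk>
          \<Longrightarrow> (f' \<cdot> f) \<star> (g' \<cdot> g) = (f' \<star> g') \<cdot> (f \<star> g)"
    and smash_plus: "\<lbrakk>f \<in> homset C X X'; f' \<in> homset C X X'; g \<in> homset C Y Y'\<rbrakk>
          \<Longrightarrow> Plus C f f' \<star> g = Plus C (f \<star> g) (f' \<star> g)"
    and asc_iso: "\<lbrakk>X \<in> Ob C; Y \<in> Ob C; Z \<in> Ob C\<rbrakk>
          \<Longrightarrow> iso_in C (Asc C X Y Z) ((X \<odot> Y) \<odot> Z) (X \<odot> (Y \<odot> Z))"
    and asc_nat: "\<lbrakk>f \<in> homset C X X'; g \<in> homset C Y Y'; h \<in> homset C Z Z'\<rbrakk>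
          \<Longrightarrow> Asc C X' Y' Z' \<cdot> ((f \<star> g) \<star> h) = (f \<star> (g \<star> h)) \<cdot> Asc C X Y Z"
    and lun_iso: "X \<in> Ob C \<Longrightarrow> iso_in C (Lun C X) (Sph C \<odot> X) X"
    and lun_nat: "f \<in> homset C X Y \<Longrightarrow> Lun C Y \<cdot> (Id C (Sph C) \<star> f) = f \<cdot> Lun C X"
    and sym_iso: "\<lbrakk>X \<in> Ob C; Y \<in> Ob C\<rbrakk> \<Longrightarrow> iso_in C (Sym C X Y) (X \<odot> Y) (Y \<odot> X)"
    and sym_nat: "\<lbrakk>f \<in> homset C X X'; g \<in> homset C Y Y'\<rbrakk>
          \<Longrightarrow> Sym C X' Y' \<cdot> (f \<star> g) = (g \<star> f) \<cdot> Sym C X Y"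
    and sym_sym: "\<lbrakk>X \<in> Ob C; Y \<in> Ob C\<rbrakk> \<Longrightarrow> Sym C Y X \<cdot> Sym C X Y = Id C (X \<odot> Y)"
    and pentagon: "\<lbrakk>W \<in> Ob C; X \<in> Ob C; Y \<in> Ob C; Z \<in> Ob C\<rbrakk>
          \<Longrightarrow> Asc C W X (Y \<odot> Z) \<cdot> Asc C (W \<odot> X) Y Z =
              (Id C W \<star> Asc C X Y Z) \<cdot> Asc C W (X \<odot> Y) Z \<cdot> (Asc C W X Y \<star> Id C Z)"
    and triangle: "\<lbrakk>X \<in> Ob C; Y \<in> Ob C\<rbrakk>
          \<Longrightarrow> (Id C X \<star> Lun C Y) \<cdot> Asc C X (Sph C) Y = run C X \<star> Id C Y"
    and hexagon: "\<lbrakk>X \<in> Ob C; Y \<in> Ob C; Z \<in> Ob C\<rbrakk>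
          \<Longrightarrow> Asc C Y Z X \<cdot> Sym C X (Y \<odot> Z) \<cdot> Asc C X Y Z =
              (Id C Y \<star> Sym C X Z) \<cdot> Asc C Y X Z \<cdot> (Sym C X Y \<star> Id C Z)"
    and sex_iso: "\<lbrakk>A \<in> Ob C; X \<in> Ob C\<rbrakk> \<Longrightarrow> iso_in C (Sex C A X) (Sus C A \<odot> X) (Sus C (A \<odot> X))"
    and sex_nat: "\<lbrakk>f \<in> homset C A B; g \<in> homset C X Y\<rbrakk>
          \<Longrightarrow> Sex C B Y \<cdot> (SusM C f \<star> g) = SusM C (f \<star> g) \<cdot> Sex C A X"
    and sex_unit: "A \<in> Ob C \<Longrightarrow> SusM C (run C A) \<cdot> Sex C A (Sph C) = run C (Sus C A)"
    and sex_asc: "\<lbrakk>A \<in> Ob C; X \<in> Ob C; Y \<in> Ob C\<rbrakk>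
          \<Longrightarrow> Sex C A (X \<odot> Y) \<cdot> Asc C (Sus C A) X Y =
              SusM C (Asc C A X Y) \<cdot> Sex C (A \<odot> X) Y \<cdot> (Sex C A X \<star> Id C Y)"
    and sex_sign: "\<lbrakk>A \<in> Ob C; B \<in> Ob C\<rbrakk>
          \<Longrightarrow> SusM C (sex_right C A B) \<cdot> Sex C A (Sus C B) =
              neg C (SusM C (Sex C A B) \<cdot> sex_right C (Sus C A) B)"
    and smash_exact: "\<lbrakk>(f, g, h) \<in> Tri C; X \<in> Ob C\<rbrakk>
          \<Longrightarrow> (f \<star> Id C X, g \<star> Id C X, Sex C (Dom C f) X \<cdot> (h \<star> Id C X)) \<in> Tri C"
    and smash_coproduct: "\<lbrakk>Small C I; \<And>i. i \<in> I \<Longrightarrow> D i \<in> Ob C; is_coproduct C I D Q j; Y \<in> Ob C\<rbrakk>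
          \<Longrightarrow> is_coproduct C I (\<lambda>i. D i \<odot> Y) (Q \<odot> Y) (\<lambda>i. j i \<star> Id C Y)"

subsection \<open>The unit as a compact generator\<close>

locale monogenic_stable_category = tensor_triangulated_category +
  assumes sph_small: "\<lbrakk>Small C I; \<And>i. i \<in> I \<Longrightarrow> D i \<in> Ob C; is_coproduct C I D Q j;
            a \<in> homset C (Sph C) Q\<rbrakk>
          \<Longrightarrow> \<exists>F g. finite F \<and> F \<subseteq> I \<and> (\<forall>i\<in>F. g i \<in> homset C (Sph C) (D i)) \<and>
                a = finprod (hom_group C (Sph C) Q) (\<lambda>i. j i \<cdot> g i) F"
    and sph_generates: "\<lbrakk>X \<in> Ob C; \<And>n. trivial_group (homotopy_group C n X)\<rbrakk> \<Longrightarrow> zero_object C X"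
    and homotopy_small: "X \<in> Ob C \<Longrightarrow> \<exists>I. Small C I \<and> carrier (homotopy_group C n X) \<lesssim> I"


section \<open>Finite pointed complexes\<close>

inductive finite_cell_complex :: "(nat \<Rightarrow> real) topology \<Rightarrow> bool" where
  empty: "topspace X = {} \<Longrightarrow> finite_cell_complex X"
| attach: "\<lbrakk>Hausdorff_space X; closedin X A; finite_cell_complex (subtopology X A);
     continuous_map (subtopology (Euclidean_space n) {x. (\<Sum>i<n. x i ^ 2) \<le> 1}) X \<phi>;
     \<phi> ` {x \<in> topspace (Euclidean_space n). (\<Sum>i<n. x i ^ 2) = 1} \<subseteq> A;
     bij_betw \<phi> {x \<in> topspace (Euclidean_space n). (\<Sum>i<n. x i ^ 2) < 1} (topspace X - A)\<rbrakk>
   \<Longrightarrow> finite_cell_complex X"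

type_synonym pspace = "(nat \<Rightarrow> real) topology \<times> (nat \<Rightarrow> real)"

definition finite_pointed :: "pspace \<Rightarrow> bool" where
  "finite_pointed K \<longleftrightarrow> finite_cell_complex (fst K) \<and> snd K \<in> topspace (fst K)"

definition pointed_map :: "pspace \<Rightarrow> pspace \<Rightarrow> ((nat \<Rightarrow> real) \<Rightarrow> nat \<Rightarrow> real) \<Rightarrow> bool" where
  "pointed_map K L f \<longleftrightarrow> continuous_map (fst K) (fst L) f \<and> f (snd K) = snd L"

definition pointed_homotopic ::
    "pspace \<Rightarrow> pspace \<Rightarrow> ((nat \<Rightarrow> real) \<Rightarrow> nat \<Rightarrow> real) \<Rightarrow> ((nat \<Rightarrow> real) \<Rightarrow> nat \<Rightarrow> real) \<Rightarrow> bool" where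
  "pointed_homotopic K L f g \<longleftrightarrow> homotopic_with (\<lambda>h. h (snd K) = snd L) (fst K) (fst L) f g"

definition pointed_sphere :: "nat \<Rightarrow> pspace" where
  "pointed_sphere n = (nsphere n, \<lambda>i. if i = 0 then 1 else 0)"

text \<open>\<open>P\<close> is the smash product of \<open>K\<close> and \<open>L\<close>, with collapse map \<open>q\<close>.\<close>

definition is_smash ::
    "pspace \<Rightarrow> pspace \<Rightarrow> pspace \<Rightarrow> ((nat \<Rightarrow> real) \<times> (nat \<Rightarrow> real) \<Rightarrow> nat \<Rightarrow> real) \<Rightarrow> bool" where
  "is_smash K L P q \<longleftrightarrow>
     quotient_map (prod_topology (fst K) (fst L)) (fst P) q \<and> q (snd K, snd L) = snd P \<and>
     (\<forall>x \<in> topspace (fst K) \<times> topspace (fst L). \<forall>y \<in> topspace (fst K) \<times> topspace (fst L).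
        q x = q y \<longleftrightarrow>
          x = y \<or> ((fst x = snd K \<or> snd x = snd L) \<and> (fst y = snd K \<or> snd y = snd L)))"

text \<open>\<open>Q\<close> is \<open>K / A\<close>, with collapse map \<open>c\<close>.\<close>

definition is_collapse ::
    "pspace \<Rightarrow> (nat \<Rightarrow> real) set \<Rightarrow> pspace \<Rightarrow> ((nat \<Rightarrow> real) \<Rightarrow> nat \<Rightarrow> real) \<Rightarrow> bool" where
  "is_collapse K A Q c \<longleftrightarrow>
     quotient_map (fst K) (fst Q) c \<and> c (snd K) = snd Q \<and>
     (\<forall>x \<in> topspace (fst K). \<forall>y \<in> topspace (fst K). c x = c y \<longleftrightarrow> x = y \<or> (x \<in> A \<and> y \<in> A))"


section \<open>The \<open>p\<close>-local stable homotopy category\<close>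

text \<open>
  Margolis' axiomatic description of the stable homotopy category (\<open>Spectra and the Steenrod
  Algebra\<close>, Chapter 2), localised at \<open>p\<close>: a monogenic tensor triangulated category with coproducts
  whose part generated by the unit is the Spanier-Whitehead category of finite pointed complexes.
  \<open>T\<close> and \<open>TM\<close> are the \<open>p\<close>-local suspension spectrum functor on spaces and maps,
  \<open>\<epsilon>\<close> compares the unit with \<open>T S\<^sup>0\<close>, and \<open>\<mu>\<close> compares the smash products.
  The assumptions \<open>full\<close> and \<open>faithful\<close> say that \<open>T\<close> identifies the groups of arrows
  \<open>T K \<rightarrow> T L\<close> with the \<open>p\<close>-localisation of the group of stable maps: each arrow has a multiple prime
  to \<open>p\<close> which is, after smashing with some sphere, the image of a map of spaces; and the image of a
  map \<open>f\<close> vanishes only if \<open>f\<close> becomes null-homotopic after smashing with a self-map of some sphere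
  of degree prime to \<open>p\<close>, that is, if a multiple of \<open>f\<close> prime to \<open>p\<close> is stably null-homotopic.
\<close>

locale suspension_spectrum_functor = monogenic_stable_category C
  for C :: "('o, 'm, 'i) stable_data" (structure) +
  fixes p :: nat
    and T :: "pspace \<Rightarrow> 'o"
    and TM :: "pspace \<Rightarrow> pspace \<Rightarrow> ((nat \<Rightarrow> real) \<Rightarrow> nat \<Rightarrow> real) \<Rightarrow> 'm"
    and \<epsilon> :: 'm
    and \<mu> :: "pspace \<Rightarrow> pspace \<Rightarrow> pspace \<Rightarrow> ((nat \<Rightarrow> real) \<times> (nat \<Rightarrow> real) \<Rightarrow> nat \<Rightarrow> real) \<Rightarrow> 'm"
  assumes T_ob: "finite_pointed K \<Longrightarrow> T K \<in> Ob C"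
    and T_hom: "\<lbrakk>finite_pointed K; finite_pointed L; pointed_map K L f\<rbrakk>
          \<Longrightarrow> TM K L f \<in> homset C (T K) (T L)"
    and T_homotopic: "\<lbrakk>finite_pointed K; finite_pointed L; pointed_homotopic K L f g\<rbrakk>
          \<Longrightarrow> TM K L f = TM K L g"
    and T_id: "finite_pointed K \<Longrightarrow> TM K K (\<lambda>x. x) = Id C (T K)"
    and T_comp: "\<lbrakk>finite_pointed K; finite_pointed L; finite_pointed M;
            pointed_map K L f; pointed_map L M g\<rbrakk> \<Longrightarrow> TM K M (g \<circ> f) = TM L M g \<cdot> TM K L f"
    and T_cofibre: "\<lbrakk>finite_pointed K; closedin (fst K) A; finite_pointed (subtopology (fst K) A, snd K);
            finite_pointed Q; is_collapse K A Q c\<rbrakk>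
          \<Longrightarrow> \<exists>h. (TM (subtopology (fst K) A, snd K) K (\<lambda>x. x), TM K Q c, h) \<in> Tri C"
    and \<epsilon>_iso: "iso_in C \<epsilon> (Sph C) (T (pointed_sphere 0))"
    and \<mu>_iso: "\<lbrakk>finite_pointed K; finite_pointed L; finite_pointed P; is_smash K L P q\<rbrakk>
          \<Longrightarrow> iso_in C (\<mu> K L P q) (T K \<odot> T L) (T P)"
    and \<mu>_nat: "\<lbrakk>finite_pointed K; finite_pointed L; finite_pointed P; is_smash K L P q;
            finite_pointed K'; finite_pointed L'; finite_pointed P'; is_smash K' L' P' q';
            pointed_map K K' f; pointed_map L L' g; pointed_map P P' h;
            \<And>a b. \<lbrakk>a \<in> topspace (fst K); b \<in> topspace (fst L)\<rbrakk> \<Longrightarrow> h (q (a, b)) = q' (f a, g b)\<rbrakk>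
          \<Longrightarrow> TM P P' h \<cdot> \<mu> K L P q = \<mu> K' L' P' q' \<cdot> (TM K K' f \<star> TM L L' g)"
    and \<mu>_unit: "\<lbrakk>finite_pointed K; finite_pointed P; is_smash (pointed_sphere 0) K P q\<rbrakk>
          \<Longrightarrow> TM K P (\<lambda>k. q (\<lambda>i. if i = 0 then -1 else 0, k)) \<cdot> Lun C (T K) =
              \<mu> (pointed_sphere 0) K P q \<cdot> (\<epsilon> \<star> Id C (T K))"
    and \<mu>_sym: "\<lbrakk>finite_pointed K; finite_pointed L; finite_pointed P; is_smash K L P q\<rbrakk>
          \<Longrightarrow> \<mu> L K P (\<lambda>(b, a). q (a, b)) \<cdot> Sym C (T K) (T L) = \<mu> K L P q"
    and \<mu>_asc: "\<lbrakk>finite_pointed K; finite_pointed L; finite_pointed M;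
            finite_pointed P; is_smash K L P q; finite_pointed P'; is_smash L M P' q';
            finite_pointed R; is_smash P M R r; is_smash K P' R r';
            \<And>a b c. \<lbrakk>a \<in> topspace (fst K); b \<in> topspace (fst L); c \<in> topspace (fst M)\<rbrakk>
              \<Longrightarrow> r (q (a, b), c) = r' (a, q' (b, c))\<rbrakk>
          \<Longrightarrow> \<mu> P M R r \<cdot> (\<mu> K L P q \<star> Id C (T M)) =
              \<mu> K P' R r' \<cdot> (Id C (T K) \<star> \<mu> L M P' q') \<cdot> Asc C (T K) (T L) (T M)"
    and full: "\<lbrakk>finite_pointed K; finite_pointed L; a \<in> homset C (T K) (T L)\<rbrakk>
          \<Longrightarrow> \<exists>m n P q P' q' f. \<not> p dvd m \<and>
                finite_pointed P \<and> is_smash (pointed_sphere n) K P q \<and>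
                finite_pointed P' \<and> is_smash (pointed_sphere n) L P' q' \<and> pointed_map P P' f \<and>
                TM P P' f \<cdot> \<mu> (pointed_sphere n) K P q =
                \<mu> (pointed_sphere n) L P' q' \<cdot> (Id C (T (pointed_sphere n)) \<star> multiple C m a)"
    and faithful: "\<lbrakk>finite_pointed K; finite_pointed L; pointed_map K L f;
            TM K L f = Zer C (T K) (T L)\<rbrakk>
          \<Longrightarrow> \<exists>n g P q P' q' h. pointed_map (pointed_sphere n) (pointed_sphere n) g \<and>
                \<not> int p dvd Brouwer_degree2 n g \<and>
                finite_pointed P \<and> is_smash (pointed_sphere n) K P q \<and>
                finite_pointed P' \<and> is_smash (pointed_sphere n) L P' q' \<and> pointed_map P P' h \<and>
                (\<forall>a \<in> topspace (nsphere n). \<forall>b \<in> topspace (fst K). h (q (a, b)) = q' (g a, f b)) \<and>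
                pointed_homotopic P P' h (\<lambda>_. snd P')"

definition p_local_stable_homotopy_category :: "nat \<Rightarrow> ('o, 'm, 'i) stable_data \<Rightarrow> bool" where
  "p_local_stable_homotopy_category p C \<longleftrightarrow>
     (\<exists>T TM \<epsilon> \<mu>. suspension_spectrum_functor C p T TM \<epsilon> \<mu>) \<and>
     (\<forall>X \<in> Ob C. \<forall>n. \<forall>q. prime q \<and> q \<noteq> p \<longrightarrow>
        bij_betw (\<lambda>a. a [^]\<^bsub>homotopy_group C n X\<^esub> q)
          (carrier (homotopy_group C n X)) (carrier (homotopy_group C n X)))"

text \<open>The mod \<open>p\<close> Eilenberg-Mac Lane spectrum, which is determined up to isomorphism by its
  homotopy groups.\<close>

definition mod_p_eilenberg_maclane :: "nat \<Rightarrow> ('o, 'm, 'i) stable_data \<Rightarrow> 'o \<Rightarrow> bool" where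
  "mod_p_eilenberg_maclane p C H \<longleftrightarrow> H \<in> Ob C \<and>
     homotopy_group C 0 H \<cong> integer_mod_group p \<and>
     (\<forall>n. n \<noteq> 0 \<longrightarrow> trivial_group (homotopy_group C n H))"


section \<open>The Bousfield lattice\<close>

definition bousfield_class :: "('o, 'm, 'i) stable_data \<Rightarrow> 'o \<Rightarrow> 'o set" where
  "bousfield_class C E = {Z \<in> Ob C. zero_object C (Smash C E Z)}"

definition bousfield_lattice :: "('o, 'm, 'i) stable_data \<Rightarrow> 'o set set" where
  "bousfield_lattice C = bousfield_class C ` Ob C"

text \<open>The ordering is reverse inclusion of the collections of acyclics.\<close>

definition bousfield_le :: "'o set \<Rightarrow> 'o set \<Rightarrow> bool" where
  "bousfield_le b c \<longleftrightarrow> (\<forall>Z. Z \<in> c \<longrightarrow> Z \<in> b)"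

definition is_bousfield_join :: "('o, 'm, 'i) stable_data \<Rightarrow> 'o set set \<Rightarrow> 'o set \<Rightarrow> bool" where
  "is_bousfield_join C A b \<longleftrightarrow>
     b \<in> bousfield_lattice C \<and> (\<forall>a\<in>A. bousfield_le a b) \<and>
     (\<forall>c \<in> bousfield_lattice C. (\<forall>a\<in>A. bousfield_le a c) \<longrightarrow> bousfield_le b c)"

definition bousfield_Join :: "('o, 'm, 'i) stable_data \<Rightarrow> 'o set set \<Rightarrow> 'o set" where
  "bousfield_Join C A = (THE b. is_bousfield_join C A b)"

definition bousfield_smash :: "('o, 'm, 'i) stable_data \<Rightarrow> 'o set \<Rightarrow> 'o set \<Rightarrow> 'o set" where
  "bousfield_smash C b c =
     (THE d. \<exists>E \<in> Ob C. \<exists>F \<in> Ob C. b = bousfield_class C E \<and> c = bousfield_class C F \<and>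
        d = bousfield_class C (Smash C E F))"

definition bousfield_DL :: "('o, 'm, 'i) stable_data \<Rightarrow> 'o set set" where
  "bousfield_DL C = {b \<in> bousfield_lattice C. b = bousfield_smash C b b}"

definition bousfield_r :: "('o, 'm, 'i) stable_data \<Rightarrow> 'o set \<Rightarrow> 'o set" where
  "bousfield_r C b = bousfield_Join C {c \<in> bousfield_DL C. bousfield_le c b}"

definition strange_ideal :: "('o, 'm, 'i) stable_data \<Rightarrow> 'o \<Rightarrow> 'o set set" where
  "strange_ideal C H =
     {b \<in> bousfield_lattice C. bousfield_le b (bousfield_class C H) \<and> b \<noteq> bousfield_class C H}"

definition bousfield_cong ::
    "('o, 'm, 'i) stable_data \<Rightarrow> 'o set set \<Rightarrow> 'o set \<Rightarrow> 'o set \<Rightarrow> bool" where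
  "bousfield_cong C J x y \<longleftrightarrow>
     (\<exists>z\<in>J. bousfield_Join C {x, z} = bousfield_Join C {y, z})"

end

theory Submission
  imports Defs "HOL-Analysis.Weierstrass_Theorems"
begin

text \<open>
  Everything rests on the minimality of \<open>\<langle>H\<rangle>\<close>: if \<open>H \<odot> E\<close> is nonzero then \<open>\<langle>H\<rangle> \<le> \<langle>E\<rangle>\<close>.  It implies that
  strange spectra are annihilated by \<open>H\<close>.  Now let \<open>z\<close> be strange with \<open>X \<or> z = Y \<or> z\<close>, and let
  \<open>D = D \<odot> D \<le> X\<close>, so \<open>D \<le> Y \<or> z\<close>.  If \<open>H \<odot> D = 0\<close>, then \<open>z \<odot> D = 0\<close>, so
  \<open>D = D \<odot> D \<le> (Y \<or> z) \<odot> D = Y \<odot> D \<le> Y\<close>.  Otherwise \<open>H \<odot> (Y \<or> z) \<noteq> 0\<close>, so \<open>H \<odot> Y \<noteq> 0\<close>, and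
  minimality gives \<open>z \<le> H \<le> Y\<close> and again \<open>D \<le> Y\<close>.  Hence \<open>X\<close> and \<open>Y\<close> have the same classes of
  \<open>DL\<close> below them.

  For minimality one shows that \<open>H \<odot> E\<close> is a coproduct of suspensions of \<open>H\<close>.  A generator
  \<open>u : Sph \<rightarrow> H\<close> becomes split after smashing with \<open>H\<close>, for dimensional reasons, and this
  unital multiplication extends each homotopy class of \<open>H \<odot> E\<close> to an arrow from a suspension of \<open>H\<close>;
  a basis of the homotopy over the prime field then gives an equivalence.

  The only geometric input is that the sphere spectrum has no homotopy in negative degrees, that is,
  that maps from a sphere to a sphere of larger dimension are null-homotopic.
\<close>

text \<open>\<open>H\<close> is given only through its homotopy groups, so its multiplication has to
  come from obstruction theory. With \<open>Hb\<close> the cofibre of the unit,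
  \<open>Hb \<odot> Hb\<close> should have cells only in dimensions at least 2, where
  \<open>Sus C H\<close> has no homotopy. Instead of a skeletal filtration, an arrow out of a
  connective object smashed with \<open>G\<close> is extended along a sequence of arrows that are
  zero on homotopy; the telescope of such a sequence is a zero object.

  On the geometric side two gaps are bridged. An arrow between spheres comes from a map of spaces
  only after taking a multiple prime to \<open>p\<close> and smashing with a further sphere: the
  multiple is removed by locality, the sphere because smashing with it is faithful. And a smash
  product of spheres is known only through its quotient map, so stereographic coordinates identify
  it with a sphere. The null-homotopy itself rests on a count: a Lipschitz image of a
  \<open>k\<close>-sphere consists of too few small pieces to meet the rays through all points of a
  fine grid in an \<open>N\<close>-cube when \<open>k < N\<close>.\<close>

no_notation smult (infixl "\<odot>\<index>" 70)

section \<open>Additive categories\<close>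

context additive_category_with_coproducts
begin

abbreviation hom where "hom \<equiv> homset C"
abbreviation zero where "zero \<equiv> Zer C"

lemma homset_iff: "f \<in> hom X Y \<longleftrightarrow> f \<in> Ar C \<and> Dom C f = X \<and> Cod C f = Y"
  by (simp add: homset_def)

lemma arrow_comp:
  assumes "f \<in> Ar C" "g \<in> Ar C" "Cod C f = Dom C g"
  shows "g \<cdot> f \<in> Ar C" "Dom C (g \<cdot> f) = Dom C f" "Cod C (g \<cdot> f) = Cod C g"
  using comp_hom[of f "Dom C f" "Cod C f" g "Cod C g"] assms by (simp_all add: homset_def)

lemma arrow_assoc:
  assumes "f \<in> Ar C" "g \<in> Ar C" "h \<in> Ar C" "Cod C f = Dom C g" "Cod C g = Dom C h"
  shows "(h \<cdot> g) \<cdot> f = h \<cdot> (g \<cdot> f)"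
  using comp_assoc[of f "Dom C f" "Cod C f" g "Cod C g" h "Cod C h"] assms
  by (simp add: homset_def)

lemma arrow_id:
  "X \<in> Ob C \<Longrightarrow> Id C X \<in> Ar C" "X \<in> Ob C \<Longrightarrow> Dom C (Id C X) = X"
  "X \<in> Ob C \<Longrightarrow> Cod C (Id C X) = X"
  "f \<in> Ar C \<Longrightarrow> Dom C f = X \<Longrightarrow> f \<cdot> Id C X = f"
  "f \<in> Ar C \<Longrightarrow> Cod C f = X \<Longrightarrow> Id C X \<cdot> f = f"
  using id_hom[of X] comp_id[of f "Dom C f" "Cod C f"] by (auto simp: homset_def)

lemmas arrow_simps = homset_iff arrow_comp arrow_assoc arrow_id dom_cod

text \<open>Connectivity is phrased by this relation and not by homotopy groups, since it passes
  along isomorphisms and simultaneous suspension of both arguments.\<close>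

definition orth :: "'o \<Rightarrow> 'o \<Rightarrow> bool" where
  "orth X Y \<longleftrightarrow> (\<forall>f \<in> hom X Y. f = zero X Y)"

lemma orthD: "orth X Y \<Longrightarrow> f \<in> hom X Y \<Longrightarrow> f = zero X Y"
  by (simp add: orth_def)

lemma hom_Ob: "f \<in> hom X Y \<Longrightarrow> X \<in> Ob C \<and> Y \<in> Ob C"
  using dom_cod by (auto simp: homset_def)

lemma zero_hom [simp, intro]: "X \<in> Ob C \<Longrightarrow> Y \<in> Ob C \<Longrightarrow> zero X Y \<in> hom X Y"
  using hom_group[of X Y] monoid.one_closed[of "hom_group C X Y"]
  by (simp add: comm_group_def comm_monoid_def hom_group_def)

lemma hom_carrier [simp]: "carrier (hom_group C X Y) = hom X Y"
  and hom_mult [simp]: "monoid.mult (hom_group C X Y) = Plus C"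
  and hom_one [simp]: "one (hom_group C X Y) = zero X Y"
  by (simp_all add: hom_group_def)

lemma hom_is_group: "f \<in> hom X Y \<Longrightarrow> comm_group (hom_group C X Y)"
  using hom_group hom_Ob by blast

lemma plus_hom: "f \<in> hom X Y \<Longrightarrow> g \<in> hom X Y \<Longrightarrow> Plus C f g \<in> hom X Y"
  using monoid.m_closed[of "hom_group C X Y" f g] hom_is_group[of f X Y]
  by (simp add: comm_group_def comm_monoid_def)

lemma plus_zero:
  assumes "f \<in> hom X Y"
  shows "Plus C f (zero X Y) = f" "Plus C (zero X Y) f = f"
  using monoid.r_one[of "hom_group C X Y" f] monoid.l_one[of "hom_group C X Y" f]
    hom_is_group[of f X Y] assms
  by (simp_all add: comm_group_def comm_monoid_def)

lemma neg_eq: "f \<in> hom X Y \<Longrightarrow> neg C f = inv\<^bsub>hom_group C X Y\<^esub> f"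
  by (auto simp: neg_def homset_def)

lemma multiple_eq: "f \<in> hom X Y \<Longrightarrow> multiple C n f = f [^]\<^bsub>hom_group C X Y\<^esub> n"
  by (auto simp: multiple_def homset_def)

lemma neg_hom: "f \<in> hom X Y \<Longrightarrow> neg C f \<in> hom X Y"
  using group.inv_closed[of "hom_group C X Y" f] hom_is_group[of f X Y]
  by (simp add: neg_eq comm_group_def)

lemma plus_neg:
  assumes "f \<in> hom X Y"
  shows "Plus C f (neg C f) = zero X Y" "Plus C (neg C f) f = zero X Y"
  using group.r_inv[of "hom_group C X Y" f] group.l_inv[of "hom_group C X Y" f]
    hom_is_group[of f X Y] assms
  by (simp_all add: comm_group_def neg_eq)

lemma plus_idem: "f \<in> hom X Y \<Longrightarrow> Plus C f f = f \<Longrightarrow> f = zero X Y"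
  using group.r_cancel_one[of "hom_group C X Y" f f] hom_is_group[of f X Y]
  by (simp add: comm_group_def)

lemma plus_eq_zeroD:
  "f \<in> hom X Y \<Longrightarrow> g \<in> hom X Y \<Longrightarrow> Plus C f g = zero X Y \<Longrightarrow> f = neg C g"
  using group.inv_equality[of "hom_group C X Y" f g] hom_is_group[of f X Y]
  by (simp add: comm_group_def neg_eq)

lemma neg_neg: "f \<in> hom X Y \<Longrightarrow> neg C (neg C f) = f"
  using group.inv_inv[of "hom_group C X Y" f] hom_is_group[of f X Y] neg_hom[of f X Y]
  by (simp add: comm_group_def neg_eq)

lemma neg_zero: "X \<in> Ob C \<Longrightarrow> Y \<in> Ob C \<Longrightarrow> neg C (zero X Y) = zero X Y"
  using plus_eq_zeroD[of "zero X Y" X Y "zero X Y"] plus_zero(1)[of "zero X Y" X Y] by simp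

lemma comp_zero_left: "f \<in> hom X Y \<Longrightarrow> Z \<in> Ob C \<Longrightarrow> zero Y Z \<cdot> f = zero X Z"
proof -
  assume f: "f \<in> hom X Y" and Z: "Z \<in> Ob C"
  have z: "zero Y Z \<in> hom Y Z" using f Z hom_Ob by blast
  have "Plus C (zero Y Z \<cdot> f) (zero Y Z \<cdot> f) = zero Y Z \<cdot> f"
    using comp_plus_left[OF f z z] plus_zero(1)[OF z] by simp
  then show ?thesis using plus_idem comp_hom[OF f z] by blast
qed

lemma comp_zero_right: "f \<in> hom Y Z \<Longrightarrow> X \<in> Ob C \<Longrightarrow> f \<cdot> zero X Y = zero X Z"
proof -
  assume f: "f \<in> hom Y Z" and Z: "X \<in> Ob C"
  have z: "zero X Y \<in> hom X Y" using f Z hom_Ob by blast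
  have "Plus C (f \<cdot> zero X Y) (f \<cdot> zero X Y) = f \<cdot> zero X Y"
    using comp_plus_right[OF z z f] plus_zero(1)[OF z] by simp
  then show ?thesis using plus_idem comp_hom[OF z f] by blast
qed

lemma comp_neg_right:
  assumes f: "f \<in> hom X Y" and g: "g \<in> hom Y Z"
  shows "g \<cdot> neg C f = neg C (g \<cdot> f)"
proof -
  have "Plus C (g \<cdot> neg C f) (g \<cdot> f) = zero X Z"
    using comp_plus_right[OF neg_hom[OF f] f g] plus_neg(2)[OF f] comp_zero_right[OF g]
      hom_Ob[OF f] by simp
  then show ?thesis
    using plus_eq_zeroD comp_hom[OF f g] comp_hom[OF neg_hom[OF f] g] by blast
qed

lemma comp_neg_left:
  assumes f: "f \<in> hom X Y" and g: "g \<in> hom Y Z"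
  shows "neg C g \<cdot> f = neg C (g \<cdot> f)"
proof -
  have "Plus C (neg C g \<cdot> f) (g \<cdot> f) = zero X Z"
    using comp_plus_left[OF f neg_hom[OF g] g] plus_neg(2)[OF g] comp_zero_left[OF f]
      hom_Ob[OF g] by simp
  then show ?thesis
    using plus_eq_zeroD comp_hom[OF f g] comp_hom[OF f neg_hom[OF g]] by blast
qed

lemma neg_eq_zero: "f \<in> hom X Y \<Longrightarrow> neg C f = zero X Y \<Longrightarrow> f = zero X Y"
  by (metis hom_Ob neg_neg neg_zero)

lemma multiple_hom: "f \<in> hom X Y \<Longrightarrow> multiple C n f \<in> hom X Y"
  using monoid.nat_pow_closed[of "hom_group C X Y" f n] hom_is_group[of f X Y]
  by (simp add: multiple_eq comm_group_def comm_monoid_def)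

lemma multiple_0: "f \<in> hom X Y \<Longrightarrow> multiple C 0 f = zero X Y"
  using hom_is_group[of f X Y] monoid.nat_pow_0[of "hom_group C X Y" f]
  by (simp add: multiple_eq)

lemma multiple_Suc: "f \<in> hom X Y \<Longrightarrow> multiple C (Suc n) f = Plus C (multiple C n f) f"
  using hom_is_group[of f X Y] monoid.nat_pow_Suc[of "hom_group C X Y" f n]
  by (simp add: multiple_eq)

lemma multiple_comp_left:
  assumes f: "f \<in> hom X Y" and g: "g \<in> hom Y Z"
  shows "multiple C n g \<cdot> f = multiple C n (g \<cdot> f)"
proof (induction n)
  case 0
  then show ?case
    using multiple_0[OF g] multiple_0[OF comp_hom[OF f g]] comp_zero_left[OF f] hom_Ob[OF g] by simp
next
  case (Suc n)
  then show ?case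
    using multiple_Suc[OF g, of n] multiple_Suc[OF comp_hom[OF f g], of n]
      comp_plus_left[OF f multiple_hom[OF g] g, of n] by simp
qed

lemma multiple_comp_right:
  assumes f: "f \<in> hom X Y" and g: "g \<in> hom Y Z"
  shows "g \<cdot> multiple C n f = multiple C n (g \<cdot> f)"
proof (induction n)
  case 0
  then show ?case
    using multiple_0[OF f] multiple_0[OF comp_hom[OF f g]] comp_zero_right[OF g] hom_Ob[OF f] by simp
next
  case (Suc n)
  then show ?case
    using multiple_Suc[OF f, of n] multiple_Suc[OF comp_hom[OF f g], of n]
      comp_plus_right[OF multiple_hom[OF f] f g, of n] by simp
qed

section \<open>Zero objects and isomorphisms\<close>

lemma zero_object_iff: "zero_object C X \<longleftrightarrow> X \<in> Ob C \<and> Id C X = zero X X"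
proof (intro iffI conjI)
  show "X \<in> Ob C" if "zero_object C X" using that by (simp add: zero_object_def)
  show "Id C X = zero X X" if "zero_object C X"
    using that id_hom unfolding zero_object_def by blast
  assume a: "X \<in> Ob C \<and> Id C X = zero X X"
  have 1: "f = zero X Y" if "f \<in> hom X Y" for f Y
    by (metis a comp_id comp_zero_right hom_Ob that)
  have 2: "f = zero Y X" if "f \<in> hom Y X" for f Y
    by (metis a comp_id comp_zero_left hom_Ob that)
  show "zero_object C X"
    unfolding zero_object_def using 1 2 a by blast
qed

lemma zero_object_source: "zero_object C X \<Longrightarrow> orth X Y"
  by (metis comp_id comp_zero_right hom_Ob orth_def zero_object_iff)

lemma zero_object_target: "zero_object C Y \<Longrightarrow> orth X Y"
  by (metis comp_id comp_zero_left hom_Ob orth_def zero_object_iff)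

lemma zero_object_retract:
  assumes "zero_object C Y" "i \<in> hom X Y" "r \<in> hom Y X" "r \<cdot> i = Id C X"
  shows "zero_object C X"
  by (metis assms comp_zero_right hom_Ob orth_def zero_object_iff zero_object_target)

definition isomorphic :: "'o \<Rightarrow> 'o \<Rightarrow> bool" where
  "isomorphic X Y \<longleftrightarrow> (\<exists>f. iso_in C f X Y)"

lemma iso_in_iff: "iso_in C f X Y \<longleftrightarrow> f \<in> hom X Y \<and> (\<exists>g \<in> hom Y X. g \<cdot> f = Id C X \<and> f \<cdot> g = Id C Y)"
  by (auto simp: iso_in_def iso_arrow_def homset_def)

lemma iso_inE:
  assumes "iso_in C f X Y"
  obtains g where "f \<in> hom X Y" "g \<in> hom Y X" "g \<cdot> f = Id C X" "f \<cdot> g = Id C Y"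
    "X \<in> Ob C" "Y \<in> Ob C" "iso_in C g Y X"
  using assms hom_Ob unfolding iso_in_iff by blast

lemma iso_inI:
  assumes "f \<in> hom X Y" "g \<in> hom Y X" "g \<cdot> f = Id C X" "f \<cdot> g = Id C Y"
  shows "iso_in C f X Y"
  using assms by (auto simp: iso_in_iff)

lemma iso_hom: "iso_in C f X Y \<Longrightarrow> f \<in> hom X Y"
  by (simp add: iso_in_iff)

lemma iso_id: "X \<in> Ob C \<Longrightarrow> iso_in C (Id C X) X X"
  by (rule iso_inI[of _ X X "Id C X"]) (simp_all add: id_hom comp_id[OF id_hom])

lemma iso_comp:
  assumes "iso_in C f X Y" "iso_in C g Y Z" shows "iso_in C (g \<cdot> f) X Z"
proof -
  obtain f' where f: "f \<in> hom X Y" "f' \<in> hom Y X" "f' \<cdot> f = Id C X" "f \<cdot> f' = Id C Y"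
    using assms(1) iso_inE by metis
  obtain g' where g: "g \<in> hom Y Z" "g' \<in> hom Z Y" "g' \<cdot> g = Id C Y" "g \<cdot> g' = Id C Z"
    using assms(2) iso_inE by metis
  have h: "g \<cdot> f \<in> hom X Z" "f' \<cdot> g' \<in> hom Z X"
    using comp_hom[OF f(1) g(1)] comp_hom[OF g(2) f(2)] by auto
  show ?thesis
  proof (rule iso_inI[OF h])
    have "(f' \<cdot> g') \<cdot> (g \<cdot> f) = f' \<cdot> (g' \<cdot> (g \<cdot> f))"
      using comp_assoc[OF h(1) g(2) f(2)] by simp
    also have "g' \<cdot> (g \<cdot> f) = f"
      using comp_assoc[OF f(1) g(1) g(2)] g(3) comp_id[OF f(1)] by simp
    finally show "(f' \<cdot> g') \<cdot> (g \<cdot> f) = Id C X" using f by simp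
    have "(g \<cdot> f) \<cdot> (f' \<cdot> g') = g \<cdot> (f \<cdot> (f' \<cdot> g'))"
      using comp_assoc[OF h(2) f(1) g(1)] by simp
    also have "f \<cdot> (f' \<cdot> g') = g'"
      using comp_assoc[OF g(2) f(2) f(1)] f(4) comp_id[OF g(2)] by simp
    finally show "(g \<cdot> f) \<cdot> (f' \<cdot> g') = Id C Z" using g by simp
  qed
qed

lemma isomorphic_refl: "X \<in> Ob C \<Longrightarrow> isomorphic X X"
  using iso_id isomorphic_def by blast

lemma isomorphic_sym: "isomorphic X Y \<Longrightarrow> isomorphic Y X"
  unfolding isomorphic_def by (metis iso_inE)

lemma isomorphic_trans: "isomorphic X Y \<Longrightarrow> isomorphic Y Z \<Longrightarrow> isomorphic X Z"
  unfolding isomorphic_def using iso_comp by blast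

lemma isomorphic_Ob: "isomorphic X Y \<Longrightarrow> X \<in> Ob C \<and> Y \<in> Ob C"
  unfolding isomorphic_def using hom_Ob iso_hom by blast

lemma isomorphic_zero: "isomorphic X Y \<Longrightarrow> zero_object C X \<Longrightarrow> zero_object C Y"
  by (metis isomorphic_def iso_inE zero_object_retract)

lemma iso_cancel_left:
  assumes f: "iso_in C f Y Z" and a: "a \<in> hom X Y" and b: "b \<in> hom X Y" and eq: "f \<cdot> a = f \<cdot> b"
  shows "a = b"
proof -
  obtain g where g: "f \<in> hom Y Z" "g \<in> hom Z Y" "g \<cdot> f = Id C Y" by (rule iso_inE[OF f])
  have "a = g \<cdot> (f \<cdot> a)" using comp_assoc[OF a g(1,2)] g(3) comp_id[OF a] by simp
  also have "\<dots> = b" using comp_assoc[OF b g(1,2)] g(3) comp_id[OF b] eq by simp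
  finally show ?thesis .
qed

lemma iso_cancel_right:
  assumes f: "iso_in C f X Y" and a: "a \<in> hom Y Z" and b: "b \<in> hom Y Z" and eq: "a \<cdot> f = b \<cdot> f"
  shows "a = b"
proof -
  obtain g where g: "f \<in> hom X Y" "g \<in> hom Y X" "f \<cdot> g = Id C Y" by (rule iso_inE[OF f])
  have "a = (a \<cdot> f) \<cdot> g" using comp_assoc[OF g(2,1) a] g(3) comp_id[OF a] by simp
  also have "\<dots> = b" using comp_assoc[OF g(2,1) b] g(3) comp_id[OF b] eq by simp
  finally show ?thesis .
qed

lemma iso_zero_left:
  assumes "iso_in C f Y Z" "a \<in> hom X Y" "f \<cdot> a = zero X Z" shows "a = zero X Y"
  by (metis assms comp_zero_right hom_Ob iso_cancel_left iso_hom zero_hom)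

lemma iso_zero_right:
  assumes "iso_in C f X Y" "a \<in> hom Y Z" "a \<cdot> f = zero X Z" shows "a = zero Y Z"
  by (metis assms comp_zero_left hom_Ob iso_cancel_right iso_hom zero_hom)

lemma orth_iso:
  assumes "orth X Y" "isomorphic X X'" "isomorphic Y Y'" shows "orth X' Y'"
proof -
  obtain f where f: "iso_in C f X X'" using assms by (auto simp: isomorphic_def)
  obtain g where g: "iso_in C g Y' Y" using assms isomorphic_sym by (metis isomorphic_def)
  show ?thesis unfolding orth_def
  proof
    fix a assume a: "a \<in> hom X' Y'"
    have "g \<cdot> (a \<cdot> f) = zero X Y"
      by (meson a assms(1) comp_hom f g iso_hom orthD)
    then show "a = zero X' Y'"
      by (meson a comp_hom f g iso_hom iso_zero_left iso_zero_right)
  qed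
qed

section \<open>Coproducts\<close>

lemma coproduct_Ob: "is_coproduct C I D Q j \<Longrightarrow> Q \<in> Ob C"
  by (simp add: is_coproduct_def)

lemma coproduct_inj: "is_coproduct C I D Q j \<Longrightarrow> i \<in> I \<Longrightarrow> j i \<in> hom (D i) Q"
  by (simp add: is_coproduct_def)

lemma coproduct_lift:
  assumes "is_coproduct C I D Q j" "Y \<in> Ob C" "\<And>i. i \<in> I \<Longrightarrow> f i \<in> hom (D i) Y"
  obtains g where "g \<in> hom Q Y" "\<And>i. i \<in> I \<Longrightarrow> g \<cdot> j i = f i"
  using assms unfolding is_coproduct_def by metis

lemma coproduct_eq:
  assumes "is_coproduct C I D Q j" "f \<in> hom Q Y" "g \<in> hom Q Y"
    "\<And>i. i \<in> I \<Longrightarrow> f \<cdot> j i = g \<cdot> j i"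
  shows "f = g"
proof -
  have Y: "Y \<in> Ob C" using assms(2) hom_Ob by blast
  have "\<forall>i\<in>I. g \<cdot> j i \<in> hom (D i) Y"
    using assms(3) comp_hom coproduct_inj[OF assms(1)] by blast
  then have "\<exists>!h. h \<in> hom Q Y \<and> (\<forall>i\<in>I. h \<cdot> j i = g \<cdot> j i)"
    using assms(1) Y unfolding is_coproduct_def
    by (elim conjE, drule_tac bspec[OF _ Y], drule_tac spec[of _ "\<lambda>i. g \<cdot> j i"]) simp
  then show ?thesis using assms(2-4) by blast
qed

lemma coproduct_eq_zero:
  assumes "is_coproduct C I D Q j" "f \<in> hom Q Y" "\<And>i. i \<in> I \<Longrightarrow> f \<cdot> j i = zero (D i) Y"
  shows "f = zero Q Y"
proof (rule coproduct_eq[OF assms(1,2)])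
  show "zero Q Y \<in> hom Q Y" using assms(2) hom_Ob by blast
  show "f \<cdot> j i = zero Q Y \<cdot> j i" if "i \<in> I" for i
    using that assms coproduct_inj comp_zero_left hom_Ob by metis
qed

text \<open>The projection is induced by the identity on one summand and zero on the others. It
  makes every summand a retract, which is how vanishing of a coproduct passes to its
  summands.\<close>

lemma coproduct_projection:
  assumes "is_coproduct C I D Q j" "i \<in> I" "\<And>i. i \<in> I \<Longrightarrow> D i \<in> Ob C"
  obtains q where "q \<in> hom Q (D i)" "q \<cdot> j i = Id C (D i)"
proof -
  obtain g where "g \<in> hom Q (D i)"
      "\<And>k. k \<in> I \<Longrightarrow> g \<cdot> j k = (if k = i then Id C (D i) else zero (D k) (D i))"
    by (rule coproduct_lift[OF assms(1), of "D i" "\<lambda>k. if k = i then Id C (D i) else zero (D k) (D i)"])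
      (use assms id_hom in auto)
  then show ?thesis using that assms(2) by auto
qed

lemma coproduct_zero:
  assumes "is_coproduct C I D Q j" "\<And>i. i \<in> I \<Longrightarrow> zero_object C (D i)"
  shows "zero_object C Q"
proof -
  have Q: "Q \<in> Ob C" using assms coproduct_Ob by blast
  have "Id C Q = zero Q Q"
  proof (rule coproduct_eq_zero[OF assms(1) id_hom[OF Q]])
    fix i assume i: "i \<in> I"
    have "j i \<in> hom (D i) Q" using assms i coproduct_inj by metis
    then show "Id C Q \<cdot> j i = zero (D i) Q"
      using comp_id[of "j i"] orthD[OF zero_object_source[OF assms(2)[OF i], of Q], of "j i"] by auto
  qed
  then show ?thesis using Q zero_object_iff by blast
qed

text \<open>Twisting the injections by isomorphisms keeps the universal property. This allows a
  coproduct to be presented as one of suspensions.\<close>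

lemma coproduct_iso:
  assumes "is_coproduct C I D Q j" "\<And>i. i \<in> I \<Longrightarrow> iso_in C (e i) (D' i) (D i)"
  shows "is_coproduct C I D' Q (\<lambda>i. j i \<cdot> e i)"
  unfolding is_coproduct_def
proof (intro conjI ballI allI impI)
  show "Q \<in> Ob C" using assms coproduct_Ob by blast
  show *: "j i \<cdot> e i \<in> hom (D' i) Q" if "i \<in> I" for i
    using that assms comp_hom coproduct_inj iso_hom by metis
  fix Y f assume Y: "Y \<in> Ob C" and f: "\<forall>i\<in>I. f i \<in> hom (D' i) Y"
  have "\<forall>i\<in>I. \<exists>k. k \<in> hom (D i) (D' i) \<and> e i \<cdot> k = Id C (D i) \<and> k \<cdot> e i = Id C (D' i)"
    using assms(2) iso_inE by metis
  then obtain k where k: "\<And>i. i \<in> I \<Longrightarrow> k i \<in> hom (D i) (D' i) \<and> e i \<cdot> k i = Id C (D i) \<and> k i \<cdot> e i = Id C (D' i)"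
    by metis
  obtain g where g: "g \<in> hom Q Y" "\<And>i. i \<in> I \<Longrightarrow> g \<cdot> j i = f i \<cdot> k i"
    by (rule coproduct_lift[OF assms(1) Y, of "\<lambda>i. f i \<cdot> k i"])
      (use f k comp_hom in \<open>blast+\<close>)
  show "\<exists>!g. g \<in> hom Q Y \<and> (\<forall>i\<in>I. g \<cdot> (j i \<cdot> e i) = f i)"
  proof (rule ex1I[of _ g])
    have "g \<cdot> (j i \<cdot> e i) = f i" if i: "i \<in> I" for i
    proof -
      have "g \<cdot> (j i \<cdot> e i) = (g \<cdot> j i) \<cdot> e i"
        by (rule comp_assoc[OF iso_hom[OF assms(2)[OF i]] coproduct_inj[OF assms(1) i] g(1)])
      also have "\<dots> = f i"
        using f k[OF i] iso_hom[OF assms(2)[OF i]] i by (simp add: g(2) arrow_simps)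
      finally show ?thesis .
    qed
    then show "g \<in> hom Q Y \<and> (\<forall>i\<in>I. g \<cdot> (j i \<cdot> e i) = f i)" using g by blast
    fix h assume h: "h \<in> hom Q Y \<and> (\<forall>i\<in>I. h \<cdot> (j i \<cdot> e i) = f i)"
    show "h = g"
    proof (rule coproduct_eq[OF assms(1)])
      show "h \<in> hom Q Y" "g \<in> hom Q Y" using h g by auto
      show "h \<cdot> j i = g \<cdot> j i" if i: "i \<in> I" for i
      proof (rule iso_cancel_right[OF assms(2)[OF i]])
        show "h \<cdot> j i \<in> hom (D i) Y" "g \<cdot> j i \<in> hom (D i) Y"
          using h g i assms(1) comp_hom coproduct_inj by metis+
        have "h \<cdot> j i \<cdot> e i = f i"
          using h i iso_hom[OF assms(2)[OF i]] coproduct_inj[OF assms(1) i] by (simp add: arrow_simps)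
        moreover have "g \<cdot> j i \<cdot> e i = f i"
          using f k[OF i] iso_hom[OF assms(2)[OF i]] i by (simp add: g(2) arrow_simps)
        ultimately show "h \<cdot> j i \<cdot> e i = g \<cdot> j i \<cdot> e i" by simp
      qed
    qed
  qed
qed

lemma coproduct_comparison:
  assumes "is_coproduct C I D Q j" "is_coproduct C I D Q' j'"
  obtains t where "iso_in C t Q Q'" "\<And>i. i \<in> I \<Longrightarrow> t \<cdot> j i = j' i"
proof -
  have Q: "Q \<in> Ob C" "Q' \<in> Ob C" using assms coproduct_Ob by auto
  obtain t where t: "t \<in> hom Q Q'" "\<And>i. i \<in> I \<Longrightarrow> t \<cdot> j i = j' i"
    using coproduct_lift[OF assms(1) Q(2) coproduct_inj[OF assms(2)]] by metis
  obtain t' where t': "t' \<in> hom Q' Q" "\<And>i. i \<in> I \<Longrightarrow> t' \<cdot> j' i = j i"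
    using coproduct_lift[OF assms(2) Q(1) coproduct_inj[OF assms(1)]] by metis
  have "t' \<cdot> t = Id C Q"
  proof (rule coproduct_eq[OF assms(1) comp_hom[OF t(1) t'(1)] id_hom[OF Q(1)]])
    fix i assume i: "i \<in> I"
    show "t' \<cdot> t \<cdot> j i = Id C Q \<cdot> j i"
      using comp_assoc[OF coproduct_inj[OF assms(1) i] t(1) t'(1)] t(2)[OF i] t'(2)[OF i]
        comp_id[OF coproduct_inj[OF assms(1) i]] by simp
  qed
  moreover have "t \<cdot> t' = Id C Q'"
  proof (rule coproduct_eq[OF assms(2) comp_hom[OF t'(1) t(1)] id_hom[OF Q(2)]])
    fix i assume i: "i \<in> I"
    show "t \<cdot> t' \<cdot> j' i = Id C Q' \<cdot> j' i"
      using comp_assoc[OF coproduct_inj[OF assms(2) i] t'(1) t(1)] t(2)[OF i] t'(2)[OF i]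
        comp_id[OF coproduct_inj[OF assms(2) i]] by simp
  qed
  ultimately show ?thesis using that t iso_inI[OF t(1) t'(1)] by blast
qed

lemma multiple_zero:
  assumes "X \<in> Ob C" "Y \<in> Ob C" shows "multiple C k (zero X Y) = zero X Y"
proof -
  have z: "zero X Y \<in> hom X Y" using assms by simp
  show ?thesis
    by (induction k) (use multiple_0[OF z] multiple_Suc[OF z] plus_zero[OF z] in simp_all)
qed

section \<open>Smallness of index sets\<close>

lemma small_Un:
  assumes "Small C A" "Small C B" shows "Small C (A \<union> B)"
proof -
  obtain J where J: "Small C J" "infinite J" using small_infinite by blast
  then obtain a b where ab: "a \<in> J" "b \<in> J" "a \<noteq> b"
    by (metis finite.emptyI finite_subset insertCI insert_subset subsetI finite.insertI singletonD)
  \<comment> \<open>The closure property concerns unions over a small index set, so two points of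
    \<open>J\<close> carry \<open>A\<close> and \<open>B\<close> and all others the empty
    set.\<close>
  have "Small C (\<Union>i\<in>J. if i = a then A else if i = b then B else {})"
    by (rule small_Union[OF J(1)]) (use assms small_lepoll[OF J(1) empty_lepoll] in auto)
  moreover have "A \<union> B \<subseteq> (\<Union>i\<in>J. if i = a then A else if i = b then B else {})"
    using ab by auto
  ultimately show ?thesis using small_lepoll subset_imp_lepoll by blast
qed

text \<open>Coproducts are indexed by sets of elements of \<open>'i\<close>, so a countable family
  is indexed by an injective copy of the natural numbers in that type.\<close>

lemma small_sequence: obtains e :: "nat \<Rightarrow> 'i" where "inj e" "Small C (range e)"
proof -
  obtain J where J: "Small C J" "infinite J" using small_infinite by blast
  then obtain e :: "nat \<Rightarrow> 'i" where "inj e" "range e \<subseteq> J" using infinite_countable_subset by blast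
  then show ?thesis using that small_lepoll[OF J(1)] subset_imp_lepoll by blast
qed

text \<open>All degrees embed into one small infinite set \<open>K\<close>, so the disjoint union
  embeds into \<open>K \<times> K\<close>, which is no larger than \<open>K\<close>. It provides
  index sets for coproducts over all homotopy classes of all degrees.\<close>

lemma small_Sigma:
  fixes A :: "int \<Rightarrow> 'x set"
  assumes "\<And>n. \<exists>I. Small C I \<and> A n \<lesssim> I"
  shows "\<exists>I. Small C I \<and> Sigma UNIV A \<lesssim> I"
proof -
  obtain I where I: "\<And>n. Small C (I n)" "\<And>n. A n \<lesssim> I n" using assms by metis
  obtain e :: "nat \<Rightarrow> 'i" where e: "inj e" "Small C (range e)" by (rule small_sequence)
  \<comment> \<open>Adjoining \<open>range e\<close> makes \<open>K\<close> infinite, so that it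
    absorbs the integers and its own square.\<close>
  define K where "K = (\<Union>i\<in>range e. I (from_nat (inv_into UNIV e i))) \<union> range e"
  have K: "Small C K"
    unfolding K_def by (rule small_Un[OF small_Union[OF e(2) I(1)] e(2)])
  have inf: "infinite K" using e unfolding K_def by (simp add: range_inj_infinite)
  have "I n \<subseteq> K" for n
  proof -
    have "I (from_nat (inv_into UNIV e (e (to_nat n)))) \<subseteq> K" unfolding K_def by blast
    then show ?thesis using e by simp
  qed
  then have AK: "A n \<lesssim> K" for n using I(2) lepoll_trans subset_imp_lepoll by blast
  have "(UNIV :: int set) \<lesssim> (UNIV :: nat set)" unfolding lepoll_def using inj_to_nat by blast
  then have Z: "(UNIV :: int set) \<lesssim> K" using inf infinite_le_lepoll lepoll_trans by blast
  have "Sigma UNIV A \<lesssim> (UNIV :: int set) \<times> K" using Sigma_lepoll_mono[of UNIV UNIV A "\<lambda>_. K"] AK by simp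
  also have "\<dots> \<lesssim> K \<times> K" using times_lepoll_mono[OF Z lepoll_refl] .
  also have "K \<times> K \<lesssim> K"
    using card_of_Times_same_infinite[OF inf] card_of_ordIso eqpoll_def eqpoll_imp_lepoll by blast
  finally show ?thesis using K by blast
qed

end

section \<open>Exact triangles\<close>

context triangulated_category
begin

lemma sus_zero: "X \<in> Ob C \<Longrightarrow> Y \<in> Ob C \<Longrightarrow> SusM C (zero X Y) = zero (Sus C X) (Sus C Y)"
  using sus_plus[of "zero X Y" X Y "zero X Y"] plus_zero(1)[of "zero X Y" X Y]
    plus_idem[of "SusM C (zero X Y)" "Sus C X" "Sus C Y"] sus_hom[of "zero X Y" X Y] by simp

lemma sus_neg:
  assumes f: "f \<in> hom X Y"
  shows "SusM C (neg C f) = neg C (SusM C f)"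
  using plus_eq_zeroD[OF sus_hom[OF neg_hom[OF f]] sus_hom[OF f]]
    sus_plus[OF neg_hom[OF f] f] plus_neg(2)[OF f] sus_zero[of X Y] hom_Ob[OF f] by simp

lemma sus_inject: "f \<in> hom X Y \<Longrightarrow> g \<in> hom X Y \<Longrightarrow> SusM C f = SusM C g \<Longrightarrow> f = g"
  using sus_fully_faithful[of X Y] hom_Ob[of f X Y] by (auto simp: bij_betw_def dest: inj_onD)

lemma sus_full:
  assumes "g \<in> hom (Sus C X) (Sus C Y)" "X \<in> Ob C" "Y \<in> Ob C"
  obtains f where "f \<in> hom X Y" "SusM C f = g"
proof -
  have "g \<in> SusM C ` hom X Y" using sus_fully_faithful[of X Y] assms by (simp add: bij_betw_def)
  then show thesis using that by blast
qed

lemma sus_eq_zero: "f \<in> hom X Y \<Longrightarrow> SusM C f = zero (Sus C X) (Sus C Y) \<Longrightarrow> f = zero X Y"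
  using sus_inject[of f X Y "zero X Y"] sus_zero hom_Ob by auto

lemma sus_multiple:
  assumes f: "f \<in> hom X Y"
  shows "SusM C (multiple C n f) = multiple C n (SusM C f)"
proof (induction n)
  case 0
  then show ?case
    using multiple_0[OF f] multiple_0[OF sus_hom[OF f]] sus_zero hom_Ob[OF f] by simp
next
  case (Suc n)
  then show ?case
    using multiple_Suc[OF f, of n] multiple_Suc[OF sus_hom[OF f], of n]
      sus_plus[OF multiple_hom[OF f] f, of n] by simp
qed

lemma sus_iso:
  assumes "iso_in C f X Y" shows "iso_in C (SusM C f) (Sus C X) (Sus C Y)"
proof -
  obtain g where g: "f \<in> hom X Y" "g \<in> hom Y X" "g \<cdot> f = Id C X" "f \<cdot> g = Id C Y"
    "X \<in> Ob C" "Y \<in> Ob C" by (rule iso_inE[OF assms])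
  show ?thesis
    by (rule iso_inI[OF sus_hom[OF g(1)] sus_hom[OF g(2)]])
      (use g sus_comp[OF g(1,2)] sus_comp[OF g(2,1)] sus_id in simp_all)
qed

lemma sus_isomorphic: "isomorphic X Y \<Longrightarrow> isomorphic (Sus C X) (Sus C Y)"
  unfolding isomorphic_def using sus_iso by blast

lemma sus_reflects_iso:
  assumes "isomorphic (Sus C X) (Sus C Y)" "X \<in> Ob C" "Y \<in> Ob C"
  shows "isomorphic X Y"
proof -
  obtain F where F: "iso_in C F (Sus C X) (Sus C Y)" using assms by (auto simp: isomorphic_def)
  obtain G where G: "F \<in> hom (Sus C X) (Sus C Y)" "G \<in> hom (Sus C Y) (Sus C X)"
     "G \<cdot> F = Id C (Sus C X)" "F \<cdot> G = Id C (Sus C Y)" by (rule iso_inE[OF F])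
  obtain f where f: "f \<in> hom X Y" "SusM C f = F" by (rule sus_full[OF G(1) assms(2,3)])
  obtain g where g: "g \<in> hom Y X" "SusM C g = G" by (rule sus_full[OF G(2) assms(3,2)])
  have "iso_in C f X Y"
  proof (rule iso_inI[OF f(1) g(1)])
    show "g \<cdot> f = Id C X"
      by (rule sus_inject[OF comp_hom[OF f(1) g(1)] id_hom[OF assms(2)]])
        (use sus_comp[OF f(1) g(1)] f g G sus_id assms in simp)
    show "f \<cdot> g = Id C Y"
      by (rule sus_inject[OF comp_hom[OF g(1) f(1)] id_hom[OF assms(3)]])
        (use sus_comp[OF g(1) f(1)] f g G sus_id assms in simp)
  qed
  then show ?thesis by (auto simp: isomorphic_def)
qed

lemma sus_orth_iff:
  assumes "X \<in> Ob C" "Y \<in> Ob C"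
  shows "orth (Sus C X) (Sus C Y) \<longleftrightarrow> orth X Y"
proof
  assume "orth (Sus C X) (Sus C Y)"
  then show "orth X Y"
    unfolding orth_def using sus_eq_zero sus_hom by blast
next
  assume o: "orth X Y"
  show "orth (Sus C X) (Sus C Y)"
    unfolding orth_def
  proof
    fix g assume "g \<in> hom (Sus C X) (Sus C Y)"
    then obtain f where "f \<in> hom X Y" "SusM C f = g" using sus_full assms by metis
    then show "g = zero (Sus C X) (Sus C Y)" using orthD[OF o] sus_zero assms by metis
  qed
qed

lemma sus_zero_object_iff:
  assumes "X \<in> Ob C"
  shows "zero_object C (Sus C X) \<longleftrightarrow> zero_object C X"
proof -
  have "Id C (Sus C X) = zero (Sus C X) (Sus C X) \<longleftrightarrow> Id C X = zero X X"
    using sus_eq_zero[OF id_hom[OF assms]] sus_id[OF assms] sus_zero[OF assms assms] by auto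
  then show ?thesis using assms sus_ob by (simp add: zero_object_iff)
qed

text \<open>Suspension preserves coproducts, because up to isomorphism every object is a suspension.\<close>

lemma sus_coproduct:
  assumes cop: "is_coproduct C I D Q j" and D: "\<And>i. i \<in> I \<Longrightarrow> D i \<in> Ob C"
  shows "is_coproduct C I (\<lambda>i. Sus C (D i)) (Sus C Q) (\<lambda>i. SusM C (j i))"
  unfolding is_coproduct_def
proof (intro conjI ballI allI impI)
  have Q: "Q \<in> Ob C" using coproduct_Ob[OF cop] .
  show "Sus C Q \<in> Ob C" using Q sus_ob by blast
  show "SusM C (j i) \<in> hom (Sus C (D i)) (Sus C Q)" if "i \<in> I" for i
    using sus_hom coproduct_inj[OF cop that] by blast
  fix Y f assume Y: "Y \<in> Ob C" and f: "\<forall>i\<in>I. f i \<in> hom (Sus C (D i)) Y"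
  obtain Y' e where Y': "Y' \<in> Ob C" and e: "iso_in C e (Sus C Y') Y" using sus_ess_surj[OF Y] by blast
  obtain e' where e': "e \<in> hom (Sus C Y') Y" "e' \<in> hom Y (Sus C Y')" "e' \<cdot> e = Id C (Sus C Y')"
    "e \<cdot> e' = Id C Y" by (rule iso_inE[OF e])
  have "\<exists>k. k \<in> hom (D i) Y' \<and> SusM C k = e' \<cdot> f i" if i: "i \<in> I" for i
    using sus_full[OF comp_hom[OF _ e'(2)] D[OF i] Y'] f i by metis
  then obtain k where k: "\<And>i. i \<in> I \<Longrightarrow> k i \<in> hom (D i) Y'" "\<And>i. i \<in> I \<Longrightarrow> SusM C (k i) = e' \<cdot> f i"
    by metis
  obtain g where g: "g \<in> hom Q Y'" "\<And>i. i \<in> I \<Longrightarrow> g \<cdot> j i = k i"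
    using coproduct_lift[OF cop Y' k(1)] by metis
  have ef: "e \<cdot> (e' \<cdot> f i) = f i" if "i \<in> I" for i
    using comp_assoc[OF _ e'(2,1), of "f i"] e'(4) comp_id[of "f i" _ Y] f that by auto
  show "\<exists>!g. g \<in> hom (Sus C Q) Y \<and> (\<forall>i\<in>I. g \<cdot> SusM C (j i) = f i)"
  proof (rule ex1I[of _ "e \<cdot> SusM C g"], intro conjI ballI)
    show "e \<cdot> SusM C g \<in> hom (Sus C Q) Y" using comp_hom[OF sus_hom[OF g(1)] e'(1)] .
    show "e \<cdot> SusM C g \<cdot> SusM C (j i) = f i" if i: "i \<in> I" for i
    proof -
      have "e \<cdot> SusM C g \<cdot> SusM C (j i) = e \<cdot> (SusM C g \<cdot> SusM C (j i))"
        using comp_assoc[OF sus_hom[OF coproduct_inj[OF cop i]] sus_hom[OF g(1)] e'(1)] by simp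
      also have "SusM C g \<cdot> SusM C (j i) = e' \<cdot> f i"
        using sus_comp[OF coproduct_inj[OF cop i] g(1)] g(2)[OF i] k(2)[OF i] by simp
      finally show ?thesis using ef[OF i] by simp
    qed
    fix h assume h: "h \<in> hom (Sus C Q) Y \<and> (\<forall>i\<in>I. h \<cdot> SusM C (j i) = f i)"
    obtain h' where h': "h' \<in> hom Q Y'" "SusM C h' = e' \<cdot> h"
      using sus_full[OF comp_hom[OF _ e'(2)] Q Y'] h by metis
    have "h' = g"
    proof (rule coproduct_eq[OF cop h'(1) g(1)])
      fix i assume i: "i \<in> I"
      have ji: "j i \<in> hom (D i) Q" using coproduct_inj[OF cop i] .
      have "SusM C (h' \<cdot> j i) = SusM C h' \<cdot> SusM C (j i)" using sus_comp[OF ji h'(1)] .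
      also have "\<dots> = e' \<cdot> (h \<cdot> SusM C (j i))"
        using comp_assoc[OF sus_hom[OF ji] _ e'(2), of h] h h' by simp
      also have "\<dots> = SusM C (g \<cdot> j i)" using h i k g by simp
      finally show "h' \<cdot> j i = g \<cdot> j i"
        using sus_inject[OF comp_hom[OF ji h'(1)] comp_hom[OF ji g(1)]] by simp
    qed
    then have "e \<cdot> SusM C g = e \<cdot> (e' \<cdot> h)" using h' by simp
    also have "\<dots> = h" using comp_assoc[OF _ e'(2,1), of h] e'(4) comp_id[of h _ Y] h by auto
    finally show "h = e \<cdot> SusM C g" by simp
  qed
qed

section \<open>Long exact sequences of a triangle\<close>

lemma tri_rotateD:
  assumes "(f, g, h) \<in> Tri C" "f \<in> hom X Y" "g \<in> hom Y Z" "h \<in> hom Z (Sus C X)"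
  shows "(g, h, neg C (SusM C f)) \<in> Tri C"
  using tri_rotate[OF assms(2-4)] assms(1) by blast

lemma exists_zero: obtains Z where "zero_object C Z"
proof -
  have "Small C {}" using small_infinite small_lepoll by (metis empty_lepoll)
  then obtain Q j where "is_coproduct C {} (\<lambda>_. undefined) Q j" using coproducts by fastforce
  then show ?thesis using that coproduct_zero by fastforce
qed

context
  fixes f g h X Y Z
  assumes tri: "(f, g, h) \<in> Tri C" and f: "f \<in> hom X Y" and g: "g \<in> hom Y Z"
    and h: "h \<in> hom Z (Sus C X)"
begin

lemma tri_obs: "X \<in> Ob C" "Y \<in> Ob C" "Z \<in> Ob C"
  using hom_Ob f g by auto

text \<open>The square formed by the identity of \<open>X\<close> and \<open>f\<close> maps the
  triangle of \<open>Id C X\<close> to the given one; its third component starts at a zero object,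
  and \<open>g \<cdot> f\<close> factors through it.\<close>

lemma tri_zero1: "g \<cdot> f = zero X Z"
proof -
  obtain N where N: "zero_object C N" by (rule exists_zero)
  have N_Ob: "N \<in> Ob C" using N zero_object_iff by blast
  have t: "(Id C X, zero X N, zero N (Sus C X)) \<in> Tri C" by (rule tri_id[OF tri_obs(1) N])
  have "\<exists>c\<in>hom (Cod C (zero X N)) (Cod C g). g \<cdot> f = c \<cdot> zero X N \<and> h \<cdot> c = SusM C (Id C X) \<cdot> zero N (Sus C X)"
    by (rule tri_fill[OF t tri]) (use f tri_obs id_hom comp_id N_Ob in \<open>auto simp: homset_def\<close>)
  then obtain c where c: "c \<in> hom N Z" "g \<cdot> f = c \<cdot> zero X N"
    using tri_obs N_Ob zero_hom[of X N] g by (auto simp: homset_def)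
  then show ?thesis using comp_zero_right tri_obs by simp
qed

text \<open>A fill-in from the rotated triangle of \<open>Id C W\<close> to the rotated given
  triangle yields an arrow \<open>Sus C W\<close> to \<open>Sus C X\<close>, which desuspends. Both
  rotations introduce a sign, so the signs cancel.\<close>

lemma tri_exact_left1:
  assumes a: "a \<in> hom W Y" and ga: "g \<cdot> a = zero W Z"
  obtains b where "b \<in> hom W X" "f \<cdot> b = a"
proof -
  obtain N where N: "zero_object C N" by (rule exists_zero)
  have N_Ob: "N \<in> Ob C" using N zero_object_iff by blast
  have W: "W \<in> Ob C" using a hom_Ob by blast
  note obs = tri_obs N_Ob W sus_ob
  have t: "(Id C W, zero W N, zero N (Sus C W)) \<in> Tri C" by (rule tri_id[OF W N])
  have t': "(zero W N, zero N (Sus C W), neg C (SusM C (Id C W))) \<in> Tri C"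
    by (rule tri_rotateD[OF t id_hom[OF W]]) (use obs in auto)
  have r: "(g, h, neg C (SusM C f)) \<in> Tri C" by (rule tri_rotateD[OF tri f g h])
  have z: "zero W N \<in> hom W N" "zero N (Sus C W) \<in> hom N (Sus C W)" "zero N Z \<in> hom N Z" using obs by auto
  have "\<exists>c\<in>hom (Cod C (zero N (Sus C W))) (Cod C h). h \<cdot> zero N Z = c \<cdot> zero N (Sus C W) \<and>
      neg C (SusM C f) \<cdot> c = SusM C a \<cdot> neg C (SusM C (Id C W))"
  proof (rule tri_fill[OF t' r])
    show "a \<in> homset C (Dom C (zero W N)) (Dom C g)" using a z g by (simp add: homset_iff)
    show "zero N Z \<in> homset C (Cod C (zero W N)) (Cod C g)" using z g by (simp add: homset_iff)
    show "g \<cdot> a = zero N Z \<cdot> zero W N" using ga comp_zero_right[OF z(3) W] by simp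
  qed
  then obtain c where c: "c \<in> hom (Sus C W) (Sus C X)"
      "neg C (SusM C f) \<cdot> c = SusM C a \<cdot> neg C (SusM C (Id C W))"
    using z h by (auto simp: homset_iff)
  obtain b where b: "b \<in> hom W X" "SusM C b = c" by (rule sus_full[OF c(1) W tri_obs(1)])
  have "neg C (SusM C f \<cdot> c) = neg C (SusM C a)"
    using c(2) comp_neg_left[OF c(1) sus_hom[OF f]]
      comp_neg_right[OF id_hom[OF sus_ob[OF W]] sus_hom[OF a]] comp_id[OF sus_hom[OF a]] sus_id[OF W]
    by simp
  then have "SusM C f \<cdot> c = SusM C a"
    using neg_neg[OF comp_hom[OF c(1) sus_hom[OF f]]] neg_neg[OF sus_hom[OF a]] by metis
  then have "SusM C (f \<cdot> b) = SusM C a" using sus_comp[OF b(1) f] b by simp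
  then have "f \<cdot> b = a" using sus_inject[OF comp_hom[OF b(1) f] a] by blast
  with b that show ?thesis by blast
qed

text \<open>The target triangle is that of \<open>Id C W\<close> rotated backwards, so that the
  identity of \<open>W\<close> sits in second place. Since rotation replaces the first object by its
  suspension, one starts from the zero object \<open>Sus C N\<close>.\<close>

lemma tri_exact_right1:
  assumes a: "a \<in> hom Y W" and af: "a \<cdot> f = zero X W"
  obtains b where "b \<in> hom Z W" "b \<cdot> g = a"
proof -
  obtain N where N: "zero_object C N" by (rule exists_zero)
  have N_Ob: "N \<in> Ob C" using N zero_object_iff by blast
  have W: "W \<in> Ob C" using a hom_Ob by blast
  note obs = tri_obs N_Ob W sus_ob
  have SN: "zero_object C (Sus C N)" using N N_Ob sus_zero_object_iff by blast
  have "(Id C W, zero W (Sus C N), zero (Sus C N) (Sus C W)) \<in> Tri C"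
    by (rule tri_id[OF W SN])
  moreover have "neg C (SusM C (zero N W)) = zero (Sus C N) (Sus C W)"
    using sus_zero[OF N_Ob W] neg_zero obs by simp
  ultimately have t: "(zero N W, Id C W, zero W (Sus C N)) \<in> Tri C"
    using tri_rotate[of "zero N W" N W "Id C W" W "zero W (Sus C N)"] obs id_hom by simp
  have z: "zero X N \<in> hom X N" "zero N W \<in> hom N W" using obs by auto
  have "\<exists>c\<in>hom (Cod C g) (Cod C (Id C W)). Id C W \<cdot> a = c \<cdot> g \<and> zero W (Sus C N) \<cdot> c = SusM C (zero X N) \<cdot> h"
  proof (rule tri_fill[OF tri t])
    show "zero X N \<in> homset C (Dom C f) (Dom C (zero N W))" using z f by (simp add: homset_iff)
    show "a \<in> homset C (Cod C f) (Cod C (zero N W))" using z f a by (simp add: homset_iff)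
    show "zero N W \<cdot> zero X N = a \<cdot> f" using af comp_zero_right[OF z(2) tri_obs(1)] by simp
  qed
  then obtain c where "c \<in> hom Z W" "c \<cdot> g = a"
    using comp_id[OF a] g W by (auto simp: homset_iff arrow_id)
  then show ?thesis using that by blast
qed

end

context
  fixes f g h X Y Z
  assumes tri: "(f, g, h) \<in> Tri C" and f: "f \<in> hom X Y" and g: "g \<in> hom Y Z"
    and h: "h \<in> hom Z (Sus C X)"
begin

lemma tri_rot1: "(g, h, neg C (SusM C f)) \<in> Tri C"
  by (rule tri_rotateD[OF tri f g h])

lemma nsf: "neg C (SusM C f) \<in> hom (Sus C X) (Sus C Y)"
  using neg_hom sus_hom f by blast

lemma tri_rot2: "(h, neg C (SusM C f), neg C (SusM C g)) \<in> Tri C"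
  by (rule tri_rotateD[OF tri_rot1 g h nsf])

lemma nsg: "neg C (SusM C g) \<in> hom (Sus C Y) (Sus C Z)"
  using neg_hom sus_hom g by blast

lemma tri_zero3: "SusM C f \<cdot> h = zero Z (Sus C Y)"
proof -
  have "neg C (SusM C f \<cdot> h) = zero Z (Sus C Y)"
    using tri_zero1[OF tri_rot2 h nsf nsg] comp_neg_left[OF h sus_hom[OF f]] by simp
  then show ?thesis using neg_eq_zero[OF comp_hom[OF h sus_hom[OF f]]] by blast
qed

lemma tri_exact_left2:
  assumes "a \<in> hom W Z" "h \<cdot> a = zero W (Sus C X)"
  obtains b where "b \<in> hom W Y" "g \<cdot> b = a"
  using tri_exact_left1[OF tri_rot1 g h nsf assms] by blast

lemma tri_exact_left3:
  assumes a: "a \<in> hom W (Sus C X)" and 0: "SusM C f \<cdot> a = zero W (Sus C Y)"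
  obtains b where "b \<in> hom W Z" "h \<cdot> b = a"
proof -
  have "neg C (SusM C f) \<cdot> a = zero W (Sus C Y)"
    using comp_neg_left[OF a sus_hom[OF f]] 0 neg_zero hom_Ob[OF a] sus_ob hom_Ob[OF f] by simp
  then show ?thesis using tri_exact_left1[OF tri_rot2 h nsf nsg a] that by blast
qed

lemma tri_exact_right2:
  assumes "a \<in> hom Z W" "a \<cdot> g = zero Y W"
  obtains b where "b \<in> hom (Sus C X) W" "b \<cdot> h = a"
  using tri_exact_right1[OF tri_rot1 g h nsf assms] by blast

text \<open>The suspended arrow extends in the doubly rotated triangle, and the extension
  desuspends. The rotated arrow is the negative of \<open>SusM C f\<close>, hence the witness
  \<open>neg C b\<close>.\<close>

lemma tri_exact_right0:
  assumes a: "a \<in> hom X W" and 0: "SusM C a \<cdot> h = zero Z (Sus C W)"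
  obtains b where "b \<in> hom Y W" "b \<cdot> f = a"
proof -
  obtain c where c: "c \<in> hom (Sus C Y) (Sus C W)" "c \<cdot> neg C (SusM C f) = SusM C a"
    by (rule tri_exact_right1[OF tri_rot2 h nsf nsg sus_hom[OF a] 0])
  obtain b where b: "b \<in> hom Y W" "SusM C b = c"
    using sus_full[OF c(1)] hom_Ob f a by blast
  have "SusM C (neg C b \<cdot> f) = SusM C a"
    using sus_comp[OF f neg_hom[OF b(1)]] sus_neg[OF b(1)] b(2) c(2)
      comp_neg_left[OF sus_hom[OF f] c(1)] comp_neg_right[OF sus_hom[OF f] c(1)] by simp
  then have "neg C b \<cdot> f = a"
    using sus_inject[OF comp_hom[OF f neg_hom[OF b(1)]] a] by blast
  then show ?thesis using that neg_hom[OF b(1)] by blast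
qed

text \<open>Exactness on the two sides gives a left and a right inverse of \<open>h\<close>, which
  then coincide.\<close>

lemma tri_iso_of_zero_middle:
  assumes "zero_object C Y" shows "iso_in C h Z (Sus C X)"
proof -
  have Z: "Z \<in> Ob C" "X \<in> Ob C" "Sus C X \<in> Ob C" using hom_Ob g f sus_ob by auto
  have "Id C Z \<cdot> g = zero Y Z"
    using orthD[OF zero_object_source[OF assms] comp_hom[OF g id_hom[OF Z(1)]]] .
  then obtain b where b: "b \<in> hom (Sus C X) Z" "b \<cdot> h = Id C Z"
    by (rule tri_exact_right2[OF id_hom[OF Z(1)]])
  have "zero_object C (Sus C Y)" using assms sus_zero_object_iff zero_object_iff by blast
  then have "SusM C f \<cdot> Id C (Sus C X) = zero (Sus C X) (Sus C Y)"
    using orthD[OF zero_object_target comp_hom[OF id_hom[OF Z(3)] sus_hom[OF f]]] by blast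
  then obtain c where c: "c \<in> hom (Sus C X) Z" "h \<cdot> c = Id C (Sus C X)"
    by (rule tri_exact_left3[OF id_hom[OF Z(3)]])
  have "b = b \<cdot> (h \<cdot> c)" using b c comp_id[OF b(1)] by simp
  also have "\<dots> = c" using comp_assoc[OF c(1) h b(1)] b(2) comp_id[OF c(1)] by simp
  finally show ?thesis using iso_inI[OF h b(1)] b c by simp
qed

lemma tri_zero_first:
  assumes "zero_object C Y" "zero_object C Z" shows "zero_object C X"
proof -
  have "isomorphic Z (Sus C X)" using tri_iso_of_zero_middle[OF assms(1)] isomorphic_def by blast
  then have "zero_object C (Sus C X)" using isomorphic_zero assms(2) by blast
  then show ?thesis using sus_zero_object_iff hom_Ob[OF f] by blast
qed

end

lemma cofibre:
  assumes "f \<in> hom X Y"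
  obtains g h Z where "(f, g, h) \<in> Tri C" "g \<in> hom Y Z" "h \<in> hom Z (Sus C X)" "Z \<in> Ob C"
proof -
  obtain g h where t: "(f, g, h) \<in> Tri C" using tri_complete assms unfolding homset_iff by blast
  with tri_typed[OF t] assms dom_cod show ?thesis by (intro that[of g h "Cod C g"]) (auto simp: homset_iff)
qed

end

section \<open>Smash products\<close>

context tensor_triangulated_category
begin

lemma smash_split:
  assumes "f \<in> hom X X'" "g \<in> hom Y Y'"
  shows "(f \<star> Id C Y') \<cdot> (Id C X \<star> g) = f \<star> g" "(Id C X' \<star> g) \<cdot> (f \<star> Id C Y) = f \<star> g"
  using smash_comp[OF id_hom assms(1) assms(2) id_hom] smash_comp[OF assms(1) id_hom id_hom assms(2)]
    hom_Ob[OF assms(1)] hom_Ob[OF assms(2)] comp_id[OF assms(1)] comp_id[OF assms(2)] by simp_all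

lemma smash_comp_left:
  assumes "f \<in> hom X X'" "f' \<in> hom X' X''" "Y \<in> Ob C"
  shows "(f' \<star> Id C Y) \<cdot> (f \<star> Id C Y) = (f' \<cdot> f) \<star> Id C Y"
  using smash_comp[OF assms(1,2) id_hom id_hom, of Y] comp_id[OF id_hom] assms(3) by simp

lemma smash_comp_right:
  assumes "f \<in> hom X X'" "f' \<in> hom X' X''" "Y \<in> Ob C"
  shows "(Id C Y \<star> f') \<cdot> (Id C Y \<star> f) = Id C Y \<star> (f' \<cdot> f)"
  using smash_comp[OF id_hom id_hom assms(1,2), of Y] comp_id[OF id_hom] assms(3) by simp

lemma smash_zero_left:
  assumes "X \<in> Ob C" "X' \<in> Ob C" "g \<in> hom Y Y'"
  shows "zero X X' \<star> g = zero (X \<odot> Y) (X' \<odot> Y')"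
proof -
  have z: "zero X X' \<in> hom X X'" using assms by simp
  show ?thesis
    using smash_plus[OF z z assms(3)] plus_zero(1)[OF z] plus_idem[OF smash_hom[OF z assms(3)]] by simp
qed

lemma smash_neg_left:
  assumes f: "f \<in> hom X X'" and g: "g \<in> hom Y Y'"
  shows "neg C f \<star> g = neg C (f \<star> g)"
  using plus_eq_zeroD[OF smash_hom[OF neg_hom[OF f] g] smash_hom[OF f g]]
    smash_plus[OF neg_hom[OF f] f g] plus_neg(2)[OF f] smash_zero_left[OF _ _ g] hom_Ob[OF f] by simp

lemma smash_multiple_left:
  assumes f: "f \<in> hom X X'" and g: "g \<in> hom Y Y'"
  shows "multiple C n f \<star> g = multiple C n (f \<star> g)"
proof (induction n)
  case 0
  then show ?case
    using multiple_0[OF f] multiple_0[OF smash_hom[OF f g]] smash_zero_left[OF _ _ g] hom_Ob[OF f] by simp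
next
  case (Suc n)
  then show ?case
    using multiple_Suc[OF f, of n] multiple_Suc[OF smash_hom[OF f g], of n]
      smash_plus[OF multiple_hom[OF f] f g, of n] by simp
qed

lemma smash_iso:
  assumes "iso_in C f X X'" "iso_in C g Y Y'"
  shows "iso_in C (f \<star> g) (X \<odot> Y) (X' \<odot> Y')"
proof -
  obtain f' where f: "f \<in> hom X X'" "f' \<in> hom X' X" "f' \<cdot> f = Id C X" "f \<cdot> f' = Id C X'"
    "X \<in> Ob C" "X' \<in> Ob C" by (rule iso_inE[OF assms(1)])
  obtain g' where g: "g \<in> hom Y Y'" "g' \<in> hom Y' Y" "g' \<cdot> g = Id C Y" "g \<cdot> g' = Id C Y'"
    "Y \<in> Ob C" "Y' \<in> Ob C" by (rule iso_inE[OF assms(2)])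
  show ?thesis
    by (rule iso_inI[OF smash_hom[OF f(1) g(1)] smash_hom[OF f(2) g(2)]])
      (use smash_comp[OF f(1,2) g(1,2)] smash_comp[OF f(2,1) g(2,1)] f g smash_id in simp_all)
qed

lemma smash_isomorphic: "isomorphic X X' \<Longrightarrow> isomorphic Y Y' \<Longrightarrow> isomorphic (X \<odot> Y) (X' \<odot> Y')"
  unfolding isomorphic_def using smash_iso by blast

lemma smash_sym_isomorphic: "X \<in> Ob C \<Longrightarrow> Y \<in> Ob C \<Longrightarrow> isomorphic (X \<odot> Y) (Y \<odot> X)"
  unfolding isomorphic_def using sym_iso by blast

lemma smash_asc_isomorphic:
  "X \<in> Ob C \<Longrightarrow> Y \<in> Ob C \<Longrightarrow> Z \<in> Ob C \<Longrightarrow> isomorphic ((X \<odot> Y) \<odot> Z) (X \<odot> (Y \<odot> Z))"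
  unfolding isomorphic_def using asc_iso by blast

lemma smash_sus_isomorphic: "X \<in> Ob C \<Longrightarrow> Y \<in> Ob C \<Longrightarrow> isomorphic (Sus C X \<odot> Y) (Sus C (X \<odot> Y))"
  unfolding isomorphic_def using sex_iso by blast

lemma smash_sus_right_isomorphic:
  assumes "X \<in> Ob C" "Y \<in> Ob C" shows "isomorphic (X \<odot> Sus C Y) (Sus C (X \<odot> Y))"
  using smash_sym_isomorphic[of X "Sus C Y"] smash_sus_isomorphic[of Y X]
    sus_isomorphic[OF smash_sym_isomorphic[of Y X]] isomorphic_trans assms sus_ob by metis

lemma smash_sph_isomorphic: "X \<in> Ob C \<Longrightarrow> isomorphic (Sph C \<odot> X) X"
  unfolding isomorphic_def using lun_iso by blast

lemma smash_zero_object_left: "zero_object C X \<Longrightarrow> Y \<in> Ob C \<Longrightarrow> zero_object C (X \<odot> Y)"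
  using smash_zero_left[of X X "Id C Y" Y Y] smash_id[of X Y] id_hom smash_ob
  by (simp add: zero_object_iff)

lemma smash_zero_object_right: "X \<in> Ob C \<Longrightarrow> zero_object C Y \<Longrightarrow> zero_object C (X \<odot> Y)"
  by (meson isomorphic_zero smash_sym_isomorphic smash_zero_object_left zero_object_iff)

lemma smash_tri:
  assumes "(f, g, h) \<in> Tri C" "f \<in> hom X Y" "g \<in> hom Y Z" "h \<in> hom Z (Sus C X)" "G \<in> Ob C"
  shows "(f \<star> Id C G, g \<star> Id C G, Sex C X G \<cdot> (h \<star> Id C G)) \<in> Tri C"
    "f \<star> Id C G \<in> hom (X \<odot> G) (Y \<odot> G)" "g \<star> Id C G \<in> hom (Y \<odot> G) (Z \<odot> G)"
    "Sex C X G \<cdot> (h \<star> Id C G) \<in> hom (Z \<odot> G) (Sus C (X \<odot> G))"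
  using smash_exact[OF assms(1,5)] assms smash_hom[OF _ id_hom] iso_hom[OF sex_iso[of X G]]
    hom_Ob[OF assms(2)] comp_hom[OF smash_hom[OF assms(4) id_hom[OF assms(5)]]]
  by (simp_all add: homset_iff)

section \<open>Right-hand unit and exchange isomorphisms, and insertion of a unit\<close>

lemma run_iso: "X \<in> Ob C \<Longrightarrow> iso_in C (run C X) (X \<odot> Sph C) X"
  unfolding run_def using iso_comp[OF sym_iso lun_iso] sph_ob by blast

lemma run_nat:
  assumes f: "f \<in> hom X Y"
  shows "run C Y \<cdot> (f \<star> Id C (Sph C)) = f \<cdot> run C X"
proof -
  note Ob = hom_Ob[OF f] sph_ob
  have XY: "X \<in> Ob C" "Y \<in> Ob C" using hom_Ob[OF f] by auto
  have I: "Id C (Sph C) \<in> hom (Sph C) (Sph C)" using id_hom sph_ob by blast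
  note s = iso_hom[OF sym_iso[OF XY(2) sph_ob]] iso_hom[OF sym_iso[OF XY(1) sph_ob]]
  note l = iso_hom[OF lun_iso[OF XY(1)]] iso_hom[OF lun_iso[OF XY(2)]]
  have "run C Y \<cdot> (f \<star> Id C (Sph C)) = Lun C Y \<cdot> (Sym C Y (Sph C) \<cdot> (f \<star> Id C (Sph C)))"
    unfolding run_def using comp_assoc[OF smash_hom[OF f I] s(1) l(2)] by simp
  also have "\<dots> = (Lun C Y \<cdot> (Id C (Sph C) \<star> f)) \<cdot> Sym C X (Sph C)"
    using sym_nat[OF f I] comp_assoc[OF s(2) smash_hom[OF I f] l(2)] by simp
  also have "\<dots> = f \<cdot> run C X"
    unfolding run_def using lun_nat[OF f] comp_assoc[OF s(2) l(1) f] by simp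
  finally show ?thesis .
qed

lemma sex_right_iso:
  assumes "A \<in> Ob C" "B \<in> Ob C"
  shows "iso_in C (sex_right C A B) (A \<odot> Sus C B) (Sus C (A \<odot> B))"
  unfolding sex_right_def
  using iso_comp[OF iso_comp[OF sym_iso[of A "Sus C B"] sex_iso[of B A]] sus_iso[OF sym_iso[of B A]]]
    assms sus_ob by simp

lemma sex_right_nat:
  assumes f: "f \<in> hom A A'" and g: "g \<in> hom B B'"
  shows "sex_right C A' B' \<cdot> (f \<star> SusM C g) = SusM C (f \<star> g) \<cdot> sex_right C A B"
proof -
  have Ob: "A \<in> Ob C" "A' \<in> Ob C" "B \<in> Ob C" "B' \<in> Ob C" using hom_Ob f g by auto
  have SOb: "Sus C B \<in> Ob C" "Sus C B' \<in> Ob C" using Ob sus_ob by auto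
  note sg = sus_hom[OF g]
  note s1 = iso_hom[OF sym_iso[OF Ob(1) SOb(1)]] and s1' = iso_hom[OF sym_iso[OF Ob(2) SOb(2)]]
  note s2 = iso_hom[OF sex_iso[OF Ob(3,1)]] and s2' = iso_hom[OF sex_iso[OF Ob(4,2)]]
  note s30 = iso_hom[OF sym_iso[OF Ob(3,1)]] and s30' = iso_hom[OF sym_iso[OF Ob(4,2)]]
  note s3 = sus_hom[OF s30] and s3' = sus_hom[OF s30']
  have "sex_right C A' B' \<cdot> (f \<star> SusM C g)
      = SusM C (Sym C B' A') \<cdot> (Sex C B' A' \<cdot> (Sym C A' (Sus C B') \<cdot> (f \<star> SusM C g)))"
    unfolding sex_right_def
    using s1' s2' s3' smash_hom[OF f sg] by (simp add: arrow_simps)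
  also have "\<dots> = SusM C (Sym C B' A') \<cdot> ((Sex C B' A' \<cdot> (SusM C g \<star> f)) \<cdot> Sym C A (Sus C B))"
    using sym_nat[OF f sg] s1 s2' s3' smash_hom[OF sg f] by (simp add: arrow_simps)
  also have "\<dots> = SusM C (Sym C B' A' \<cdot> (g \<star> f)) \<cdot> (Sex C B A \<cdot> Sym C A (Sus C B))"
    using sex_nat[OF g f] s1 s2 s3' s30' smash_hom[OF g f] sus_hom[OF smash_hom[OF g f]]
      sus_comp[OF smash_hom[OF g f] s30']
    by (simp add: arrow_simps)
  also have "Sym C B' A' \<cdot> (g \<star> f) = (f \<star> g) \<cdot> Sym C B A" using sym_nat[OF g f] .
  also have "SusM C ((f \<star> g) \<cdot> Sym C B A) \<cdot> (Sex C B A \<cdot> Sym C A (Sus C B))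
      = SusM C (f \<star> g) \<cdot> sex_right C A B"
    unfolding sex_right_def
    using sus_comp[OF s30 smash_hom[OF f g]] s1 s2 s3 sus_hom[OF smash_hom[OF f g]]
    by (simp add: arrow_simps)
  finally show ?thesis .
qed

text \<open>This is \<open>u \<star> Id C P\<close> preceded by the inverse of the left unit
  isomorphism; for the unit \<open>u\<close> of \<open>H\<close> it is the Hurewicz arrow of
  \<open>P\<close>. It is pinned down by its composite with \<open>Lun C P\<close>, so that no
  inverse has to be named.\<close>

definition insertion where
  "insertion u P = (SOME i. i \<in> hom P (Cod C u \<odot> P) \<and> i \<cdot> Lun C P = u \<star> Id C P)"

lemma insertion:
  assumes u: "u \<in> hom (Sph C) X" and P: "P \<in> Ob C"
  shows "insertion u P \<in> hom P (X \<odot> P)" "insertion u P \<cdot> Lun C P = u \<star> Id C P"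
proof -
  obtain l where l: "Lun C P \<in> hom (Sph C \<odot> P) P" "l \<in> hom P (Sph C \<odot> P)" "l \<cdot> Lun C P = Id C (Sph C \<odot> P)"
    by (rule iso_inE[OF lun_iso[OF P]])
  have uP: "u \<star> Id C P \<in> hom (Sph C \<odot> P) (X \<odot> P)" using smash_hom[OF u id_hom[OF P]] .
  have "(u \<star> Id C P) \<cdot> l \<in> hom P (Cod C u \<odot> P) \<and> ((u \<star> Id C P) \<cdot> l) \<cdot> Lun C P = u \<star> Id C P"
    using comp_hom[OF l(2) uP] comp_assoc[OF l(1,2) uP] l(3) comp_id[OF uP] u by (simp add: homset_iff)
  then have "insertion u P \<in> hom P (Cod C u \<odot> P) \<and> insertion u P \<cdot> Lun C P = u \<star> Id C P"
    unfolding insertion_def by (rule someI)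
  then show "insertion u P \<in> hom P (X \<odot> P)" "insertion u P \<cdot> Lun C P = u \<star> Id C P"
    using u by (auto simp: homset_iff)
qed

lemma insertion_nat:
  assumes u: "u \<in> hom (Sph C) X" and f: "f \<in> hom P P'"
  shows "insertion u P' \<cdot> f = (Id C X \<star> f) \<cdot> insertion u P"
proof -
  have Ob: "X \<in> Ob C" "P \<in> Ob C" "P' \<in> Ob C" using hom_Ob u f by auto
  note i = insertion[OF u Ob(2)] and i' = insertion[OF u Ob(3)]
  note l = iso_hom[OF lun_iso[OF Ob(2)]] and l' = iso_hom[OF lun_iso[OF Ob(3)]]
  have I: "Id C (Sph C) \<in> hom (Sph C) (Sph C)" "Id C X \<in> hom X X" using id_hom sph_ob Ob by auto
  have "insertion u P' \<cdot> f \<cdot> Lun C P = insertion u P' \<cdot> Lun C P' \<cdot> (Id C (Sph C) \<star> f)"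
    using lun_nat[OF f] comp_assoc[OF l f i'(1)] comp_assoc[OF smash_hom[OF I(1) f] l' i'(1)] by simp
  also have "\<dots> = u \<star> f" using i'(2) smash_split(1)[OF u f] by simp
  also have "\<dots> = (Id C X \<star> f) \<cdot> insertion u P \<cdot> Lun C P"
    using i(2) smash_split(2)[OF u f] comp_assoc[OF l i(1) smash_hom[OF I(2) f]] by simp
  finally show ?thesis
    using iso_cancel_right[OF lun_iso[OF Ob(2)] comp_hom[OF f i'(1)] comp_hom[OF i(1) smash_hom[OF I(2) f]]]
    by simp
qed

text \<open>The smash product is additive in its first variable, so torsion of \<open>u\<close>
  passes to all its insertions. This is where the exponent \<open>p\<close> of the homotopy of
  \<open>H \<odot> E\<close> comes from.\<close>

lemma multiple_insertion:
  assumes u: "u \<in> hom (Sph C) X" and P: "P \<in> Ob C" and "multiple C n u = zero (Sph C) X"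
  shows "multiple C n (insertion u P) = zero P (X \<odot> P)"
proof -
  note i = insertion[OF u P] and l = lun_iso[OF P]
  have "multiple C n (insertion u P) \<cdot> Lun C P = multiple C n u \<star> Id C P"
    using multiple_comp_left[OF iso_hom[OF l] i(1)] i(2) smash_multiple_left[OF u id_hom[OF P]] by simp
  also have "\<dots> = zero (Sph C \<odot> P) (X \<odot> P)"
    using assms(3) smash_zero_left[OF _ _ id_hom[OF P]] hom_Ob[OF u] by simp
  finally show ?thesis using iso_zero_right[OF l multiple_hom[OF i(1)]] by blast
qed

text \<open>The automorphism \<open>c\<close> compares two identifications of
  \<open>Sph C \<odot> Sus C P\<close> with \<open>Sus C P\<close>. Leaving it unspecified saves a
  coherence computation, and statements about generation by multiples are insensitive to it.\<close>

lemma sus_insertion: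
  assumes u: "u \<in> hom (Sph C) X" and P: "P \<in> Ob C"
  obtains c where "iso_in C c (Sus C P) (Sus C P)"
    "sex_right C X P \<cdot> insertion u (Sus C P) = SusM C (insertion u P) \<cdot> c"
proof -
  have Ob: "X \<in> Ob C" "Sph C \<in> Ob C" "Sus C P \<in> Ob C" using hom_Ob u P sus_ob by auto
  note i = insertion[OF u P] and i' = insertion[OF u Ob(3)]
  note l = iso_hom[OF lun_iso[OF P]] and l' = iso_hom[OF lun_iso[OF Ob(3)]]
  note s = iso_hom[OF sex_right_iso[OF Ob(1) P]] and s0 = iso_hom[OF sex_right_iso[OF Ob(2) P]]
  obtain k where k: "k \<in> hom (Sus C P) (Sph C \<odot> Sus C P)" "Lun C (Sus C P) \<cdot> k = Id C (Sus C P)"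
      "iso_in C k (Sus C P) (Sph C \<odot> Sus C P)"
    by (rule iso_inE[OF lun_iso[OF Ob(3)]])
  define c where "c = SusM C (Lun C P) \<cdot> (sex_right C (Sph C) P \<cdot> k)"
  have c: "iso_in C c (Sus C P) (Sus C P)"
    unfolding c_def by (rule iso_comp[OF iso_comp[OF k(3) sex_right_iso[OF Ob(2) P]] sus_iso[OF lun_iso[OF P]]])
  have "sex_right C X P \<cdot> insertion u (Sus C P) = sex_right C X P \<cdot> (insertion u (Sus C P) \<cdot> (Lun C (Sus C P) \<cdot> k))"
    using k comp_id[OF i'(1)] by simp
  also have "\<dots> = sex_right C X P \<cdot> ((u \<star> Id C (Sus C P)) \<cdot> k)"
    using comp_assoc[OF k(1) l' i'(1)] i'(2) by simp
  also have "\<dots> = (sex_right C X P \<cdot> (u \<star> SusM C (Id C P))) \<cdot> k"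
    using comp_assoc[OF k(1) smash_hom[OF u id_hom[OF Ob(3)]] s] sus_id[OF P] by simp
  also have "\<dots> = (SusM C (insertion u P \<cdot> Lun C P) \<cdot> sex_right C (Sph C) P) \<cdot> k"
    using sex_right_nat[OF u id_hom[OF P]] i(2) by simp
  also have "\<dots> = SusM C (insertion u P) \<cdot> c"
    unfolding c_def using sus_comp[OF l i(1)] k(1) s0 sus_hom[OF l] sus_hom[OF i(1)]
    by (simp add: arrow_simps)
  finally show ?thesis using that c by blast
qed

end

section \<open>Spheres\<close>

context monogenic_stable_category
begin

definition desuspend where "desuspend X = (SOME Y. Y \<in> Ob C \<and> isomorphic (Sus C Y) X)"

lemma desuspend:
  assumes "X \<in> Ob C" shows "desuspend X \<in> Ob C" "isomorphic (Sus C (desuspend X)) X"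
proof -
  have "\<exists>Y. Y \<in> Ob C \<and> isomorphic (Sus C Y) X" using sus_ess_surj[OF assms] isomorphic_def by blast
  then have "desuspend X \<in> Ob C \<and> isomorphic (Sus C (desuspend X)) X" unfolding desuspend_def by (rule someI_ex)
  then show "desuspend X \<in> Ob C" "isomorphic (Sus C (desuspend X)) X" by auto
qed

text \<open>In negative degrees desuspensions are chosen, so suspending \<open>sphere n\<close>
  gives \<open>sphere (n + 1)\<close> only up to isomorphism.\<close>

definition sphere :: "int \<Rightarrow> 'a" where
  "sphere n = (if 0 \<le> n then (Sus C ^^ nat n) (Sph C) else (desuspend ^^ nat (- n)) (Sph C))"

lemma sphere_0 [simp]: "sphere 0 = Sph C"
  by (simp add: sphere_def)

lemma sus_pow_Ob: "X \<in> Ob C \<Longrightarrow> (Sus C ^^ n) X \<in> Ob C"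
  by (induction n) (auto simp: sus_ob)

lemma sphere_Ob [simp]: "sphere n \<in> Ob C"
proof -
  have "(desuspend ^^ k) (Sph C) \<in> Ob C" for k by (induction k) (auto simp: sph_ob desuspend)
  then show ?thesis using sus_pow_Ob sph_ob by (simp add: sphere_def)
qed

lemma sphere_sus: "isomorphic (Sus C (sphere n)) (sphere (n + 1))"
proof (cases "0 \<le> n")
  case True
  then have "Sus C (sphere n) = sphere (n + 1)" by (simp add: sphere_def nat_add_distrib)
  then show ?thesis using isomorphic_refl sphere_Ob by metis
next
  case False
  then have "n = - int (nat (- n - 1)) - 1" by simp
  then obtain k where k: "n = - int k - 1" by blast
  have "sphere n = desuspend (sphere (n + 1))"
    using k by (cases "k = 0") (auto simp: sphere_def nat_add_distrib)
  then show ?thesis using desuspend(2)[of "sphere (n + 1)"] by simp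
qed

text \<open>The suspension hypothesis is an equivalence because spheres of negative dimension are
  reached by cancelling suspensions.\<close>

lemma sphere_induct:
  assumes base: "Q (Sph C)"
    and iso: "\<And>X Y. isomorphic X Y \<Longrightarrow> Q X \<Longrightarrow> Q Y"
    and sus: "\<And>X. X \<in> Ob C \<Longrightarrow> Q X \<longleftrightarrow> Q (Sus C X)"
  shows "Q (sphere n)"
proof (induction n rule: int_induct[where k = 0])
  case base
  then show ?case using assms(1) by simp
next
  case (step1 i)
  then show ?case using sus[of "sphere i"] iso[OF sphere_sus] by simp
next
  case (step2 i)
  have "Q (Sus C (sphere (i - 1)))"
    using iso[OF isomorphic_sym[OF sphere_sus[of "i - 1"]]] step2 by simp
  then show ?case using sus[of "sphere (i - 1)"] by simp
qed

lemma sphere_orth_sus: "X \<in> Ob C \<Longrightarrow> orth (sphere (n + 1)) (Sus C X) \<longleftrightarrow> orth (sphere n) X"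
  using sus_orth_iff[of "sphere n" X] orth_iso[OF _ sphere_sus[of n] isomorphic_refl, of "Sus C X"]
    orth_iso[OF _ isomorphic_sym[OF sphere_sus[of n]] isomorphic_refl, of "Sus C X"] sus_ob[of X] by auto

lemma sphere_orth_sus_pow:
  "X \<in> Ob C \<Longrightarrow> orth (sphere (n + int k)) ((Sus C ^^ k) X) \<longleftrightarrow> orth (sphere n) X"
proof (induction k)
  case (Suc k)
  then show ?case using sphere_orth_sus[OF sus_pow_Ob, of X "n + int k" k] by (simp add: add.commute add.left_commute)
qed simp

section \<open>Homotopy groups and arrows out of spheres\<close>

lemma orth_trivial_group:
  assumes "X \<in> Ob C" "Y \<in> Ob C"
  shows "trivial_group (hom_group C X Y) \<longleftrightarrow> orth X Y"
proof
  assume "orth X Y"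
  then have "hom X Y = {zero X Y}" unfolding orth_def using zero_hom[OF assms] by blast
  then show "trivial_group (hom_group C X Y)"
    using hom_group[OF assms] by (simp add: trivial_group_def comm_group_def)
qed (auto simp: trivial_group_def orth_def)

text \<open>For negative \<open>n\<close> the homotopy group suspends the target whereas
  \<open>sphere n\<close> desuspends the source; suspending both source and target compares the
  two.\<close>

lemma homotopy_group_trivial:
  assumes "X \<in> Ob C" shows "trivial_group (homotopy_group C n X) \<longleftrightarrow> orth (sphere n) X"
proof (cases "0 \<le> n")
  case True
  then show ?thesis using orth_trivial_group[of "(Sus C ^^ nat n) (Sph C)" X] assms sus_pow_Ob sph_ob
    by (simp add: homotopy_group_def sphere_def)
next
  case False
  then show ?thesis
    using orth_trivial_group[of "Sph C" "(Sus C ^^ nat (- n)) X"] assms sus_pow_Ob sph_ob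
      sphere_orth_sus_pow[OF assms, of n "nat (- n)"]
    by (simp add: homotopy_group_def)
qed

lemma zero_object_sphere: "X \<in> Ob C \<Longrightarrow> (\<And>n. orth (sphere n) X) \<Longrightarrow> zero_object C X"
  using sph_generates homotopy_group_trivial by blast

lemma hom_lepoll_sus: "X \<in> Ob C \<Longrightarrow> Y \<in> Ob C \<Longrightarrow> hom X Y \<lesssim> hom (Sus C X) (Sus C Y)"
  using bij_betw_imp_inj_on[OF sus_fully_faithful, of X Y] bij_betw_imp_surj_on[OF sus_fully_faithful, of X Y]
  unfolding lepoll_def by blast

lemma hom_lepoll_iso:
  assumes "isomorphic X' X"
  shows "hom X Y \<lesssim> hom X' Y"
proof -
  obtain e where e: "iso_in C e X' X" using assms isomorphic_def by blast
  have "inj_on (\<lambda>a. a \<cdot> e) (hom X Y)" using iso_cancel_right[OF e] by (auto intro: inj_onI)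
  moreover have "(\<lambda>a. a \<cdot> e) ` hom X Y \<subseteq> hom X' Y" using comp_hom iso_hom[OF e] by blast
  ultimately show ?thesis unfolding lepoll_def by blast
qed

lemma hom_sphere_lepoll:
  assumes "X \<in> Ob C" shows "hom (sphere n) X \<lesssim> hom (sphere (n + int k)) ((Sus C ^^ k) X)"
proof (induction k)
  case (Suc k)
  note Suc
  also have "hom (sphere (n + int k)) ((Sus C ^^ k) X) \<lesssim> hom (Sus C (sphere (n + int k))) (Sus C ((Sus C ^^ k) X))"
    using hom_lepoll_sus sus_pow_Ob assms by simp
  also have "\<dots> \<lesssim> hom (sphere (n + int k + 1)) (Sus C ((Sus C ^^ k) X))"
    using hom_lepoll_iso[OF isomorphic_sym[OF sphere_sus]] .
  finally show ?case by (simp add: add.commute add.left_commute)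
qed simp

lemma hom_sphere_small:
  assumes "X \<in> Ob C" shows "\<exists>I. Small C I \<and> hom (sphere n) X \<lesssim> I"
proof (cases "0 \<le> n")
  case True
  then show ?thesis using homotopy_small[OF assms, of n] by (simp add: homotopy_group_def sphere_def)
next
  case False
  then obtain I where I: "Small C I" "hom (Sph C) ((Sus C ^^ nat (- n)) X) \<lesssim> I"
    using homotopy_small[OF assms, of n] by (auto simp: homotopy_group_def)
  have "hom (sphere n) X \<lesssim> hom (Sph C) ((Sus C ^^ nat (- n)) X)"
    using hom_sphere_lepoll[OF assms, of n "nat (- n)"] False by simp
  then show ?thesis using I lepoll_trans by blast
qed

text \<open>Compactness as an induction principle: an arrow from \<open>P\<close> into a coproduct is a finite sum of
  arrows through the summands.\<close>

definition compact_object where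
  "compact_object P \<longleftrightarrow> (\<forall>I D Q j S. Small C I \<and> (\<forall>i\<in>I. D i \<in> Ob C) \<and> is_coproduct C I D Q j \<and>
     zero P Q \<in> S \<and> (\<forall>i\<in>I. \<forall>g \<in> hom P (D i). j i \<cdot> g \<in> S) \<and>
     (\<forall>x \<in> S \<inter> hom P Q. \<forall>y \<in> S \<inter> hom P Q. Plus C x y \<in> S) \<longrightarrow> hom P Q \<subseteq> S)"

lemma compact_objectD:
  assumes "compact_object P" "Small C I" "\<And>i. i \<in> I \<Longrightarrow> D i \<in> Ob C" "is_coproduct C I D Q j" "a \<in> hom P Q"
    "R (zero P Q)" "\<And>i g. i \<in> I \<Longrightarrow> g \<in> hom P (D i) \<Longrightarrow> R (j i \<cdot> g)"
    "\<And>x y. x \<in> hom P Q \<Longrightarrow> y \<in> hom P Q \<Longrightarrow> R x \<Longrightarrow> R y \<Longrightarrow> R (Plus C x y)"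
  shows "R a"
proof -
  have "hom P Q \<subseteq> Collect R"
    using assms(1)[unfolded compact_object_def, rule_format, of I D Q j "Collect R"] assms(2-4,6-8) by blast
  then show ?thesis using assms(5) by blast
qed

lemma compact_Sph: "compact_object (Sph C)"
  unfolding compact_object_def
proof (intro allI impI subsetI, elim conjE)
  fix I D Q j S a
  assume I: "Small C I" and D: "\<forall>i\<in>I. D i \<in> Ob C" and cop: "is_coproduct C I D Q j"
    and z: "zero (Sph C) Q \<in> S" and g: "\<forall>i\<in>I. \<forall>g \<in> hom (Sph C) (D i). j i \<cdot> g \<in> S"
    and p: "\<forall>x \<in> S \<inter> hom (Sph C) Q. \<forall>y \<in> S \<inter> hom (Sph C) Q. Plus C x y \<in> S"
    and a: "a \<in> hom (Sph C) Q"
  obtain F k where F: "finite F" "F \<subseteq> I" "\<And>i. i \<in> F \<Longrightarrow> k i \<in> hom (Sph C) (D i)"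
      "a = finprod (hom_group C (Sph C) Q) (\<lambda>i. j i \<cdot> k i) F"
    using sph_small[OF I _ cop a] D by metis
  interpret G: comm_group "hom_group C (Sph C) Q" using hom_is_group[OF a] .
  have jk: "j i \<cdot> k i \<in> S \<inter> hom (Sph C) Q" if "i \<in> F" for i
    using g F that comp_hom[OF F(3)[OF that] coproduct_inj[OF cop]] by blast
  have "finprod (hom_group C (Sph C) Q) (\<lambda>i. j i \<cdot> k i) E \<in> S \<inter> hom (Sph C) Q" if "finite E" "E \<subseteq> F" for E
    using that
  proof (induction E)
    case empty
    then show ?case using z hom_Ob[OF a] by simp
  next
    case (insert i E)
    have "(\<lambda>i. j i \<cdot> k i) \<in> E \<rightarrow> carrier (hom_group C (Sph C) Q)"
      "j i \<cdot> k i \<in> carrier (hom_group C (Sph C) Q)" using insert.prems jk by auto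
    from G.finprod_insert[OF insert.hyps this]
    have "finprod (hom_group C (Sph C) Q) (\<lambda>i. j i \<cdot> k i) (insert i E)
        = Plus C (j i \<cdot> k i) (finprod (hom_group C (Sph C) Q) (\<lambda>i. j i \<cdot> k i) E)"
      by simp
    then show ?case using insert jk[of i] p plus_hom by auto
  qed
  then show "a \<in> S" using F by blast
qed

lemma compact_iso:
  assumes iso: "isomorphic P P'" and P: "compact_object P" shows "compact_object P'"
  unfolding compact_object_def
proof (intro allI impI subsetI, elim conjE)
  fix I D Q j S a
  assume I: "Small C I" and D: "\<forall>i\<in>I. D i \<in> Ob C" and cop: "is_coproduct C I D Q j"
    and z: "zero P' Q \<in> S" and g: "\<forall>i\<in>I. \<forall>g \<in> hom P' (D i). j i \<cdot> g \<in> S"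
    and p: "\<forall>x \<in> S \<inter> hom P' Q. \<forall>y \<in> S \<inter> hom P' Q. Plus C x y \<in> S"
    and a: "a \<in> hom P' Q"
  obtain e where e0: "iso_in C e P P'" using iso isomorphic_def by blast
  obtain e' where e: "e \<in> hom P P'" "e' \<in> hom P' P" "e \<cdot> e' = Id C P'" "P' \<in> Ob C" "P \<in> Ob C" by (rule iso_inE[OF e0])
  have "(a \<cdot> e) \<cdot> e' \<in> S"
  proof (rule compact_objectD[OF P I _ cop comp_hom[OF e(1) a], where R = "\<lambda>x. x \<cdot> e' \<in> S"])
    show "D i \<in> Ob C" if "i \<in> I" for i using D that by blast
    show "zero P Q \<cdot> e' \<in> S" using comp_zero_left[OF e(2)] coproduct_Ob[OF cop] z by simp
    show "j i \<cdot> h \<cdot> e' \<in> S" if "i \<in> I" "h \<in> hom P (D i)" for i h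
      using g comp_hom[OF e(2) that(2)] comp_assoc[OF e(2) that(2) coproduct_inj[OF cop that(1)]] that(1) by force
    show "Plus C x y \<cdot> e' \<in> S" if "x \<in> hom P Q" "y \<in> hom P Q" "x \<cdot> e' \<in> S" "y \<cdot> e' \<in> S" for x y
      using comp_plus_left[OF e(2) that(1,2)] p that comp_hom[OF e(2)] by simp
  qed
  then show "a \<in> S" using comp_assoc[OF e(2,1) a] e(3) comp_id[OF a] by simp
qed

text \<open>Up to isomorphism every summand is a suspension. As suspension preserves coproducts, so
  is the coproduct, and the arrow out of \<open>Sus C P\<close> desuspends to one into the coproduct
  of the desuspended summands.\<close>

lemma compact_sus:
  assumes Ob: "P \<in> Ob C" and P: "compact_object P" shows "compact_object (Sus C P)"
  unfolding compact_object_def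
proof (intro allI impI subsetI, elim conjE)
  fix I D Q j S a
  assume I: "Small C I" and D: "\<forall>i\<in>I. D i \<in> Ob C" and cop: "is_coproduct C I D Q j"
    and z: "zero (Sus C P) Q \<in> S" and g: "\<forall>i\<in>I. \<forall>g \<in> hom (Sus C P) (D i). j i \<cdot> g \<in> S"
    and p: "\<forall>x \<in> S \<inter> hom (Sus C P) Q. \<forall>y \<in> S \<inter> hom (Sus C P) Q. Plus C x y \<in> S"
    and a: "a \<in> hom (Sus C P) Q"
  define D' where "D' i = desuspend (D i)" for i
  have D': "D' i \<in> Ob C" if "i \<in> I" for i using D that desuspend D'_def by simp
  have "\<exists>e. iso_in C e (Sus C (D' i)) (D i)" if "i \<in> I" for i
    using D that desuspend(2) unfolding D'_def isomorphic_def by blast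
  then obtain e where e: "\<And>i. i \<in> I \<Longrightarrow> iso_in C (e i) (Sus C (D' i)) (D i)" by metis
  obtain Q' j' where cop': "is_coproduct C I D' Q' j'" using coproducts[OF I, of D'] D' by blast
  obtain t where t: "iso_in C t (Sus C Q') Q" "\<And>i. i \<in> I \<Longrightarrow> t \<cdot> SusM C (j' i) = j i \<cdot> e i"
    using coproduct_comparison[OF sus_coproduct[OF cop' D'] coproduct_iso[OF cop e]] by metis
  obtain t' where t': "t \<in> hom (Sus C Q') Q" "t' \<in> hom Q (Sus C Q')" "t \<cdot> t' = Id C Q"
    "Q \<in> Ob C" "Sus C Q' \<in> Ob C" by (rule iso_inE[OF t(1)])
  have Q': "Q' \<in> Ob C" using coproduct_Ob[OF cop'] .
  obtain b where b: "b \<in> hom P Q'" "SusM C b = t' \<cdot> a" by (rule sus_full[OF comp_hom[OF a t'(2)] Ob Q'])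
  have "t \<cdot> SusM C b \<in> S"
  proof (rule compact_objectD[OF P I D' cop' b(1)])
    show "t \<cdot> SusM C (zero P Q') \<in> S" using sus_zero[OF Ob Q'] comp_zero_right[OF t'(1)] sus_ob[OF Ob] z by simp
    show "t \<cdot> SusM C (j' i \<cdot> h) \<in> S" if i: "i \<in> I" and h: "h \<in> hom P (D' i)" for i h
    proof -
      note j'i = coproduct_inj[OF cop' i] and ji = coproduct_inj[OF cop i]
      have "t \<cdot> SusM C (j' i \<cdot> h) = j i \<cdot> (e i \<cdot> SusM C h)"
        using sus_comp[OF h j'i] comp_assoc[OF sus_hom[OF h] sus_hom[OF j'i] t'(1)] t(2)[OF i]
          comp_assoc[OF sus_hom[OF h] iso_hom[OF e[OF i]] ji] by simp
      then show ?thesis using g i comp_hom[OF sus_hom[OF h] iso_hom[OF e[OF i]]] by simp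
    qed
    show "t \<cdot> SusM C (Plus C x y) \<in> S"
      if x: "x \<in> hom P Q'" and y: "y \<in> hom P Q'" and S: "t \<cdot> SusM C x \<in> S" "t \<cdot> SusM C y \<in> S" for x y
      using sus_plus[OF x y] comp_plus_right[OF sus_hom[OF x] sus_hom[OF y] t'(1)] p S
        comp_hom[OF sus_hom[OF x] t'(1)] comp_hom[OF sus_hom[OF y] t'(1)] by simp
  qed
  then show "a \<in> S" using b(2) comp_assoc[OF a t'(2,1)] t'(3) comp_id[OF a] by simp
qed

lemma compact_desus:
  assumes Ob: "P \<in> Ob C" and P: "compact_object (Sus C P)" shows "compact_object P"
  unfolding compact_object_def
proof (intro allI impI subsetI, elim conjE)
  fix I D Q j S a
  assume I: "Small C I" and D: "\<forall>i\<in>I. D i \<in> Ob C" and cop: "is_coproduct C I D Q j"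
    and z: "zero P Q \<in> S" and g: "\<forall>i\<in>I. \<forall>g \<in> hom P (D i). j i \<cdot> g \<in> S"
    and p: "\<forall>x \<in> S \<inter> hom P Q. \<forall>y \<in> S \<inter> hom P Q. Plus C x y \<in> S"
    and a: "a \<in> hom P Q"
  have Q: "Q \<in> Ob C" using coproduct_Ob[OF cop] .
  have Di: "D i \<in> Ob C" if "i \<in> I" for i using D that by blast
  \<comment> \<open>Membership in \<open>S\<close> is transported along suspension: an arrow
    qualifies if it is the suspension of a member of \<open>S\<close>.\<close>
  have "\<exists>y \<in> S \<inter> hom P Q. SusM C a = SusM C y"
  proof (rule compact_objectD[OF P I _ sus_coproduct[OF cop Di] sus_hom[OF a]])
    show "Sus C (D i) \<in> Ob C" if "i \<in> I" for i using Di sus_ob that by blast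
    show "\<exists>y \<in> S \<inter> hom P Q. zero (Sus C P) (Sus C Q) = SusM C y"
      using z sus_zero[OF Ob Q, symmetric] zero_hom[OF Ob Q] by blast
    show "\<exists>y \<in> S \<inter> hom P Q. SusM C (j i) \<cdot> h = SusM C y"
      if i: "i \<in> I" and h: "h \<in> hom (Sus C P) (Sus C (D i))" for i h
    proof -
      obtain k where k: "k \<in> hom P (D i)" "SusM C k = h" by (rule sus_full[OF h Ob Di[OF i]])
      then show ?thesis
        using g i sus_comp[OF k(1) coproduct_inj[OF cop i]] comp_hom[OF k(1) coproduct_inj[OF cop i]]
        by (intro bexI[of _ "j i \<cdot> k"]) auto
    qed
    show "\<exists>y \<in> S \<inter> hom P Q. Plus C v w = SusM C y"
      if vw: "\<exists>y \<in> S \<inter> hom P Q. v = SusM C y" "\<exists>y \<in> S \<inter> hom P Q. w = SusM C y" for v w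
    proof -
      obtain x y where xy: "x \<in> S \<inter> hom P Q" "v = SusM C x" "y \<in> S \<inter> hom P Q" "w = SusM C y"
        using vw by blast
      then have "Plus C x y \<in> S \<inter> hom P Q" using p plus_hom by blast
      moreover have "Plus C v w = SusM C (Plus C x y)" using sus_plus xy by auto
      ultimately show ?thesis by blast
    qed
  qed
  then show "a \<in> S" using sus_inject a by blast
qed

lemma compact_sphere: "compact_object (sphere n)"
proof (rule conjunct2, rule sphere_induct[where Q = "\<lambda>X. X \<in> Ob C \<and> compact_object X"])
  show "Sph C \<in> Ob C \<and> compact_object (Sph C)" using sph_ob compact_Sph by blast
  show "Y \<in> Ob C \<and> compact_object Y" if "isomorphic X Y" "X \<in> Ob C \<and> compact_object X" for X Y
    using that compact_iso isomorphic_Ob by blast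
  show "X \<in> Ob C \<and> compact_object X \<longleftrightarrow> Sus C X \<in> Ob C \<and> compact_object (Sus C X)" if "X \<in> Ob C" for X
    using that sus_ob compact_sus compact_desus by blast
qed

lemma sphere_orth_coproduct:
  assumes "Small C I" "\<And>i. i \<in> I \<Longrightarrow> D i \<in> Ob C" "is_coproduct C I D Q j" "\<And>i. i \<in> I \<Longrightarrow> orth (sphere n) (D i)"
  shows "orth (sphere n) Q"
  unfolding orth_def
proof
  have Q: "Q \<in> Ob C" using coproduct_Ob[OF assms(3)] .
  fix a assume a: "a \<in> hom (sphere n) Q"
  show "a = zero (sphere n) Q"
  proof (rule compact_objectD[OF compact_sphere assms(1,2,3) a])
    show "j i \<cdot> g = zero (sphere n) Q" if "i \<in> I" "g \<in> hom (sphere n) (D i)" for i g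
      using orthD[OF assms(4) that(2)] that(1) comp_zero_right[OF coproduct_inj[OF assms(3)]] by simp
    show "Plus C x y = zero (sphere n) Q"
      if "x \<in> hom (sphere n) Q" "x = zero (sphere n) Q" "y = zero (sphere n) Q" for x y
      using that plus_zero(1) by blast
  qed simp_all
qed

end

section \<open>Connectivity\<close>

locale connective_stable_category = monogenic_stable_category +
  assumes unit_connective: "0 < k \<Longrightarrow> orth (Sph C) ((Sus C ^^ k) (Sph C))"
begin

text \<open>Both degrees can be shifted simultaneously, which reduces the claim to arrows out of the
  unit.\<close>

lemma sphere_orth_sphere:
  assumes "n < m" shows "orth (sphere n) (sphere m)"
proof -
  have shift: "orth (sphere (n + 1)) (sphere (m + 1)) \<longleftrightarrow> orth (sphere n) (sphere m)" for n m
    using sphere_orth_sus[of "sphere m" n] orth_iso[OF _ isomorphic_refl sphere_sus[of m], of "sphere (n + 1)"]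
      orth_iso[OF _ isomorphic_refl isomorphic_sym[OF sphere_sus[of m]], of "sphere (n + 1)"] by auto
  have "orth (sphere n) (sphere (n + int k)) \<longleftrightarrow> orth (sphere 0) (sphere (int k))" for k
  proof (induction n rule: int_induct[where k = 0])
    case (step1 i)
    then show ?case using shift[of i "i + int k"] by (simp add: ac_simps)
  next
    case (step2 i)
    then show ?case using shift[of "i - 1" "i - 1 + int k"] by simp
  qed simp
  from this[of "nat (m - n)"] assms show ?thesis
    using unit_connective[of "nat (m - n)"] by (simp add: sphere_def)
qed

text \<open>Attach one cell for each homotopy class of positive dimension.\<close>

lemma kill_homotopy:
  assumes A: "A \<in> Ob C" and conn: "\<And>n. n \<le> 0 \<Longrightarrow> orth (sphere n) A"
  obtains A' s where "s \<in> hom A A'" "\<And>n. n \<le> 0 \<Longrightarrow> orth (sphere n) A'"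
    "\<And>n x. x \<in> hom (sphere n) A \<Longrightarrow> s \<cdot> x = zero (sphere n) A'"
    "\<And>G B f. \<lbrakk>G \<in> Ob C; \<And>n. 1 \<le> n \<Longrightarrow> orth (sphere n \<odot> G) B; f \<in> hom (A \<odot> G) B\<rbrakk>
       \<Longrightarrow> \<exists>f' \<in> hom (A' \<odot> G) B. f' \<cdot> (s \<star> Id C G) = f"
proof -
  obtain J where J: "Small C J" "Sigma UNIV (\<lambda>n. hom (sphere n) A) \<lesssim> J"
    using small_Sigma[of "\<lambda>n. hom (sphere n) A"] hom_sphere_small[OF A] by auto
  \<comment> \<open>No cells are needed in degrees up to 0, where \<open>A\<close> has no homotopy
    to be killed.\<close>
  define K where "K = {(n, x). 1 \<le> n \<and> x \<in> hom (sphere n) A}"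
  have "K \<subseteq> Sigma UNIV (\<lambda>n. hom (sphere n) A)" unfolding K_def by auto
  then have "K \<lesssim> J" using J(2) lepoll_trans subset_imp_lepoll by blast
  then obtain \<phi> where \<phi>: "inj_on \<phi> K" "\<phi> ` K \<subseteq> J" unfolding lepoll_def by blast
  define I where "I = \<phi> ` K"
  have I: "Small C I" using \<phi>(2) J(1) small_lepoll subset_imp_lepoll unfolding I_def by blast
  define \<psi> where "\<psi> = inv_into K \<phi>"
  have \<psi>: "\<psi> (\<phi> k) = k" if "k \<in> K" for k using \<phi>(1) that unfolding \<psi>_def by simp
  have \<psi>K: "\<psi> i \<in> K" if "i \<in> I" for i using that unfolding \<psi>_def I_def by (rule inv_into_into)
  define D where "D i = sphere (fst (\<psi> i))" for i
  have D: "D i \<in> Ob C" for i unfolding D_def by simp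
  have dim: "1 \<le> fst (\<psi> i)" and cell: "snd (\<psi> i) \<in> hom (D i) A" if "i \<in> I" for i
    using \<psi>K[OF that] unfolding K_def D_def by auto
  obtain W j where cop: "is_coproduct C I D W j" using coproducts[OF I, of D] D by blast
  have W: "W \<in> Ob C" using coproduct_Ob[OF cop] .
  obtain t where t: "t \<in> hom W A" "\<And>i. i \<in> I \<Longrightarrow> t \<cdot> j i = snd (\<psi> i)"
    using coproduct_lift[OF cop A cell] by metis
  obtain s h A' where tri: "(t, s, h) \<in> Tri C" and s: "s \<in> hom A A'" and h: "h \<in> hom A' (Sus C W)"
    and A': "A' \<in> Ob C" by (rule cofibre[OF t(1)])
  have kill: "s \<cdot> x = zero (sphere n) A'" if x: "x \<in> hom (sphere n) A" for n x
  proof (cases "1 \<le> n")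
    case True
    define i where "i = \<phi> (n, x)"
    have k: "(n, x) \<in> K" using True x unfolding K_def by simp
    then have i: "i \<in> I" "\<psi> i = (n, x)" using \<psi> unfolding i_def I_def by auto
    have ji: "j i \<in> hom (sphere n) W" using coproduct_inj[OF cop i(1)] i(2) by (simp add: D_def)
    have "s \<cdot> x = s \<cdot> (t \<cdot> j i)" using t(2)[OF i(1)] i(2) by simp
    also have "\<dots> = (s \<cdot> t) \<cdot> j i" using comp_assoc[OF ji t(1) s] .
    also have "\<dots> = zero (sphere n) A'" using tri_zero1[OF tri t(1) s h] comp_zero_left[OF ji A'] by simp
    finally show ?thesis .
  next
    case False
    then show ?thesis using orthD[OF conn x] comp_zero_right[OF s sphere_Ob] by simp
  qed
  \<comment> \<open>\<open>Sus C W\<close> is a coproduct of spheres of dimension at least 2. So a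
    class of \<open>A'\<close> in degree at most 0 lifts to \<open>A\<close>, and \<open>s\<close>
    kills whatever comes from \<open>A\<close>.\<close>
  have conn': "orth (sphere n) A'" if n: "n \<le> 0" for n
    unfolding orth_def
  proof
    fix y assume y: "y \<in> hom (sphere n) A'"
    have "orth (sphere n) (Sus C W)"
    proof (rule sphere_orth_coproduct[OF I _ sus_coproduct[OF cop D]])
      show "Sus C (D i) \<in> Ob C" for i using D sus_ob by blast
      show "orth (sphere n) (Sus C (D i))" if i: "i \<in> I" for i
        using orth_iso[OF sphere_orth_sphere[of n "fst (\<psi> i) + 1"] isomorphic_refl[OF sphere_Ob] isomorphic_sym[OF sphere_sus]]
          n dim[OF i] unfolding D_def by simp
    qed
    from orthD[OF this comp_hom[OF y h]] obtain x where x: "x \<in> hom (sphere n) A" "s \<cdot> x = y"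
      by (rule tri_exact_left2[OF tri t(1) s h y])
    show "y = zero (sphere n) A'" using kill[OF x(1)] x(2) by simp
  qed
  \<comment> \<open>The obstruction to extending \<open>f\<close> over the cofibre lives on
    \<open>W \<odot> G\<close>, a coproduct of spheres of positive dimension smashed with
    \<open>G\<close>, from which there are no arrows to \<open>B\<close>.\<close>
  have ext: "\<exists>f' \<in> hom (A' \<odot> G) B. f' \<cdot> (s \<star> Id C G) = f"
    if G: "G \<in> Ob C" and o: "\<And>n. 1 \<le> n \<Longrightarrow> orth (sphere n \<odot> G) B" and f: "f \<in> hom (A \<odot> G) B" for G B f
  proof -
    note st = smash_tri[OF tri t(1) s h G]
    have "f \<cdot> (t \<star> Id C G) = zero (W \<odot> G) B"
    proof (rule coproduct_eq_zero[OF smash_coproduct[OF I D cop G] comp_hom[OF st(2) f]])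
      fix i assume i: "i \<in> I"
      have ji: "j i \<star> Id C G \<in> hom (D i \<odot> G) (W \<odot> G)"
        using smash_hom[OF coproduct_inj[OF cop i] id_hom[OF G]] .
      show "f \<cdot> (t \<star> Id C G) \<cdot> (j i \<star> Id C G) = zero (D i \<odot> G) B"
        using orthD[OF o[OF dim[OF i]], of "f \<cdot> (t \<star> Id C G) \<cdot> (j i \<star> Id C G)"]
          comp_hom[OF ji comp_hom[OF st(2) f]] by (simp add: D_def)
    qed
    then show ?thesis using tri_exact_right1[OF st f] by metis
  qed
  show ?thesis by (rule that[OF s conn' kill ext])
qed

text \<open>The shift vanishes on homotopy, so \<open>d\<close>, the identity minus the shift, acts on it as the identity.\<close>

lemma telescope_zero:
  fixes A :: "nat \<Rightarrow> 'a"
  assumes e: "inj e" "Small C (range e)"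
    and A: "\<And>k. A k \<in> Ob C" and s: "\<And>k. s k \<in> hom (A k) (A (Suc k))"
    and kill: "\<And>k n x. x \<in> hom (sphere n) (A k) \<Longrightarrow> s k \<cdot> x = zero (sphere n) (A (Suc k))"
    and cop: "is_coproduct C (range e) (\<lambda>i. A (inv_into UNIV e i)) Q j"
    and d: "d \<in> hom Q Q" "\<And>k. d \<cdot> j (e k) = Plus C (j (e k)) (neg C (j (e (Suc k)) \<cdot> s k))"
    and tri: "(d, g, h) \<in> Tri C" and g: "g \<in> hom Q T" and h: "h \<in> hom T (Sus C Q)"
  shows "zero_object C T"
proof (rule zero_object_sphere)
  show T: "T \<in> Ob C" using g hom_Ob by blast
  have Q: "Q \<in> Ob C" using coproduct_Ob[OF cop] .
  have je: "j (e k) \<in> hom (A k) Q" for k using coproduct_inj[OF cop, of "e k"] e(1) by simp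
  \<comment> \<open>By compactness it is enough to consider classes in a single summand; there the
    shift term contains \<open>s k \<cdot> x\<close>, which is zero.\<close>
  have dy: "d \<cdot> y = y" if y: "y \<in> hom (sphere n) Q" for n y
  proof (rule compact_objectD[OF compact_sphere e(2) A cop y])
    show "d \<cdot> zero (sphere n) Q = zero (sphere n) Q" using comp_zero_right[OF d(1) sphere_Ob] .
    show "d \<cdot> Plus C x y = Plus C x y"
      if "x \<in> hom (sphere n) Q" "y \<in> hom (sphere n) Q" "d \<cdot> x = x" "d \<cdot> y = y" for x y
      using comp_plus_right[OF that(1,2) d(1)] that by simp
    fix i x assume "i \<in> range e" and "x \<in> hom (sphere n) (A (inv_into UNIV e i))"
    then obtain k where i: "i = e k" and x: "x \<in> hom (sphere n) (A k)" using e(1) by auto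
    have js: "j (e (Suc k)) \<cdot> s k \<in> hom (A k) Q" using comp_hom[OF s je] .
    have "(j (e (Suc k)) \<cdot> s k) \<cdot> x = zero (sphere n) Q"
      using comp_assoc[OF x s je] kill[OF x] comp_zero_right[OF je sphere_Ob] by simp
    then have n: "neg C (j (e (Suc k)) \<cdot> s k) \<cdot> x = zero (sphere n) Q"
      using comp_neg_left[OF x js] neg_zero[OF sphere_Ob Q] by simp
    have "d \<cdot> (j i \<cdot> x) = Plus C (j (e k)) (neg C (j (e (Suc k)) \<cdot> s k)) \<cdot> x"
      unfolding i using comp_assoc[OF x je d(1)] d(2) by simp
    also have "\<dots> = j i \<cdot> x"
      unfolding i comp_plus_left[OF x je neg_hom[OF js]] n using plus_zero(1)[OF comp_hom[OF x je]] .
    finally show "d \<cdot> (j i \<cdot> x) = j i \<cdot> x" .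
  qed
  \<comment> \<open>The same holds for the suspended arrow, by precomposing with a suspension
    isomorphism and desuspending the class.\<close>
  have Sdy: "SusM C d \<cdot> y = y" if y: "y \<in> hom (sphere n) (Sus C Q)" for n y
  proof -
    obtain c where c0: "iso_in C c (Sus C (sphere (n - 1))) (sphere n)"
      using sphere_sus[of "n - 1"] unfolding isomorphic_def by auto
    have c: "c \<in> hom (Sus C (sphere (n - 1))) (sphere n)" using iso_hom[OF c0] .
    obtain z where z: "z \<in> hom (sphere (n - 1)) Q" "SusM C z = y \<cdot> c"
      by (rule sus_full[OF comp_hom[OF c y] sphere_Ob Q])
    have "(SusM C d \<cdot> y) \<cdot> c = SusM C (d \<cdot> z)"
      using comp_assoc[OF c y sus_hom[OF d(1)]] sus_comp[OF z(1) d(1)] z(2) by simp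
    also have "\<dots> = y \<cdot> c" using dy[OF z(1)] z(2) by simp
    finally show ?thesis using iso_cancel_right[OF c0 comp_hom[OF y sus_hom[OF d(1)]] y] by simp
  qed
  show "orth (sphere n) T" for n
    unfolding orth_def
  proof
    fix a assume a: "a \<in> hom (sphere n) T"
    note ha = comp_hom[OF a h]
    \<comment> \<open>The class \<open>h \<cdot> a\<close> is fixed by \<open>SusM C d\<close>, but
      this composite is zero in the triangle. So \<open>a\<close> lifts to \<open>b\<close>, and
      \<open>b = d \<cdot> b\<close> is killed by \<open>g\<close>.\<close>
    have "h \<cdot> a = SusM C d \<cdot> (h \<cdot> a)" using Sdy[OF ha] by simp
    also have "\<dots> = zero (sphere n) (Sus C Q)"
      using comp_assoc[OF a h sus_hom[OF d(1)]] tri_zero3[OF tri d(1) g h] comp_zero_left[OF a] sus_ob[OF Q] by simp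
    finally obtain b where b: "b \<in> hom (sphere n) Q" "g \<cdot> b = a"
      by (rule tri_exact_left2[OF tri d(1) g h a])
    have "a = (g \<cdot> d) \<cdot> b" using b dy[OF b(1)] comp_assoc[OF b(1) d(1) g] by simp
    then show "a = zero (sphere n) T"
      using tri_zero1[OF tri d(1) g h] comp_zero_left[OF b(1) T] by simp
  qed
qed

text \<open>Any arrow \<open>f\<close> extends step by step over a sequence of objects starting at
  \<open>A\<close>, each step killing all homotopy. The extensions together vanish on the identity
  minus the shift, so they factor through the telescope smashed with \<open>G\<close>. The telescope
  is a zero object, hence all extensions vanish, and \<open>f\<close> is the first of them.\<close>

lemma connective_smash_orth:
  assumes A: "A \<in> Ob C" and conn: "\<And>n. n \<le> 0 \<Longrightarrow> orth (sphere n) A"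
    and G: "G \<in> Ob C" and o: "\<And>n. 1 \<le> n \<Longrightarrow> orth (sphere n \<odot> G) B"
  shows "orth (A \<odot> G) B"
  unfolding orth_def
proof
  fix f assume f: "f \<in> hom (A \<odot> G) B"
  have B: "B \<in> Ob C" using f hom_Ob by blast
  \<comment> \<open>A state of the iteration is an object with homotopy only in positive degrees
    together with an extension of \<open>f\<close> to its smash with \<open>G\<close>.\<close>
  define good where "good a \<longleftrightarrow> fst a \<in> Ob C \<and> (\<forall>n\<le>0. orth (sphere n) (fst a)) \<and> snd a \<in> hom (fst a \<odot> G) B" for a
  define step where "step a b \<longleftrightarrow> (\<exists>s \<in> hom (fst a) (fst b).
      (\<forall>n. \<forall>x \<in> hom (sphere n) (fst a). s \<cdot> x = zero (sphere n) (fst b)) \<and> snd b \<cdot> (s \<star> Id C G) = snd a)" for a b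
  have next_step: "\<exists>b. good b \<and> step a b" if "good a" for a
  proof -
    have a: "fst a \<in> Ob C" "\<And>n. n \<le> 0 \<Longrightarrow> orth (sphere n) (fst a)" "snd a \<in> hom (fst a \<odot> G) B"
      using that unfolding good_def by auto
    show ?thesis
    proof (rule kill_homotopy[OF a(1,2)])
      fix A' s
      assume s: "s \<in> hom (fst a) A'" and c: "\<And>n. n \<le> 0 \<Longrightarrow> orth (sphere n) A'"
        and k: "\<And>n x. x \<in> hom (sphere n) (fst a) \<Longrightarrow> s \<cdot> x = zero (sphere n) A'"
        and e: "\<And>G B f. \<lbrakk>G \<in> Ob C; \<And>n. 1 \<le> n \<Longrightarrow> orth (sphere n \<odot> G) B; f \<in> hom (fst a \<odot> G) B\<rbrakk>
          \<Longrightarrow> \<exists>f' \<in> hom (A' \<odot> G) B. f' \<cdot> (s \<star> Id C G) = f"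
      obtain f' where "f' \<in> hom (A' \<odot> G) B" "f' \<cdot> (s \<star> Id C G) = snd a" using e[OF G o a(3)] by blast
      then have "good (A', f') \<and> step a (A', f')"
        unfolding good_def step_def using s c k hom_Ob by auto
      then show ?thesis by blast
    qed
  qed
  have "good (A, f)" unfolding good_def using A conn f by simp
  then have "\<exists>q. \<forall>k. (good (q k) \<and> (k = 0 \<longrightarrow> q k = (A, f))) \<and> step (q k) (q (Suc k))"
    using next_step by (intro dependent_nat_choice) auto
  then obtain q where q: "\<And>k. good (q k)" "q 0 = (A, f)" "\<And>k. step (q k) (q (Suc k))" by blast
  define A' where "A' k = fst (q k)" for k
  define F where "F k = snd (q k)" for k
  have A': "A' k \<in> Ob C" and F: "F k \<in> hom (A' k \<odot> G) B" for k
    using q(1) unfolding good_def A'_def F_def by auto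
  obtain s where s: "\<And>k. s k \<in> hom (A' k) (A' (Suc k))"
    "\<And>k n x. x \<in> hom (sphere n) (A' k) \<Longrightarrow> s k \<cdot> x = zero (sphere n) (A' (Suc k))"
    "\<And>k. F (Suc k) \<cdot> (s k \<star> Id C G) = F k"
    using q(3) unfolding step_def A'_def F_def by metis
  obtain e :: "nat \<Rightarrow> 'c" where e: "inj e" "Small C (range e)" by (rule small_sequence)
  define ie where "ie = inv_into UNIV e"
  have ie: "ie (e k) = k" for k using e(1) unfolding ie_def by simp
  obtain Q j where cop: "is_coproduct C (range e) (\<lambda>i. A' (ie i)) Q j"
    using coproducts[OF e(2), of "\<lambda>i. A' (ie i)"] A' by blast
  have Q: "Q \<in> Ob C" using coproduct_Ob[OF cop] .
  have je: "j (e k) \<in> hom (A' k) Q" for k using coproduct_inj[OF cop, of "e k"] ie by simp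
  \<comment> \<open>Components of the identity minus the shift, whose cofibre is the
    telescope.\<close>
  define c where "c k = Plus C (j (e k)) (neg C (j (e (Suc k)) \<cdot> s k))" for k
  have js: "j (e (Suc k)) \<cdot> s k \<in> hom (A' k) Q" for k using comp_hom[OF s(1) je] .
  have c: "c k \<in> hom (A' k) Q" for k unfolding c_def using plus_hom[OF je neg_hom[OF js]] .
  obtain d where d0: "d \<in> hom Q Q" "\<And>i. i \<in> range e \<Longrightarrow> d \<cdot> j i = c (ie i)"
    using coproduct_lift[OF cop Q, of "\<lambda>i. c (ie i)"] c by blast
  have d: "d \<cdot> j (e k) = c k" for k using d0(2)[of "e k"] ie by simp
  note copG = smash_coproduct[OF e(2) A' cop G]
  obtain \<Phi> where \<Phi>: "\<Phi> \<in> hom (Q \<odot> G) B" "\<And>i. i \<in> range e \<Longrightarrow> \<Phi> \<cdot> (j i \<star> Id C G) = F (ie i)"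
    using coproduct_lift[OF copG B, of "\<lambda>i. F (ie i)"] F by blast
  have \<Phi>e: "\<Phi> \<cdot> (j (e k) \<star> Id C G) = F k" for k using \<Phi>(2)[of "e k"] ie by simp
  note IG = id_hom[OF G]
  obtain g h T where tri: "(d, g, h) \<in> Tri C" and g: "g \<in> hom Q T" and h: "h \<in> hom T (Sus C Q)"
    by (rule cofibre[OF d0(1)])
  have T: "zero_object C T"
    by (rule telescope_zero[OF e A' s(1,2) cop[unfolded ie_def] d0(1) d[unfolded c_def] tri g h])
  note st = smash_tri[OF tri d0(1) g h G]
  \<comment> \<open>On the summand of index \<open>k\<close> this is \<open>F k\<close> minus
    \<open>F (Suc k)\<close> restricted along \<open>s k\<close>, and the latter equals
    \<open>F k\<close>.\<close>
  have "\<Phi> \<cdot> (d \<star> Id C G) = zero (Q \<odot> G) B"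
  proof (rule coproduct_eq_zero[OF copG comp_hom[OF st(2) \<Phi>(1)]])
    fix i assume "i \<in> range e"
    then obtain k where i: "i = e k" by blast
    note jG = smash_hom[OF je IG, of k] and jsG = smash_hom[OF js IG, of k]
    have "\<Phi> \<cdot> (d \<star> Id C G) \<cdot> (j i \<star> Id C G) = \<Phi> \<cdot> (c k \<star> Id C G)"
      unfolding i using comp_assoc[OF jG st(2) \<Phi>(1)] smash_comp_left[OF je d0(1) G] d by simp
    also have "c k \<star> Id C G = Plus C (j (e k) \<star> Id C G) (neg C ((j (e (Suc k)) \<cdot> s k) \<star> Id C G))"
      unfolding c_def using smash_plus[OF je neg_hom[OF js] IG] smash_neg_left[OF js IG] by simp
    also have "\<Phi> \<cdot> \<dots> = Plus C (\<Phi> \<cdot> (j (e k) \<star> Id C G)) (neg C (\<Phi> \<cdot> ((j (e (Suc k)) \<cdot> s k) \<star> Id C G)))"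
      using comp_plus_right[OF jG neg_hom[OF jsG] \<Phi>(1)] comp_neg_right[OF jsG \<Phi>(1)] by simp
    also have "\<Phi> \<cdot> ((j (e (Suc k)) \<cdot> s k) \<star> Id C G) = F k"
      using smash_comp_left[OF s(1) je G, of k] comp_assoc[OF smash_hom[OF s(1) IG] smash_hom[OF je IG] \<Phi>(1), of k]
        \<Phi>e[of "Suc k"] s(3)[of k] by simp
    finally show "\<Phi> \<cdot> (d \<star> Id C G) \<cdot> (j i \<star> Id C G) = zero (A' (ie i) \<odot> G) B"
      using \<Phi>e[of k] plus_neg(1)[OF F] i ie by simp
  qed
  then obtain \<Psi> where \<Psi>: "\<Psi> \<in> hom (T \<odot> G) B" "\<Psi> \<cdot> (g \<star> Id C G) = \<Phi>"
    by (rule tri_exact_right1[OF st \<Phi>(1)])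
  have "\<Psi> = zero (T \<odot> G) B"
    using orthD[OF zero_object_source[OF smash_zero_object_left[OF T G]] \<Psi>(1)] .
  then have "\<Phi> = zero (Q \<odot> G) B" using \<Psi>(2) comp_zero_left[OF st(3) B] by simp
  then have "F 0 = zero (A' 0 \<odot> G) B" using \<Phi>e[of 0] comp_zero_left[OF smash_hom[OF je IG, of 0] B] by simp
  then show "f = zero (A \<odot> G) B" using q(2) by (simp add: F_def A'_def)
qed

end

section \<open>Bases of abelian groups of prime exponent\<close>

context comm_group
begin

text \<open>Since \<open>x\<close> has finite order, its inverse is a power with natural exponent,
  so natural coefficients are enough.\<close>

lemma generate_insert_elem:
  assumes x: "x \<in> carrier G" and S: "S \<subseteq> carrier G" and xp: "x [^] (p :: nat) = \<one>" "0 < p"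
    and b: "b \<in> generate G (insert x S)"
  shows "\<exists>k :: nat. \<exists>y \<in> generate G S. b = x [^] k \<otimes> y"
  using b
proof (induction rule: generate.induct)
  case one
  show ?case by (rule exI[of _ 0], rule bexI[OF _ generate.one]) simp
next
  case (incl h)
  show ?case
  proof (cases "h = x")
    case True
    then show ?thesis using x by (intro exI[of _ 1] bexI[OF _ generate.one]) simp
  next
    case False
    then have "h \<in> S" using incl by blast
    then show ?thesis using S by (intro exI[of _ 0] bexI[OF _ generate.incl]) auto
  qed
next
  case (inv h)
  show ?case
  proof (cases "h = x")
    case True
    have "x [^] (p - 1) \<otimes> x = \<one>" using xp nat_pow_Suc[of x "p - 1"] by simp
    then have "inv x = x [^] (p - 1)" using x inv_equality by simp
    then show ?thesis using x True by (intro exI[of _ "p - 1"] bexI[OF _ generate.one]) simp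
  next
    case False
    then have "h \<in> S" using inv by blast
    then show ?thesis using S by (intro exI[of _ 0] bexI[OF _ generate.inv]) auto
  qed
next
  case (eng h1 h2)
  then obtain k1 k2 :: nat and y1 y2 where y: "y1 \<in> generate G S" "h1 = x [^] k1 \<otimes> y1"
    "y2 \<in> generate G S" "h2 = x [^] k2 \<otimes> y2" by blast
  then have c: "y1 \<in> carrier G" "y2 \<in> carrier G" using generate_in_carrier[OF S] by auto
  have "h1 \<otimes> h2 = x [^] (k1 + k2) \<otimes> (y1 \<otimes> y2)"
    using y c x by (simp add: nat_pow_mult[symmetric] m_ac)
  then show ?case using generate.eng[OF y(1,3)] by blast
qed

text \<open>Modulo the prime \<open>p\<close> the exponent \<open>k\<close> is invertible: by Bezout
  \<open>k * j = p * q + 1\<close>, and the \<open>j\<close>-th power of \<open>x [^] k\<close> is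
  \<open>x\<close>.\<close>

lemma generate_power_dest:
  assumes x: "x \<in> carrier G" and S: "S \<subseteq> carrier G" and xp: "x [^] (p :: nat) = \<one>" and p: "prime p"
    and k: "\<not> p dvd k" and xk: "x [^] (k :: nat) \<in> generate G S"
  shows "x \<in> generate G S"
proof -
  have "gcd k p = 1" using prime_imp_coprime[OF p k] by (simp add: coprime_iff_gcd_eq_1 gcd.commute)
  moreover have "k \<noteq> 0" using k by (cases "k = 0") simp_all
  ultimately obtain j q where q: "k * j = p * q + 1"
    using bezout_nat[of k p] by auto
  have "x [^] (k * j) = x"
    unfolding q using x xp by (simp add: nat_pow_pow[symmetric] nat_pow_mult[symmetric])
  then have "(x [^] k) [^] j = x" using x by (simp add: nat_pow_pow)
  moreover have "(x [^] k) [^] j \<in> generate G S"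
    using generate_is_subgroup[OF S] xk by (induction j) (auto simp: subgroup.one_closed subgroup.m_closed)
  ultimately show ?thesis by simp
qed

text \<open>In a group of exponent \<open>p\<close> this is linear independence over the prime
  field, expressed without scalars.\<close>

definition independent_set where
  "independent_set B \<longleftrightarrow> B \<subseteq> carrier G \<and> (\<forall>b \<in> B. b \<notin> generate G (B - {b}))"

text \<open>An element of a generated subgroup involves finitely many generators, and these lie in
  one member of the chain.\<close>

lemma generate_chain:
  assumes b: "b \<in> generate G (\<Union>\<C> - {a})" and \<C>: "subset.chain A \<C>" "\<C> \<noteq> {}"
  shows "\<exists>B \<in> \<C>. b \<in> generate G (B - {a})"
  using b
proof (induction rule: generate.induct)
  case one
  then show ?case using \<C>(2) generate.one by blast
next
  case (incl h)
  then obtain B where "B \<in> \<C>" "h \<in> B - {a}" by blast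
  then show ?case using generate.incl by (intro bexI[of _ B])
next
  case (inv h)
  then obtain B where "B \<in> \<C>" "h \<in> B - {a}" by blast
  then show ?case using generate.inv by (intro bexI[of _ B])
next
  case (eng h1 h2)
  then obtain B1 B2 where B: "B1 \<in> \<C>" "h1 \<in> generate G (B1 - {a})" "B2 \<in> \<C>" "h2 \<in> generate G (B2 - {a})"
    by blast
  then have "B1 \<subseteq> B2 \<or> B2 \<subseteq> B1" using \<C>(1) by (auto simp: subset.chain_def)
  then obtain B where "B \<in> \<C>" "h1 \<in> generate G (B - {a})" "h2 \<in> generate G (B - {a})"
    using B mono_generate[of "B1 - {a}" "B2 - {a}"] mono_generate[of "B2 - {a}" "B1 - {a}"] by blast
  then show ?case using generate.eng by (intro bexI[of _ B])
qed

text \<open>Zorn's lemma gives a maximal independent set; an element outside its span could be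
  adjoined by the exchange argument.\<close>

lemma prime_exponent_basis:
  assumes p: "prime (p :: nat)" and exp: "\<And>x. x \<in> carrier G \<Longrightarrow> x [^] p = \<one>"
  obtains B where "independent_set B" "generate G B = carrier G"
proof -
  have "\<exists>M\<in>Collect independent_set. \<forall>X\<in>Collect independent_set. M \<subseteq> X \<longrightarrow> X = M"
  proof (rule subset_Zorn_nonempty)
    show "Collect independent_set \<noteq> {}" unfolding independent_set_def by blast
    fix \<C> assume ne: "\<C> \<noteq> {}" and ch: "subset.chain (Collect independent_set) \<C>"
    have ind: "independent_set B" if "B \<in> \<C>" for B using ch that by (auto simp: subset.chain_def)
    show "\<Union>\<C> \<in> Collect independent_set"
      unfolding mem_Collect_eq independent_set_def
    proof (intro conjI ballI notI)
      show "\<Union>\<C> \<subseteq> carrier G" using ind unfolding independent_set_def by blast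
      fix b assume b: "b \<in> \<Union>\<C>" "b \<in> generate G (\<Union>\<C> - {b})"
      obtain B1 where B1: "B1 \<in> \<C>" "b \<in> generate G (B1 - {b})" using generate_chain[OF b(2) ch ne] by blast
      obtain B2 where B2: "B2 \<in> \<C>" "b \<in> B2" using b(1) by blast
      have "B1 \<subseteq> B2 \<or> B2 \<subseteq> B1" using ch B1 B2 by (auto simp: subset.chain_def)
      then obtain B where "B \<in> \<C>" "b \<in> B" "b \<in> generate G (B - {b})"
        using B1 B2 mono_generate[of "B1 - {b}" "B2 - {b}"] by blast
      then show False using ind unfolding independent_set_def by blast
    qed
  qed
  then obtain B where B: "independent_set B" and max: "\<And>X. independent_set X \<Longrightarrow> B \<subseteq> X \<Longrightarrow> X = B" by blast
  have Bc: "B \<subseteq> carrier G" using B unfolding independent_set_def by blast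
  have p0: "0 < p" using prime_gt_0_nat[OF p] .
  have "x \<in> generate G B" if x: "x \<in> carrier G" for x
  proof (rule ccontr)
    assume nx: "x \<notin> generate G B"
    then have xB: "x \<notin> B" using generate.incl by metis
    have "independent_set (insert x B)"
      unfolding independent_set_def
    proof (intro conjI ballI notI)
      show "insert x B \<subseteq> carrier G" using x Bc by blast
      fix b assume b: "b \<in> insert x B" "b \<in> generate G (insert x B - {b})"
      show False
      proof (cases "b = x")
        case True
        then show ?thesis using b(2) nx xB by simp
      next
        case False
        then have bB: "b \<in> B" and eq: "insert x B - {b} = insert x (B - {b})" using b(1) by auto
        have S: "B - {b} \<subseteq> carrier G" using Bc by blast
        obtain k :: nat and y where y: "y \<in> generate G (B - {b})" "b = x [^] k \<otimes> y"
          using generate_insert_elem[OF x S exp[OF x] p0] b(2) eq by metis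
        have yc: "y \<in> carrier G" using generate_in_carrier[OF S y(1)] .
        show ?thesis
        \<comment> \<open>If the coefficient of \<open>x\<close> vanishes modulo \<open>p\<close>,
          then \<open>b\<close> depends on the rest of \<open>B\<close>; otherwise the relation can
          be solved for \<open>x\<close>.\<close>
        proof (cases "p dvd k")
          case True
          then obtain q where "k = p * q" by blast
          then have "x [^] k = \<one>" using exp[OF x] x by (simp add: nat_pow_pow[symmetric])
          then have "b = y" using y(2) yc by simp
          then show ?thesis using y(1) B bB unfolding independent_set_def by blast
        next
          case False
          have sg: "subgroup (generate G B) G" using generate_is_subgroup[OF Bc] .
          have yB: "y \<in> generate G B" using y(1) mono_generate[of "B - {b}" B] by blast
          have "x [^] k = b \<otimes> inv y" using y(2) yc x by (simp add: m_assoc)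
          then have "x [^] k \<in> generate G B"
            using subgroup.m_closed[OF sg generate.incl[OF bB] subgroup.m_inv_closed[OF sg yB]] by simp
          then show ?thesis using generate_power_dest[OF x Bc exp[OF x] p False] nx by blast
        qed
      qed
    qed
    then show False using max[of "insert x B"] xB by blast
  qed
  then have "generate G B = carrier G" using generate_in_carrier[OF Bc] by blast
  then show ?thesis using that B by blast
qed

end

section \<open>Minimality of the mod p Eilenberg-Mac Lane spectrum\<close>

text \<open>The homotopy of \<open>H\<close> is recast through a generator \<open>u\<close> of its
  degree 0 part; this group is finite cyclic, so natural multiples of \<open>u\<close> exhaust
  it.\<close>

locale eilenberg_maclane = connective_stable_category C
  for C :: "('o, 'm, 'i) stable_data" (structure) +
  fixes p :: nat and H :: 'o and u :: 'm
  assumes p: "prime p"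
    and u: "u \<in> homset C (Sph C) H"
    and u_generates: "f \<in> homset C (Sph C) H \<Longrightarrow> \<exists>k. f = multiple C k u"
    and u_torsion: "multiple C p u = Zer C (Sph C) H"
    and H_orth: "n \<noteq> 0 \<Longrightarrow> orth (sphere n) H"
begin

lemma H_Ob: "H \<in> Ob C"
  using u hom_Ob by blast

section \<open>Smashing with spheres\<close>

lemma smash_sphere_isomorphic: "isomorphic (sphere n \<odot> sphere i) (sphere (n + i))"
proof (induction n rule: int_induct[where k = 0])
  case base
  then show ?case using smash_sph_isomorphic[of "sphere i"] by simp
next
  case (step1 n)
  have "isomorphic (sphere (n + 1) \<odot> sphere i) (Sus C (sphere n) \<odot> sphere i)"
    using smash_isomorphic[OF isomorphic_sym[OF sphere_sus] isomorphic_refl] by simp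
  moreover have "isomorphic (Sus C (sphere n) \<odot> sphere i) (Sus C (sphere n \<odot> sphere i))"
    using smash_sus_isomorphic by simp
  moreover have "isomorphic (Sus C (sphere n \<odot> sphere i)) (Sus C (sphere (n + i)))"
    using sus_isomorphic step1 by simp
  moreover have "isomorphic (Sus C (sphere (n + i))) (sphere (n + 1 + i))"
    using sphere_sus[of "n + i"] by (simp add: add.commute add.left_commute)
  ultimately show ?case using isomorphic_trans by blast
next
  case (step2 n)
  have "isomorphic (Sus C (sphere (n - 1) \<odot> sphere i)) (Sus C (sphere (n - 1)) \<odot> sphere i)"
    using isomorphic_sym[OF smash_sus_isomorphic] by simp
  moreover have "isomorphic (Sus C (sphere (n - 1)) \<odot> sphere i) (sphere n \<odot> sphere i)"
    using smash_isomorphic[OF sphere_sus[of "n - 1"] isomorphic_refl] by simp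
  moreover have "isomorphic (sphere n \<odot> sphere i) (sphere (n + i))" using step2 by simp
  moreover have "isomorphic (sphere (n + i)) (Sus C (sphere (n - 1 + i)))"
    using isomorphic_sym[OF sphere_sus[of "n - 1 + i"]] by simp
  ultimately have "isomorphic (Sus C (sphere (n - 1) \<odot> sphere i)) (Sus C (sphere (n - 1 + i)))"
    using isomorphic_trans by blast
  then show ?case using sus_reflects_iso smash_ob by simp
qed

lemma sphere_orth_smash: "X \<in> Ob C \<Longrightarrow> orth (sphere n) (X \<odot> sphere m) \<longleftrightarrow> orth (sphere (n - m)) X"
proof (induction m arbitrary: n rule: int_induct[where k = 0])
  case base
  have "isomorphic (X \<odot> Sph C) X" using run_iso[OF base] isomorphic_def by blast
  then show ?case
    using orth_iso[OF _ isomorphic_refl[OF sphere_Ob], of n "X \<odot> Sph C" X]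
      orth_iso[OF _ isomorphic_refl[OF sphere_Ob], of n X "X \<odot> Sph C"] isomorphic_sym by auto
next
  case (step1 m)
  have "isomorphic (X \<odot> sphere (m + 1)) (Sus C (X \<odot> sphere m))"
    using isomorphic_trans[OF smash_isomorphic[OF isomorphic_refl isomorphic_sym[OF sphere_sus]] smash_sus_right_isomorphic]
      step1 by simp
  then have "orth (sphere n) (X \<odot> sphere (m + 1)) \<longleftrightarrow> orth (sphere n) (Sus C (X \<odot> sphere m))"
    using orth_iso[OF _ isomorphic_refl[OF sphere_Ob]] isomorphic_sym by blast
  also have "\<dots> \<longleftrightarrow> orth (sphere (n - 1)) (X \<odot> sphere m)"
    using sphere_orth_sus[of "X \<odot> sphere m" "n - 1"] smash_ob step1 by simp
  finally show ?case using step1 by (simp add: algebra_simps)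
next
  case (step2 m)
  have "isomorphic (Sus C (X \<odot> sphere (m - 1))) (X \<odot> sphere m)"
    using isomorphic_trans[OF isomorphic_sym[OF smash_sus_right_isomorphic] smash_isomorphic[OF isomorphic_refl sphere_sus[of "m - 1"]]]
      step2 by simp
  then have "orth (sphere (n + 1)) (X \<odot> sphere m) \<longleftrightarrow> orth (sphere (n + 1)) (Sus C (X \<odot> sphere (m - 1)))"
    using orth_iso[OF _ isomorphic_refl[OF sphere_Ob]] isomorphic_sym by blast
  also have "\<dots> \<longleftrightarrow> orth (sphere n) (X \<odot> sphere (m - 1))"
    using sphere_orth_sus[of "X \<odot> sphere (m - 1)" n] smash_ob step2 by simp
  finally show ?case using step2 by (simp add: algebra_simps)
qed

text \<open>The unit of \<open>H\<close> splits after smashing with \<open>H\<close>: the connecting arrow of the cofibre \<open>Hb\<close> of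
  \<open>u\<close> becomes zero, because it vanishes on \<open>Sph \<odot> Hb\<close> and there is no arrow \<open>Hb \<odot> Hb \<rightarrow> Sus H\<close>,
  for dimensional reasons.\<close>

lemma unit_splits:
  obtains m where "m \<in> hom (H \<odot> H) (Sph C \<odot> H)" "m \<cdot> (u \<star> Id C H) = Id C (Sph C \<odot> H)"
proof -
  let ?S = "Sph C"
  obtain v w Hb where tri: "(u, v, w) \<in> Tri C" and v: "v \<in> hom H Hb" and w: "w \<in> hom Hb (Sus C ?S)"
    and Hb: "Hb \<in> Ob C" by (rule cofibre[OF u])
  note S = sph_ob and SS = sus_ob[OF sph_ob] and SH = sus_ob[OF H_Ob]
  note vu = tri_zero1[OF tri u v w] and uw = tri_zero3[OF tri u v w]
  \<comment> \<open>Since \<open>Sus C ?S\<close> has no homotopy in degree at most 0, a class of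
    \<open>Hb\<close> lifts to \<open>H\<close>. There only degree 0 matters, and its classes are
    multiples of \<open>u\<close>, killed by \<open>v\<close>.\<close>
  have conn: "orth (sphere n) Hb" if n: "n \<le> 0" for n
    unfolding orth_def
  proof
    fix y assume y: "y \<in> hom (sphere n) Hb"
    have "orth (sphere n) (Sus C ?S)" using sphere_orth_sphere[of n 1] n by (simp add: sphere_def)
    from orthD[OF this comp_hom[OF y w]] obtain x where x: "x \<in> hom (sphere n) H" "v \<cdot> x = y"
      by (rule tri_exact_left2[OF tri u v w y])
    show "y = zero (sphere n) Hb"
    proof (cases "n = 0")
      case True
      then obtain k where "x = multiple C k u" using u_generates x by auto
      then show ?thesis using x(2) multiple_comp_right[OF u v] vu multiple_zero[OF S Hb] True by simp
    next
      case False
      then show ?thesis using orthD[OF H_orth x(1)] x(2) comp_zero_right[OF v sphere_Ob] by simp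
    qed
  qed
  \<comment> \<open>Replacing the first \<open>Hb\<close> by a sphere of dimension
    \<open>n \<ge> 1\<close> leaves a sphere of dimension \<open>n + i \<ge> 2\<close>, while the
    homotopy of \<open>Sus C H\<close> is in degree 1. The case of two factors \<open>Hb\<close>
    follows by the same extension principle.\<close>
  have 1: "orth (sphere i \<odot> Hb) (Sus C H)" if i: "1 \<le> i" for i
  proof -
    have "orth (Hb \<odot> sphere i) (Sus C H)"
    proof (rule connective_smash_orth[OF Hb conn])
      show "orth (sphere n \<odot> sphere i) (Sus C H)" if n: "1 \<le> n" for n
        using orth_iso[OF _ isomorphic_sym[OF smash_sphere_isomorphic] isomorphic_refl[OF SH], of n i]
          sphere_orth_sus[OF H_Ob, of "n + i - 1"] H_orth[of "n + i - 1"] n i by simp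
    qed simp_all
    then show ?thesis using orth_iso[OF _ smash_sym_isomorphic isomorphic_refl[OF SH]] Hb by simp
  qed
  have 2: "orth (Hb \<odot> Hb) (Sus C H)" using connective_smash_orth[OF Hb conn Hb 1] .
  have e1: "iso_in C (SusM C (Lun C H) \<cdot> Sex C ?S H) (Sus C ?S \<odot> H) (Sus C H)"
    by (rule iso_comp[OF sex_iso[OF S H_Ob] sus_iso[OF lun_iso[OF H_Ob]]])
  then have "isomorphic (Sus C H) (Sus C ?S \<odot> H)" using isomorphic_def isomorphic_sym by blast
  then have 3: "orth (Hb \<odot> Hb) (Sus C ?S \<odot> H)"
    using orth_iso[OF 2 isomorphic_refl] smash_ob Hb by simp
  define \<phi> where "\<phi> = (w \<star> Id C H) \<cdot> Sym C H Hb"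
  note IH = id_hom[OF H_Ob] and IHb = id_hom[OF Hb] and IS = id_hom[OF S] and ISS = id_hom[OF SS]
  note sy = iso_hom[OF sym_iso[OF H_Ob Hb]] and sy' = iso_hom[OF sym_iso[OF S Hb]]
  note wH = smash_hom[OF w IH] and wS = smash_hom[OF w IS]
  have \<phi>: "\<phi> \<in> hom (H \<odot> Hb) (Sus C ?S \<odot> H)" unfolding \<phi>_def using comp_hom[OF sy wH] .
  \<comment> \<open>Under the unit isomorphisms this composite becomes
    \<open>SusM C u \<cdot> w\<close>, which vanishes in the triangle, up to an endomorphism of the
    unit.\<close>
  have key: "(Id C (Sus C ?S) \<star> u) \<cdot> (w \<star> Id C ?S) = zero (Hb \<odot> ?S) (Sus C ?S \<odot> H)"
  proof -
    define \<kappa> where "\<kappa> = SusM C (Lun C ?S) \<cdot> Sex C ?S ?S"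
    note lS = iso_hom[OF lun_iso[OF S]] and lH = iso_hom[OF lun_iso[OF H_Ob]]
    note xS = iso_hom[OF sex_iso[OF S S]] and xH = iso_hom[OF sex_iso[OF S H_Ob]]
    have \<kappa>: "\<kappa> \<in> hom (Sus C ?S \<odot> ?S) (Sus C ?S)"
      unfolding \<kappa>_def using comp_hom[OF xS sus_hom[OF lS]] .
    obtain r where r: "run C (Sus C ?S) \<in> hom (Sus C ?S \<odot> ?S) (Sus C ?S)" "r \<in> hom (Sus C ?S) (Sus C ?S \<odot> ?S)"
        "r \<cdot> run C (Sus C ?S) = Id C (Sus C ?S \<odot> ?S)"
      by (rule iso_inE[OF run_iso[OF SS]])
    \<comment> \<open>The arrows \<open>\<kappa>\<close> and \<open>run\<close> are two
      identifications of \<open>Sus C ?S \<odot> ?S\<close> with \<open>Sus C ?S\<close>, so they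
      differ by the suspension of some \<open>c\<close>. As \<open>u \<cdot> c\<close> is a multiple
      of \<open>u\<close>, the vanishing survives without determining \<open>c\<close>.\<close>
    obtain c where c: "c \<in> hom ?S ?S" "SusM C c = \<kappa> \<cdot> r" by (rule sus_full[OF comp_hom[OF r(2) \<kappa>] S S])
    obtain k where k: "u \<cdot> c = multiple C k u" using u_generates comp_hom[OF c(1) u] by blast
    note rH = iso_hom[OF run_iso[OF Hb]]
    have kw: "\<kappa> \<cdot> (w \<star> Id C ?S) = SusM C c \<cdot> (w \<cdot> run C Hb)"
    proof -
      have "\<kappa> \<cdot> (w \<star> Id C ?S) = \<kappa> \<cdot> ((r \<cdot> run C (Sus C ?S)) \<cdot> (w \<star> Id C ?S))"
        using r(3) comp_id[OF wS] by simp
      also have "\<dots> = (\<kappa> \<cdot> r) \<cdot> (run C (Sus C ?S) \<cdot> (w \<star> Id C ?S))"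
        using comp_assoc[OF wS r(1,2)] comp_assoc[OF comp_hom[OF wS r(1)] r(2) \<kappa>] by simp
      finally show ?thesis using run_nat[OF w] c by simp
    qed
    have "(SusM C (Lun C H) \<cdot> Sex C ?S H) \<cdot> ((Id C (Sus C ?S) \<star> u) \<cdot> (w \<star> Id C ?S))
       = (SusM C (Lun C H) \<cdot> (Sex C ?S H \<cdot> (SusM C (Id C ?S) \<star> u))) \<cdot> (w \<star> Id C ?S)"
      using xH sus_hom[OF lH] smash_hom[OF ISS u] wS sus_id[OF S] by (simp add: arrow_simps)
    also have "\<dots> = (SusM C (Lun C H \<cdot> (Id C ?S \<star> u)) \<cdot> Sex C ?S ?S) \<cdot> (w \<star> Id C ?S)"
      using sex_nat[OF IS u] sus_comp[OF smash_hom[OF IS u] lH] xS sus_hom[OF lH] sus_hom[OF smash_hom[OF IS u]] wS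
      by (simp add: arrow_simps)
    also have "\<dots> = SusM C u \<cdot> (\<kappa> \<cdot> (w \<star> Id C ?S))"
      using lun_nat[OF u] sus_comp[OF lS u] xS sus_hom[OF lS] sus_hom[OF u] wS
      by (simp add: \<kappa>_def arrow_simps)
    also have "\<dots> = (SusM C (u \<cdot> c) \<cdot> w) \<cdot> run C Hb"
      using kw sus_comp[OF c(1) u] sus_hom[OF c(1)] sus_hom[OF u] w rH by (simp add: arrow_simps)
    also have "SusM C (u \<cdot> c) \<cdot> w = zero Hb (Sus C H)"
      using k sus_multiple[OF u] multiple_comp_left[OF w sus_hom[OF u]] uw multiple_zero[OF Hb SH] by simp
    also have "zero Hb (Sus C H) \<cdot> run C Hb = zero (Hb \<odot> ?S) (Sus C H)" using comp_zero_left[OF rH SH] .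
    finally show ?thesis
      using iso_zero_left[OF e1 comp_hom[OF wS smash_hom[OF ISS u]]] by blast
  qed
  note tHb = smash_tri[OF tri u v w Hb] and tH = smash_tri[OF tri u v w H_Ob]
  have "\<phi> \<cdot> (u \<star> Id C Hb) = (w \<star> Id C H) \<cdot> ((Id C Hb \<star> u) \<cdot> Sym C ?S Hb)"
    unfolding \<phi>_def using comp_assoc[OF tHb(2) sy wH] sym_nat[OF u IHb] by simp
  also have "\<dots> = (w \<star> u) \<cdot> Sym C ?S Hb"
    using comp_assoc[OF sy' smash_hom[OF IHb u] wH] smash_split(1)[OF w u] by simp
  also have "\<dots> = zero (?S \<odot> Hb) (Sus C ?S \<odot> H)"
    unfolding smash_split(2)[OF w u, symmetric] key using comp_zero_left[OF sy'] smash_ob SS H_Ob by simp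
  \<comment> \<open>Vanishing on \<open>?S \<odot> Hb\<close> means factoring through the cofibre
    \<open>Hb \<odot> Hb\<close>, from which there is no nonzero arrow to this target.\<close>
  finally obtain \<psi> where \<psi>: "\<psi> \<in> hom (Hb \<odot> Hb) (Sus C ?S \<odot> H)" "\<psi> \<cdot> (v \<star> Id C Hb) = \<phi>"
    by (rule tri_exact_right1[OF tHb \<phi>])
  have "\<phi> = zero (H \<odot> Hb) (Sus C ?S \<odot> H)"
    using orthD[OF 3 \<psi>(1)] \<psi>(2) comp_zero_left[OF tHb(3)] smash_ob SS H_Ob by simp
  then have "w \<star> Id C H = zero (Hb \<odot> H) (Sus C ?S \<odot> H)"
    using iso_zero_right[OF sym_iso[OF H_Ob Hb] wH] unfolding \<phi>_def by blast
  then have z: "Sex C ?S H \<cdot> (w \<star> Id C H) = zero (Hb \<odot> H) (Sus C (?S \<odot> H))"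
    using comp_zero_right[OF iso_hom[OF sex_iso[OF S H_Ob]]] smash_ob Hb H_Ob by simp
  have SoH: "?S \<odot> H \<in> Ob C" using smash_ob S H_Ob by blast
  \<comment> \<open>With the connecting arrow zero, the obstruction to extending the identity of
    \<open>?S \<odot> H\<close> over \<open>H \<odot> H\<close> is gone; the extension is the
    multiplication.\<close>
  have "SusM C (Id C (?S \<odot> H)) \<cdot> (Sex C ?S H \<cdot> (w \<star> Id C H)) = zero (Hb \<odot> H) (Sus C (?S \<odot> H))"
    using z comp_zero_right[OF sus_hom[OF id_hom[OF SoH]]] smash_ob Hb H_Ob by simp
  then show ?thesis using tri_exact_right0[OF tH id_hom[OF SoH]] that by blast
qed

text \<open>The retraction of the unit is smashed with \<open>E\<close>. Because of the unit and
  associativity isomorphisms, its composite with the insertion is at first only an automorphism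
  \<open>\<theta>\<close>; composing with the inverse of \<open>\<theta>\<close> corrects
  this.\<close>

lemma action:
  assumes E: "E \<in> Ob C"
  obtains \<rho> where "\<rho> \<in> hom (H \<odot> (H \<odot> E)) (H \<odot> E)" "\<rho> \<cdot> insertion u (H \<odot> E) = Id C (H \<odot> E)"
proof -
  let ?W = "H \<odot> E" and ?S = "Sph C"
  note S = sph_ob
  have W: "?W \<in> Ob C" and SH: "?S \<odot> H \<in> Ob C" and HH: "H \<odot> H \<in> Ob C" using smash_ob H_Ob E S by auto
  obtain m where m: "m \<in> hom (H \<odot> H) (?S \<odot> H)" "m \<cdot> (u \<star> Id C H) = Id C (?S \<odot> H)" by (rule unit_splits)
  note IE = id_hom[OF E] and IH = id_hom[OF H_Ob]
  obtain a where a: "Asc C H H E \<in> hom ((H \<odot> H) \<odot> E) (H \<odot> ?W)" "a \<in> hom (H \<odot> ?W) ((H \<odot> H) \<odot> E)"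
     "a \<cdot> Asc C H H E = Id C ((H \<odot> H) \<odot> E)" by (rule iso_inE[OF asc_iso[OF H_Ob H_Ob E]])
  obtain b where b: "Asc C ?S H E \<in> hom ((?S \<odot> H) \<odot> E) (?S \<odot> ?W)" "b \<in> hom (?S \<odot> ?W) ((?S \<odot> H) \<odot> E)"
     "Asc C ?S H E \<cdot> b = Id C (?S \<odot> ?W)" "iso_in C b (?S \<odot> ?W) ((?S \<odot> H) \<odot> E)"
    by (rule iso_inE[OF asc_iso[OF S H_Ob E]])
  note l = iso_hom[OF lun_iso[OF H_Ob]] and lW = iso_hom[OF lun_iso[OF W]]
  define \<rho>0 where "\<rho>0 = (Lun C H \<star> Id C E) \<cdot> ((m \<star> Id C E) \<cdot> a)"
  note lE = smash_hom[OF l IE] and mE = smash_hom[OF m(1) IE]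
  have \<rho>0: "\<rho>0 \<in> hom (H \<odot> ?W) ?W" unfolding \<rho>0_def using comp_hom[OF comp_hom[OF a(2) mE] lE] .
  note uW = smash_hom[OF u id_hom[OF W]] and uH = smash_hom[OF u IH]
  note uHE = smash_hom[OF uH IE]
  have "a \<cdot> (u \<star> Id C ?W) = a \<cdot> ((u \<star> Id C ?W) \<cdot> (Asc C ?S H E \<cdot> b))" using b(3) comp_id[OF uW] by simp
  also have "\<dots> = a \<cdot> (((u \<star> (Id C H \<star> Id C E)) \<cdot> Asc C ?S H E) \<cdot> b)"
    using comp_assoc[OF b(2,1) uW] smash_id[OF H_Ob E] by simp
  also have "\<dots> = a \<cdot> ((Asc C H H E \<cdot> ((u \<star> Id C H) \<star> Id C E)) \<cdot> b)"
    using asc_nat[OF u IH IE] by simp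
  also have "\<dots> = ((a \<cdot> Asc C H H E) \<cdot> ((u \<star> Id C H) \<star> Id C E)) \<cdot> b"
    using a(1,2) b(1,2) uHE by (simp add: arrow_simps)
  also have "\<dots> = ((u \<star> Id C H) \<star> Id C E) \<cdot> b" using a(3) comp_id[OF uHE] by simp
  finally have au: "a \<cdot> (u \<star> Id C ?W) = ((u \<star> Id C H) \<star> Id C E) \<cdot> b" .
  have "(m \<star> Id C E) \<cdot> ((u \<star> Id C H) \<star> Id C E) = Id C ((?S \<odot> H) \<odot> E)"
    using smash_comp_left[OF uH m(1) E] m(2) smash_id[OF SH E] by simp
  then have "(m \<star> Id C E) \<cdot> (a \<cdot> (u \<star> Id C ?W)) = b"
    unfolding au using comp_assoc[OF b(2) uHE mE] comp_id[OF b(2)] by simp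
  then have \<rho>u: "\<rho>0 \<cdot> (u \<star> Id C ?W) = (Lun C H \<star> Id C E) \<cdot> b"
    unfolding \<rho>0_def using comp_assoc[OF uW comp_hom[OF a(2) mE] lE] comp_assoc[OF uW a(2) mE] by simp
  note i = insertion[OF u W]
  define \<theta> where "\<theta> = \<rho>0 \<cdot> insertion u ?W"
  have \<theta>: "\<theta> \<in> hom ?W ?W" unfolding \<theta>_def using comp_hom[OF i(1) \<rho>0] .
  have \<theta>l: "\<theta> \<cdot> Lun C ?W = (Lun C H \<star> Id C E) \<cdot> b"
    unfolding \<theta>_def using comp_assoc[OF lW i(1) \<rho>0] i(2) \<rho>u by simp
  obtain l' where l': "l' \<in> hom ?W (?S \<odot> ?W)" "Lun C ?W \<cdot> l' = Id C ?W" "iso_in C l' ?W (?S \<odot> ?W)"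
    by (rule iso_inE[OF lun_iso[OF W]])
  have "\<theta> = ((Lun C H \<star> Id C E) \<cdot> b) \<cdot> l'"
    using \<theta>l comp_assoc[OF l'(1) lW \<theta>] l'(2) comp_id[OF \<theta>] by simp
  then have "iso_in C \<theta> ?W ?W"
    using iso_comp[OF l'(3) iso_comp[OF b(4) smash_iso[OF lun_iso[OF H_Ob] iso_id[OF E]]]] by simp
  then obtain \<theta>' where \<theta>': "\<theta>' \<in> hom ?W ?W" "\<theta>' \<cdot> \<theta> = Id C ?W" by (rule iso_inE)
  show ?thesis
  proof (rule that)
    show "\<theta>' \<cdot> \<rho>0 \<in> hom (H \<odot> ?W) ?W" using comp_hom[OF \<rho>0 \<theta>'(1)] .
    show "\<theta>' \<cdot> \<rho>0 \<cdot> insertion u ?W = Id C ?W"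
      using comp_assoc[OF i(1) \<rho>0 \<theta>'(1)] \<theta>'(2) unfolding \<theta>_def by simp
  qed
qed

text \<open>For a sphere \<open>P\<close> of dimension \<open>n\<close> it concerns the homotopy of
  \<open>H \<odot> P\<close> in degree \<open>n\<close>. The general form of \<open>P\<close> makes
  it accessible to induction along suspension.\<close>

definition generated_by_insertion where
  "generated_by_insertion P \<longleftrightarrow> P \<in> Ob C \<and> (\<forall>f \<in> hom P (H \<odot> P). \<exists>k. f = multiple C k (insertion u P))"

lemma insertion_sus_iff:
  assumes P: "P \<in> Ob C"
  shows "generated_by_insertion P \<longleftrightarrow> generated_by_insertion (Sus C P)"
proof -
  have SP: "Sus C P \<in> Ob C" and HP: "H \<odot> P \<in> Ob C" using P sus_ob smash_ob H_Ob by auto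
  obtain c where c0: "iso_in C c (Sus C P) (Sus C P)"
    and ci: "sex_right C H P \<cdot> insertion u (Sus C P) = SusM C (insertion u P) \<cdot> c"
    by (rule sus_insertion[OF u P])
  obtain c' where c: "c \<in> hom (Sus C P) (Sus C P)" "c' \<in> hom (Sus C P) (Sus C P)" "c' \<cdot> c = Id C (Sus C P)"
    "c \<cdot> c' = Id C (Sus C P)" by (rule iso_inE[OF c0])
  note t0 = sex_right_iso[OF H_Ob P]
  obtain t' where t: "sex_right C H P \<in> hom (H \<odot> Sus C P) (Sus C (H \<odot> P))" "t' \<in> hom (Sus C (H \<odot> P)) (H \<odot> Sus C P)"
    "sex_right C H P \<cdot> t' = Id C (Sus C (H \<odot> P))" by (rule iso_inE[OF t0])
  note i = insertion(1)[OF u P] and i' = insertion(1)[OF u SP]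
  have ck: "sex_right C H P \<cdot> multiple C k (insertion u (Sus C P)) = SusM C (multiple C k (insertion u P)) \<cdot> c" for k
    using multiple_comp_right[OF i' t(1)] ci sus_multiple[OF i] multiple_comp_left[OF c(1) sus_hom[OF i]] by simp
  show ?thesis
  proof
    assume g: "generated_by_insertion P"
    have "\<exists>k. f = multiple C k (insertion u (Sus C P))" if f: "f \<in> hom (Sus C P) (H \<odot> Sus C P)" for f
    proof -
      note tf = comp_hom[OF f t(1)]
      obtain g' where g': "g' \<in> hom P (H \<odot> P)" "SusM C g' = (sex_right C H P \<cdot> f) \<cdot> c'"
        by (rule sus_full[OF comp_hom[OF c(2) tf] P HP])
      obtain k where "g' = multiple C k (insertion u P)" using g g'(1) unfolding generated_by_insertion_def by blast
      then have "sex_right C H P \<cdot> f = sex_right C H P \<cdot> multiple C k (insertion u (Sus C P))"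
        using ck[of k] g'(2) comp_assoc[OF c(1,2) tf] c(3) comp_id[OF tf] by simp
      then show ?thesis using iso_cancel_left[OF t0 f multiple_hom[OF i']] by blast
    qed
    then show "generated_by_insertion (Sus C P)" using SP unfolding generated_by_insertion_def by blast
  next
    assume g: "generated_by_insertion (Sus C P)"
    have "\<exists>k. f = multiple C k (insertion u P)" if f: "f \<in> hom P (H \<odot> P)" for f
    proof -
      note Sf = sus_hom[OF f]
      note Sfc = comp_hom[OF c(1) Sf]
      obtain k where k: "t' \<cdot> (SusM C f \<cdot> c) = multiple C k (insertion u (Sus C P))"
        using g comp_hom[OF Sfc t(2)] unfolding generated_by_insertion_def by blast
      have "SusM C f \<cdot> c = sex_right C H P \<cdot> (t' \<cdot> (SusM C f \<cdot> c))"
        using comp_assoc[OF Sfc t(2,1)] t(3) comp_id[OF Sfc] by simp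
      also have "\<dots> = SusM C (multiple C k (insertion u P)) \<cdot> c" unfolding k using ck .
      finally have "SusM C f = SusM C (multiple C k (insertion u P))"
        using iso_cancel_right[OF c0 Sf sus_hom[OF multiple_hom[OF i]]] by blast
      then show ?thesis using sus_inject[OF f multiple_hom[OF i]] by blast
    qed
    then show "generated_by_insertion P" using P unfolding generated_by_insertion_def by blast
  qed
qed

lemma insertion_iso:
  assumes "isomorphic P P'" "generated_by_insertion P" shows "generated_by_insertion P'"
proof -
  obtain e where e0: "iso_in C e P P'" using assms isomorphic_def by blast
  obtain e' where e: "e \<in> hom P P'" "e' \<in> hom P' P" "e \<cdot> e' = Id C P'" "P \<in> Ob C" "P' \<in> Ob C" by (rule iso_inE[OF e0])
  note IH = id_hom[OF H_Ob]
  note i = insertion(1)[OF u e(4)] and i' = insertion(1)[OF u e(5)]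
  note he = smash_hom[OF IH e(1)] and he' = smash_hom[OF IH e(2)]
  have "\<exists>k. f = multiple C k (insertion u P')" if f: "f \<in> hom P' (H \<odot> P')" for f
  proof -
    define g where "g = (Id C H \<star> e') \<cdot> (f \<cdot> e)"
    note fe = comp_hom[OF e(1) f]
    have g: "g \<in> hom P (H \<odot> P)" unfolding g_def using comp_hom[OF fe he'] .
    then obtain k where k: "g = multiple C k (insertion u P)" using assms unfolding generated_by_insertion_def by blast
    have "f \<cdot> e = (Id C H \<star> e) \<cdot> g"
      unfolding g_def using comp_assoc[OF fe he' he] smash_comp_right[OF e(2,1) H_Ob] e(3) smash_id[OF H_Ob e(5)] comp_id[OF fe] by simp
    also have "\<dots> = multiple C k (insertion u P') \<cdot> e"
      using k multiple_comp_right[OF i he] insertion_nat[OF u e(1)] multiple_comp_left[OF e(1) i'] by simp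
    finally show ?thesis using iso_cancel_right[OF e0 f multiple_hom[OF i']] by blast
  qed
  then show ?thesis using e(5) unfolding generated_by_insertion_def by blast
qed

text \<open>The right unit isomorphism turns arrows into \<open>H \<odot> ?S\<close> into arrows
  into \<open>H\<close>, and the insertion into \<open>u\<close> up to an automorphism
  \<open>c\<close> of the unit.\<close>

lemma insertion_Sph: "generated_by_insertion (Sph C)"
proof -
  let ?S = "Sph C"
  note S = sph_ob
  note i = insertion[OF u S] and l = iso_hom[OF lun_iso[OF S]]
  note r = iso_hom[OF run_iso[OF H_Ob]] and rS = iso_hom[OF run_iso[OF S]]
  obtain l' where l': "l' \<in> hom ?S (?S \<odot> ?S)" "Lun C ?S \<cdot> l' = Id C ?S" "iso_in C l' ?S (?S \<odot> ?S)"
    by (rule iso_inE[OF lun_iso[OF S]])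
  define c where "c = run C ?S \<cdot> l'"
  have c0: "iso_in C c ?S ?S" unfolding c_def by (rule iso_comp[OF l'(3) run_iso[OF S]])
  obtain c' where c: "c \<in> hom ?S ?S" "c' \<in> hom ?S ?S" "c' \<cdot> c = Id C ?S" by (rule iso_inE[OF c0])
  note I = id_hom[OF S]
  have "run C H \<cdot> insertion u ?S = run C H \<cdot> (insertion u ?S \<cdot> (Lun C ?S \<cdot> l'))"
    using l'(2) comp_id[OF i(1)] by simp
  also have "\<dots> = (run C H \<cdot> (u \<star> Id C ?S)) \<cdot> l'"
    using comp_assoc[OF l'(1) l i(1)] i(2) comp_assoc[OF l'(1) smash_hom[OF u I] r] by simp
  also have "\<dots> = u \<cdot> c" unfolding c_def run_nat[OF u] using comp_assoc[OF l'(1) rS u] by simp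
  finally have ri: "run C H \<cdot> insertion u ?S = u \<cdot> c" .
  have "\<exists>k. f = multiple C k (insertion u ?S)" if f: "f \<in> hom ?S (H \<odot> ?S)" for f
  proof -
    note rf = comp_hom[OF f r]
    obtain k where k: "(run C H \<cdot> f) \<cdot> c' = multiple C k u" using u_generates comp_hom[OF c(2) rf] by blast
    have "run C H \<cdot> f = ((run C H \<cdot> f) \<cdot> c') \<cdot> c" using comp_assoc[OF c(1,2) rf] c(3) comp_id[OF rf] by simp
    also have "\<dots> = run C H \<cdot> multiple C k (insertion u ?S)"
      unfolding k using multiple_comp_left[OF c(1) u] multiple_comp_right[OF i(1) r] ri by simp
    finally show ?thesis using iso_cancel_left[OF run_iso[OF H_Ob] f multiple_hom[OF i(1)]] by blast
  qed
  then show ?thesis using S unfolding generated_by_insertion_def by blast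
qed

lemma insertion_sphere:
  assumes "f \<in> hom (sphere n) (H \<odot> sphere n)" shows "\<exists>k. f = multiple C k (insertion u (sphere n))"
  using sphere_induct[of generated_by_insertion n] insertion_Sph insertion_iso insertion_sus_iff assms
  unfolding generated_by_insertion_def by blast

context
  fixes E \<rho>
  assumes E: "E \<in> Ob C" and \<rho>: "\<rho> \<in> homset C (H \<odot> (H \<odot> E)) (H \<odot> E)"
    and \<rho>_unit: "\<rho> \<cdot> insertion u (H \<odot> E) = Id C (H \<odot> E)"
begin

lemma HE: "H \<odot> E \<in> Ob C"
  using smash_ob E H_Ob by blast

text \<open>The extension of a class to an arrow from a free object \<open>H \<odot> P\<close>;
  restricting it along the insertion uses just that \<open>\<rho>\<close> is unital.\<close>

definition extend where "extend x = \<rho> \<cdot> (Id C H \<star> x)"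

lemma extend:
  assumes x: "x \<in> hom P (H \<odot> E)"
  shows "extend x \<in> hom (H \<odot> P) (H \<odot> E)" "extend x \<cdot> insertion u P = x"
proof -
  have P: "P \<in> Ob C" using x hom_Ob by blast
  note hx = smash_hom[OF id_hom[OF H_Ob] x]
  note i = insertion(1)[OF u P] and i' = insertion(1)[OF u HE]
  show "extend x \<in> hom (H \<odot> P) (H \<odot> E)" unfolding extend_def using comp_hom[OF hx \<rho>] .
  show "extend x \<cdot> insertion u P = x"
    unfolding extend_def
    using comp_assoc[OF i hx \<rho>] insertion_nat[OF u x] comp_assoc[OF x i' \<rho>] \<rho>_unit comp_id[OF x] by simp
qed

text \<open>Every \<open>x\<close> factors through an insertion of \<open>u\<close>, and these are
  annihilated by \<open>p\<close>.\<close>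

lemma exponent_p:
  assumes x: "x \<in> hom P (H \<odot> E)"
  shows "multiple C p x = zero P (H \<odot> E)"
proof -
  have P: "P \<in> Ob C" using x hom_Ob by blast
  show ?thesis
    using multiple_comp_right[OF insertion(1)[OF u P] extend(1)[OF x], of p] extend(2)[OF x]
      multiple_insertion[OF u P u_torsion] comp_zero_right[OF extend(1)[OF x] P] by simp
qed

lemma sphere_basis:
  obtains B where "B \<subseteq> hom (sphere n) (H \<odot> E)"
    "\<And>b. b \<in> B \<Longrightarrow> b \<notin> generate (hom_group C (sphere n) (H \<odot> E)) (B - {b})"
    "generate (hom_group C (sphere n) (H \<odot> E)) B = hom (sphere n) (H \<odot> E)"
proof -
  interpret G: comm_group "hom_group C (sphere n) (H \<odot> E)" using hom_group[OF sphere_Ob HE] .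
  obtain B where "G.independent_set B" "generate (hom_group C (sphere n) (H \<odot> E)) B = carrier (hom_group C (sphere n) (H \<odot> E))"
    by (rule G.prime_exponent_basis[OF p]) (use exponent_p multiple_eq in auto)
  then show ?thesis using that unfolding G.independent_set_def by auto
qed

end

text \<open>A basis is chosen in every homotopy group, with one summand
  \<open>H \<odot> sphere n\<close> for each basis element of degree \<open>n\<close>;
  \<open>\<Phi>\<close> extends the basis elements. It hits all generators, and compactness reduces
  injectivity to finite linear combinations of them.\<close>

lemma free_resolution:
  assumes E: "E \<in> Ob C"
  obtains I D Q j \<Phi> where "Small C I" "\<And>i. i \<in> I \<Longrightarrow> \<exists>n. D i = H \<odot> sphere n" "is_coproduct C I D Q j"
    "\<Phi> \<in> hom Q (H \<odot> E)" "zero_object C (H \<odot> E) \<or> I \<noteq> {}"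
    "\<And>n x. x \<in> hom (sphere n) (H \<odot> E) \<Longrightarrow> \<exists>y \<in> hom (sphere n) Q. \<Phi> \<cdot> y = x"
    "\<And>n y. y \<in> hom (sphere n) Q \<Longrightarrow> \<Phi> \<cdot> y = zero (sphere n) (H \<odot> E) \<Longrightarrow> y = zero (sphere n) Q"
proof -
  define W where "W = H \<odot> E"
  have W: "W \<in> Ob C" unfolding W_def using smash_ob H_Ob E by blast
  obtain \<rho> where \<rho>: "\<rho> \<in> homset C (H \<odot> (H \<odot> E)) (H \<odot> E)" "\<rho> \<cdot> insertion u (H \<odot> E) = Id C (H \<odot> E)"
    by (rule action[OF E])
  note ext = extend[OF E \<rho>, folded W_def] and exp = exponent_p[OF E \<rho>, folded W_def]
  have "\<exists>B. \<forall>n. B n \<subseteq> hom (sphere n) W \<and> (\<forall>b \<in> B n. b \<notin> generate (hom_group C (sphere n) W) (B n - {b})) \<and>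
      generate (hom_group C (sphere n) W) (B n) = hom (sphere n) W"
    by (rule choice) (use sphere_basis[OF E \<rho>, folded W_def] in metis)
  then obtain B where B: "\<And>n. B n \<subseteq> hom (sphere n) W"
    "\<And>n b. b \<in> B n \<Longrightarrow> b \<notin> generate (hom_group C (sphere n) W) (B n - {b})"
    "\<And>n. generate (hom_group C (sphere n) W) (B n) = hom (sphere n) W" by blast
  define K where "K = Sigma UNIV B"
  obtain J where J: "Small C J" "Sigma UNIV (\<lambda>n. hom (sphere n) W) \<lesssim> J"
    using small_Sigma[of "\<lambda>n. hom (sphere n) W"] hom_sphere_small[OF W] by auto
  have "K \<subseteq> Sigma UNIV (\<lambda>n. hom (sphere n) W)" unfolding K_def using B(1) by auto
  then have "K \<lesssim> J" using J(2) lepoll_trans subset_imp_lepoll by blast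
  then obtain \<phi> where \<phi>: "inj_on \<phi> K" "\<phi> ` K \<subseteq> J" unfolding lepoll_def by blast
  define I where "I = \<phi> ` K"
  have I: "Small C I" using \<phi>(2) J(1) small_lepoll subset_imp_lepoll unfolding I_def by blast
  define \<psi> where "\<psi> = inv_into K \<phi>"
  have \<psi>: "\<psi> (\<phi> k) = k" if "k \<in> K" for k using \<phi>(1) that unfolding \<psi>_def by simp
  have \<psi>K: "\<psi> i \<in> K" if "i \<in> I" for i using that unfolding \<psi>_def I_def by (rule inv_into_into)
  define D where "D i = H \<odot> sphere (fst (\<psi> i))" for i
  have D: "D i \<in> Ob C" for i unfolding D_def using smash_ob H_Ob by simp
  have cell: "snd (\<psi> i) \<in> hom (sphere (fst (\<psi> i))) W" if "i \<in> I" for i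
    using \<psi>K[OF that] B(1)[of "fst (\<psi> i)"] unfolding K_def by auto
  obtain Q j where cop: "is_coproduct C I D Q j" using coproducts[OF I, of D] D by blast
  have Q: "Q \<in> Ob C" using coproduct_Ob[OF cop] .
  have ext_hom: "extend \<rho> (snd (\<psi> i)) \<in> hom (D i) W" if "i \<in> I" for i
    using ext(1)[OF cell[OF that]] unfolding D_def .
  obtain \<Phi> where \<Phi>: "\<Phi> \<in> hom Q W" "\<And>i. i \<in> I \<Longrightarrow> \<Phi> \<cdot> j i = extend \<rho> (snd (\<psi> i))"
    using coproduct_lift[OF cop W ext_hom] by metis
  \<comment> \<open>The class in \<open>Q\<close> carried by the summand of the basis element
    \<open>x\<close>; \<open>\<Phi>\<close> returns \<open>x\<close> itself.\<close>
  define \<eta> where "\<eta> n x = j (\<phi> (n, x)) \<cdot> insertion u (sphere n)" for n x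
  have idx: "\<phi> (n, x) \<in> I" "\<psi> (\<phi> (n, x)) = (n, x)" if "x \<in> B n" for n x
    using \<psi> that unfolding I_def K_def by auto
  have jn: "j (\<phi> (n, x)) \<in> hom (H \<odot> sphere n) Q" if "x \<in> B n" for n x
    using coproduct_inj[OF cop idx(1)[OF that]] idx(2)[OF that] unfolding D_def by simp
  note ins = insertion(1)[OF u sphere_Ob]
  have \<eta>: "\<eta> n x \<in> hom (sphere n) Q" if "x \<in> B n" for n x
    unfolding \<eta>_def using comp_hom[OF ins jn[OF that]] .
  have \<Phi>\<eta>: "\<Phi> \<cdot> \<eta> n x = x" if x: "x \<in> B n" for n x
  proof -
    have xh: "x \<in> hom (sphere n) W" using B(1) x by blast
    show ?thesis
      unfolding \<eta>_def using comp_assoc[OF ins jn[OF x] \<Phi>(1)] \<Phi>(2)[OF idx(1)[OF x]] idx(2)[OF x] ext(2)[OF xh] by simp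
  qed
  have \<eta>p: "multiple C p (\<eta> n x) = zero (sphere n) Q" if x: "x \<in> B n" for n x
    unfolding \<eta>_def using multiple_comp_right[OF ins jn[OF x], of p] multiple_insertion[OF u sphere_Ob u_torsion]
      comp_zero_right[OF jn[OF x]] by simp
  have p0: "0 < p" using prime_gt_0_nat[OF p] .
  have surj: "\<exists>y \<in> hom (sphere n) Q. \<Phi> \<cdot> y = x" if "x \<in> hom (sphere n) W" for n x
  proof -
    interpret G: comm_group "hom_group C (sphere n) W" using hom_group[OF sphere_Ob W] .
    have "x \<in> generate (hom_group C (sphere n) W) (B n)" using B(3) that by blast
    then show ?thesis
    proof (induction rule: generate.induct)
      case one
      then show ?case using comp_zero_right[OF \<Phi>(1) sphere_Ob] zero_hom[OF sphere_Ob Q] by auto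
    next
      case (incl h)
      then show ?case using \<eta> \<Phi>\<eta> by blast
    next
      case (inv h)
      have "h \<in> hom (sphere n) W" using B(1) inv by blast
      then have "\<Phi> \<cdot> neg C (\<eta> n h) = inv\<^bsub>hom_group C (sphere n) W\<^esub> h"
        using comp_neg_right[OF \<eta>[OF inv] \<Phi>(1)] \<Phi>\<eta>[OF inv] neg_eq by simp
      then show ?case using neg_hom[OF \<eta>[OF inv]] by blast
    next
      case (eng h1 h2)
      then obtain y1 y2 where y: "y1 \<in> hom (sphere n) Q" "\<Phi> \<cdot> y1 = h1" "y2 \<in> hom (sphere n) Q" "\<Phi> \<cdot> y2 = h2" by blast
      then show ?case using plus_hom[OF y(1,3)] comp_plus_right[OF y(1,3) \<Phi>(1)]
        by (intro bexI[of _ "Plus C y1 y2"]) simp_all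
    qed
  qed
  have inj: "y = zero (sphere n) Q"
    if y: "y \<in> hom (sphere n) Q" and 0: "\<Phi> \<cdot> y = zero (sphere n) W" for n y
  proof -
    define GQ where "GQ = hom_group C (sphere n) Q"
    define GW where "GW = hom_group C (sphere n) W"
    have GQ [simp]: "carrier GQ = hom (sphere n) Q" "monoid.mult GQ = Plus C" "one GQ = zero (sphere n) Q"
      and GW [simp]: "carrier GW = hom (sphere n) W" "monoid.mult GW = Plus C" "one GW = zero (sphere n) W"
      unfolding GQ_def GW_def by simp_all
    interpret Q: comm_group GQ unfolding GQ_def using hom_group[OF sphere_Ob Q] .
    interpret W: comm_group GW unfolding GW_def using hom_group[OF sphere_Ob W] .
    have powQ: "x [^]\<^bsub>GQ\<^esub> k = multiple C k x" if "x \<in> hom (sphere n) Q" for x k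
      unfolding GQ_def using multiple_eq[OF that] by simp
    have powW: "x [^]\<^bsub>GW\<^esub> k = multiple C k x" if "x \<in> hom (sphere n) W" for x k
      unfolding GW_def using multiple_eq[OF that] by simp
    have Bn: "B n \<subseteq> hom (sphere n) W" "\<eta> n ` B n \<subseteq> hom (sphere n) Q" using B(1) \<eta> by auto
    \<comment> \<open>A relation among the classes \<open>\<eta> n x\<close> is read off as a
      relation among basis elements.\<close>
    have map: "\<Phi> \<cdot> z \<in> generate GW F" if z: "z \<in> generate GQ (\<eta> n ` F)" and FB: "F \<subseteq> B n" for z F
      using z
    proof (induction rule: generate.induct)
      case one
      then show ?case using comp_zero_right[OF \<Phi>(1) sphere_Ob] generate.one[of GW F] by simp
    next
      case (incl h)
      then show ?case using \<Phi>\<eta> FB generate.incl[of _ F GW] by force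
    next
      case (inv h)
      then obtain x where x: "x \<in> F" "h = \<eta> n x" "x \<in> B n" using FB by blast
      then have xh: "x \<in> hom (sphere n) W" using Bn by blast
      have "\<Phi> \<cdot> (inv\<^bsub>GQ\<^esub> h) = inv\<^bsub>GW\<^esub> x"
        unfolding GQ_def GW_def using comp_neg_right[OF \<eta>[OF x(3)] \<Phi>(1)] \<Phi>\<eta>[OF x(3)] x(2)
          neg_eq[OF \<eta>[OF x(3)]] neg_eq[OF xh] by simp
      then show ?case using generate.inv[OF x(1), of GW] by simp
    next
      case (eng h1 h2)
      have "\<eta> n ` F \<subseteq> carrier GQ" using Bn FB by auto
      then have "h1 \<in> hom (sphere n) Q" "h2 \<in> hom (sphere n) Q"
        using Q.generate_in_carrier[of "\<eta> n ` F"] eng by auto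
      then show ?case using comp_plus_right[OF _ _ \<Phi>(1)] generate.eng[OF eng(3,4)] by simp
    qed
    have claim: "z = zero (sphere n) Q"
      if "finite F" "F \<subseteq> B n" "z \<in> generate GQ (\<eta> n ` F)" "\<Phi> \<cdot> z = zero (sphere n) W" for F z
      using that
    proof (induction F arbitrary: z rule: finite_induct)
      case empty
      then show ?case using Q.generate_empty by simp
    next
      case (insert x F)
      have x: "x \<in> B n" and F: "F \<subseteq> B n" using insert.prems by auto
      have xh: "x \<in> hom (sphere n) W" and \<eta>h: "\<eta> n x \<in> hom (sphere n) Q" using Bn x by auto
      have \<eta>F: "\<eta> n ` F \<subseteq> carrier GQ" using Bn F by auto
      obtain k :: nat and w where w: "w \<in> generate GQ (\<eta> n ` F)" "z = \<eta> n x [^]\<^bsub>GQ\<^esub> k \<otimes>\<^bsub>GQ\<^esub> w"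
        using Q.generate_insert_elem[of "\<eta> n x" "\<eta> n ` F" p z] \<eta>h \<eta>F powQ \<eta>p[OF x] p0 insert.prems by auto
      have wh: "w \<in> hom (sphere n) Q" using Q.generate_in_carrier[OF \<eta>F w(1)] by simp
      have z: "z = Plus C (multiple C k (\<eta> n x)) w" using w powQ \<eta>h by simp
      show ?case
      proof (cases "p dvd k")
        case True
        then obtain q where "k = p * q" by blast
        then have "\<eta> n x [^]\<^bsub>GQ\<^esub> k = zero (sphere n) Q"
          using Q.nat_pow_pow[of "\<eta> n x" p q] \<eta>h powQ[OF \<eta>h, of p] \<eta>p[OF x] Q.nat_pow_one[of q] by simp
        then have "z = w" using w(2) plus_zero(2)[OF wh] by simp
        then show ?thesis using insert.IH[OF F w(1)] insert.prems by simp
      next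
        case False
        \<comment> \<open>With a coefficient prime to \<open>p\<close>, the image of the relation
          would express \<open>x\<close> by the other basis elements, against independence.\<close>
        have "Plus C (multiple C k x) (\<Phi> \<cdot> w) = zero (sphere n) W"
          using insert.prems(3) comp_plus_right[OF multiple_hom[OF \<eta>h] wh \<Phi>(1)] multiple_comp_right[OF \<eta>h \<Phi>(1)] \<Phi>\<eta>[OF x] z by simp
        then have "multiple C k x = neg C (\<Phi> \<cdot> w)"
          using plus_eq_zeroD[OF multiple_hom[OF xh] comp_hom[OF wh \<Phi>(1)]] by simp
        then have "x [^]\<^bsub>GW\<^esub> k = inv\<^bsub>GW\<^esub> (\<Phi> \<cdot> w)"
          using powW[OF xh] neg_eq[OF comp_hom[OF wh \<Phi>(1)]] unfolding GW_def by simp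
        moreover have "\<Phi> \<cdot> w \<in> generate GW (B n - {x})"
          using map[OF w(1) F] W.mono_generate[of F "B n - {x}"] F insert.hyps by blast
        moreover have S: "B n - {x} \<subseteq> carrier GW" using Bn by auto
        ultimately have "x [^]\<^bsub>GW\<^esub> k \<in> generate GW (B n - {x})"
          using subgroup.m_inv_closed[OF W.generate_is_subgroup[OF S]] by simp
        then have "x \<in> generate GW (B n - {x})"
          using W.generate_power_dest[OF _ S _ p False] xh powW[OF xh] exp[OF xh] by simp
        then show ?thesis using B(2)[OF x] unfolding GW_def by blast
      qed
    qed
    \<comment> \<open>Compactness: every class of \<open>Q\<close> is a combination of finitely many
      of the classes \<open>\<eta> n x\<close>.\<close>
    have "\<exists>F. finite F \<and> F \<subseteq> B n \<and> y \<in> generate GQ (\<eta> n ` F)"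
    proof (rule compact_objectD[OF compact_sphere I D cop y])
      have "zero (sphere n) Q \<in> generate GQ (\<eta> n ` {})" using generate.one[of GQ "{}"] by simp
      then show z: "\<exists>F. finite F \<and> F \<subseteq> B n \<and> zero (sphere n) Q \<in> generate GQ (\<eta> n ` F)" by blast
      fix i g assume i: "i \<in> I" and g: "g \<in> hom (sphere n) (D i)"
      obtain m x where mx: "\<psi> i = (m, x)" "x \<in> B m" "i = \<phi> (m, x)"
        using \<psi>K[OF i] i \<psi> unfolding I_def K_def by auto
      show "\<exists>F. finite F \<and> F \<subseteq> B n \<and> j i \<cdot> g \<in> generate GQ (\<eta> n ` F)"
      \<comment> \<open>The homotopy of \<open>H \<odot> sphere m\<close> sits in degree
        \<open>m\<close>, so only summands of the matching degree contribute, and there by multiples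
        of the insertion.\<close>
      proof (cases "m = n")
        case False
        have "orth (sphere n) (D i)" using sphere_orth_smash[OF H_Ob, of n m] H_orth[of "n - m"] False mx(1) by (simp add: D_def)
        then have "j i \<cdot> g = zero (sphere n) Q"
          using orthD[OF _ g] comp_zero_right[OF coproduct_inj[OF cop i] sphere_Ob] by simp
        then show ?thesis using z by simp
      next
        case True
        then obtain k where "g = multiple C k (insertion u (sphere n))"
          using insertion_sphere[of g n] g mx(1) by (auto simp: D_def)
        then have "j i \<cdot> g = \<eta> n x [^]\<^bsub>GQ\<^esub> k"
          using powQ[OF \<eta>] multiple_comp_right[OF ins jn] mx True by (simp add: \<eta>_def)
        moreover have "\<eta> n x [^]\<^bsub>GQ\<^esub> k \<in> generate GQ (\<eta> n ` {x})"
        proof (induction k)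
          case (Suc k)
          then show ?case using generate.eng[OF Suc generate.incl[of "\<eta> n x" "\<eta> n ` {x}" GQ]] by simp
        qed (use generate.one[of GQ "\<eta> n ` {x}"] in simp)
        ultimately show ?thesis using mx True by (intro exI[of _ "{x}"]) auto
      qed
    next
      fix a b assume "\<exists>F. finite F \<and> F \<subseteq> B n \<and> a \<in> generate GQ (\<eta> n ` F)"
        "\<exists>F. finite F \<and> F \<subseteq> B n \<and> b \<in> generate GQ (\<eta> n ` F)"
      then obtain F F' where F: "finite F" "F \<subseteq> B n" "a \<in> generate GQ (\<eta> n ` F)"
        "finite F'" "F' \<subseteq> B n" "b \<in> generate GQ (\<eta> n ` F')" by blast
      have "a \<in> generate GQ (\<eta> n ` (F \<union> F'))" "b \<in> generate GQ (\<eta> n ` (F \<union> F'))"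
        using F Q.mono_generate[of "\<eta> n ` F" "\<eta> n ` (F \<union> F')"] Q.mono_generate[of "\<eta> n ` F'" "\<eta> n ` (F \<union> F')"] by blast+
      from generate.eng[OF this] show "\<exists>F. finite F \<and> F \<subseteq> B n \<and> Plus C a b \<in> generate GQ (\<eta> n ` F)"
        using F by (intro exI[of _ "F \<union> F'"]) auto
    qed
    then show ?thesis using claim 0 by blast
  qed
  \<comment> \<open>With no basis elements all homotopy of \<open>W\<close> vanishes. Nonemptiness
    later provides a summand of \<open>Q\<close>.\<close>
  have ne: "zero_object C W \<or> I \<noteq> {}"
  proof (rule ccontr)
    assume "\<not> (zero_object C W \<or> I \<noteq> {})"
    then have nz: "\<not> zero_object C W" and "K = {}" unfolding I_def by auto
    then have "B n = {}" for n unfolding K_def by auto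
    then have "hom (sphere n) W = {zero (sphere n) W}" for n
      using B(3)[of n] group.generate_empty[of "hom_group C (sphere n) W"] hom_group[OF sphere_Ob W, of n]
      by (simp add: comm_group_def)
    then have "orth (sphere n) W" for n unfolding orth_def by blast
    then show False using zero_object_sphere[OF W] nz by blast
  qed
  show ?thesis
  proof (rule that[OF I _ cop \<Phi>(1)[unfolded W_def] ne[unfolded W_def]])
    show "\<exists>n. D i = H \<odot> sphere n" for i unfolding D_def by blast
  qed (use surj inj in \<open>auto simp: W_def\<close>)
qed

text \<open>The long exact sequence of homotopy: injectivity one degree lower gives
  \<open>h \<cdot> a = 0\<close>, so \<open>a\<close> lifts to \<open>Y\<close>, and by surjectivity
  the lift comes from \<open>X\<close>.\<close>

lemma sphere_equivalence_cofibre: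
  assumes tri: "(f, g, h) \<in> Tri C" and f: "f \<in> hom X Y" and g: "g \<in> hom Y Z" and h: "h \<in> hom Z (Sus C X)"
    and surj: "\<And>n x. x \<in> hom (sphere n) Y \<Longrightarrow> \<exists>y \<in> hom (sphere n) X. f \<cdot> y = x"
    and inj: "\<And>n y. y \<in> hom (sphere n) X \<Longrightarrow> f \<cdot> y = zero (sphere n) Y \<Longrightarrow> y = zero (sphere n) X"
  shows "zero_object C Z"
proof (rule zero_object_sphere)
  show Z: "Z \<in> Ob C" using g hom_Ob by blast
  have X: "X \<in> Ob C" and Y: "Y \<in> Ob C" using hom_Ob[OF f] by auto
  show "orth (sphere n) Z" for n
    unfolding orth_def
  proof
    fix a assume a: "a \<in> hom (sphere n) Z"
    note ha = comp_hom[OF a h]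
    obtain c where c0: "iso_in C c (Sus C (sphere (n - 1))) (sphere n)"
      using sphere_sus[of "n - 1"] unfolding isomorphic_def by auto
    have c: "c \<in> hom (Sus C (sphere (n - 1))) (sphere n)" using iso_hom[OF c0] .
    obtain z where z: "z \<in> hom (sphere (n - 1)) X" "SusM C z = (h \<cdot> a) \<cdot> c"
      by (rule sus_full[OF comp_hom[OF c ha] sphere_Ob X])
    have "SusM C (f \<cdot> z) = (SusM C f \<cdot> h) \<cdot> (a \<cdot> c)"
      using sus_comp[OF z(1) f] z(2) comp_assoc[OF c a h] comp_assoc[OF comp_hom[OF c a] h sus_hom[OF f]] by simp
    also have "\<dots> = zero (Sus C (sphere (n - 1))) (Sus C Y)"
      using tri_zero3[OF tri f g h] comp_zero_left[OF comp_hom[OF c a] sus_ob[OF Y]] by simp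
    finally have "f \<cdot> z = zero (sphere (n - 1)) Y" using sus_eq_zero[OF comp_hom[OF z(1) f]] by blast
    then have "z = zero (sphere (n - 1)) X" using inj z(1) by blast
    then have "(h \<cdot> a) \<cdot> c = zero (Sus C (sphere (n - 1))) (Sus C X)" using z(2) sus_zero[OF sphere_Ob X] by simp
    then have "h \<cdot> a = zero (sphere n) (Sus C X)" using iso_zero_right[OF c0 ha] by blast
    then obtain b where b: "b \<in> hom (sphere n) Y" "g \<cdot> b = a" by (rule tri_exact_left2[OF tri f g h a])
    obtain y where y: "y \<in> hom (sphere n) X" "f \<cdot> y = b" using surj[OF b(1)] by blast
    have "a = (g \<cdot> f) \<cdot> y" using b y comp_assoc[OF y(1) f g] by simp
    then show "a = zero (sphere n) Z"
      using tri_zero1[OF tri f g h] comp_zero_left[OF y(1) Z] by simp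
  qed
qed

lemma smash_sphere_zero_iff:
  assumes Z: "Z \<in> Ob C" shows "zero_object C ((H \<odot> sphere n) \<odot> Z) \<longleftrightarrow> zero_object C (H \<odot> Z)"
proof -
  have iso: "zero_object C ((H \<odot> X) \<odot> Z) \<longleftrightarrow> zero_object C ((H \<odot> Y) \<odot> Z)" if "isomorphic X Y" for X Y
    using smash_isomorphic[OF smash_isomorphic[OF isomorphic_refl[OF H_Ob] that] isomorphic_refl[OF Z]]
      isomorphic_zero isomorphic_sym by blast
  have sus: "zero_object C ((H \<odot> X) \<odot> Z) \<longleftrightarrow> zero_object C ((H \<odot> Sus C X) \<odot> Z)" if X: "X \<in> Ob C" for X
  proof -
    have HX: "H \<odot> X \<in> Ob C" "(H \<odot> X) \<odot> Z \<in> Ob C" using smash_ob H_Ob X Z by auto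
    have "isomorphic ((H \<odot> Sus C X) \<odot> Z) (Sus C ((H \<odot> X) \<odot> Z))"
      using isomorphic_trans[OF smash_isomorphic[OF smash_sus_right_isomorphic[OF H_Ob X] isomorphic_refl[OF Z]]
          smash_sus_isomorphic[OF HX(1) Z]] .
    then show ?thesis using isomorphic_zero isomorphic_sym sus_zero_object_iff[OF HX(2)] by blast
  qed
  have "isomorphic (H \<odot> Sph C) H" using run_iso[OF H_Ob] isomorphic_def by blast
  then have base: "zero_object C ((H \<odot> Sph C) \<odot> Z) \<longleftrightarrow> zero_object C (H \<odot> Z)"
    using smash_isomorphic[OF _ isomorphic_refl[OF Z]] isomorphic_zero isomorphic_sym by blast
  show ?thesis
    by (rule sphere_induct[where Q = "\<lambda>X. zero_object C ((H \<odot> X) \<odot> Z) \<longleftrightarrow> zero_object C (H \<odot> Z)"])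
      (use base iso sus in blast)+
qed

text \<open>If \<open>E \<odot> Z\<close> vanishes, so does \<open>(H \<odot> E) \<odot> Z\<close>,
  and hence \<open>Q \<odot> Z\<close> for the equivalent coproduct \<open>Q\<close>. A summand
  \<open>H \<odot> sphere n\<close> of \<open>Q\<close> is a retract, and the sphere can be removed
  since it only shifts degrees.\<close>

lemma bousfield_minimal:
  assumes E: "E \<in> Ob C" and Z: "Z \<in> Ob C" and nz: "\<not> zero_object C (H \<odot> E)" and EZ: "zero_object C (E \<odot> Z)"
  shows "zero_object C (H \<odot> Z)"
proof -
  obtain I D Q j \<Phi> where I: "Small C I" and D: "\<And>i. i \<in> I \<Longrightarrow> \<exists>n. D i = H \<odot> sphere n"
    and cop: "is_coproduct C I D Q j" and \<Phi>: "\<Phi> \<in> hom Q (H \<odot> E)" and ne: "zero_object C (H \<odot> E) \<or> I \<noteq> {}"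
    and surj: "\<And>n x. x \<in> hom (sphere n) (H \<odot> E) \<Longrightarrow> \<exists>y \<in> hom (sphere n) Q. \<Phi> \<cdot> y = x"
    and inj: "\<And>n y. y \<in> hom (sphere n) Q \<Longrightarrow> \<Phi> \<cdot> y = zero (sphere n) (H \<odot> E) \<Longrightarrow> y = zero (sphere n) Q"
    by (rule free_resolution[OF E], rule that) assumption+
  obtain g h T where tri: "(\<Phi>, g, h) \<in> Tri C" and g: "g \<in> hom (H \<odot> E) T" and h: "h \<in> hom T (Sus C Q)"
    by (rule cofibre[OF \<Phi>])
  have T: "zero_object C T" by (rule sphere_equivalence_cofibre[OF tri \<Phi> g h surj inj])
  have "zero_object C (H \<odot> (E \<odot> Z))" using smash_zero_object_right[OF H_Ob EZ] .
  then have HEZ: "zero_object C ((H \<odot> E) \<odot> Z)"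
    using isomorphic_zero[OF isomorphic_sym[OF smash_asc_isomorphic[OF H_Ob E Z]]] by blast
  have QZ: "zero_object C (Q \<odot> Z)"
    by (rule tri_zero_first[OF smash_tri[OF tri \<Phi> g h Z] HEZ smash_zero_object_left[OF T Z]])
  obtain i where i: "i \<in> I" using ne nz by blast
  obtain n where n: "D i = H \<odot> sphere n" using D[OF i] by blast
  have DOb: "D i \<in> Ob C" if "i \<in> I" for i using D[OF that] smash_ob H_Ob sphere_Ob by auto
  obtain q where q: "q \<in> hom Q (D i)" "q \<cdot> j i = Id C (D i)" by (rule coproduct_projection[OF cop i DOb])
  note IZ = id_hom[OF Z] and ji = coproduct_inj[OF cop i]
  have "(q \<star> Id C Z) \<cdot> (j i \<star> Id C Z) = Id C (D i \<odot> Z)"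
    using smash_comp_left[OF ji q(1) Z] q(2) smash_id[OF DOb[OF i] Z] by simp
  then have "zero_object C (D i \<odot> Z)"
    by (rule zero_object_retract[OF QZ smash_hom[OF ji IZ] smash_hom[OF q(1) IZ]])
  then show ?thesis using n smash_sphere_zero_iff[OF Z] by simp
qed

section \<open>The Bousfield lattice\<close>

lemma mem_class: "Z \<in> bousfield_class C E \<longleftrightarrow> Z \<in> Ob C \<and> zero_object C (E \<odot> Z)"
  by (simp add: bousfield_class_def)

lemma smash_zero_commute: "X \<in> Ob C \<Longrightarrow> Y \<in> Ob C \<Longrightarrow> zero_object C (X \<odot> Y) \<Longrightarrow> zero_object C (Y \<odot> X)"
  using isomorphic_zero smash_sym_isomorphic by blast

lemma smash_zero_assoc:
  "X \<in> Ob C \<Longrightarrow> Y \<in> Ob C \<Longrightarrow> Z \<in> Ob C \<Longrightarrow> zero_object C ((X \<odot> Y) \<odot> Z) \<longleftrightarrow> zero_object C (X \<odot> (Y \<odot> Z))"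
  using isomorphic_zero smash_asc_isomorphic isomorphic_sym by blast

text \<open>By associativity, \<open>Z\<close> is acyclic for \<open>E \<odot> G\<close> exactly if
  \<open>G \<odot> Z\<close> is acyclic for \<open>E\<close>.\<close>

lemma bousfield_class_smash_mono:
  assumes "E \<in> Ob C" "F \<in> Ob C" "G \<in> Ob C" "bousfield_class C E \<subseteq> bousfield_class C F"
  shows "bousfield_class C (E \<odot> G) \<subseteq> bousfield_class C (F \<odot> G)"
proof
  fix Z assume "Z \<in> bousfield_class C (E \<odot> G)"
  then have "Z \<in> Ob C" "G \<odot> Z \<in> bousfield_class C E"
    using assms smash_zero_assoc smash_ob by (auto simp: mem_class)
  moreover have "G \<odot> Z \<in> bousfield_class C F" using calculation assms(4) by blast
  ultimately show "Z \<in> bousfield_class C (F \<odot> G)"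
    using assms smash_zero_assoc smash_ob by (auto simp: mem_class)
qed

lemma bousfield_class_smash_commute:
  assumes "E \<in> Ob C" "F \<in> Ob C"
  shows "bousfield_class C (E \<odot> F) = bousfield_class C (F \<odot> E)"
proof -
  have "zero_object C ((E \<odot> F) \<odot> Z) \<longleftrightarrow> zero_object C ((F \<odot> E) \<odot> Z)" if "Z \<in> Ob C" for Z
    using smash_isomorphic[OF smash_sym_isomorphic[OF assms] isomorphic_refl[OF that]] isomorphic_zero isomorphic_sym
    by blast
  then show ?thesis by (auto simp: mem_class)
qed

text \<open>The description determines a unique class because the representatives can be exchanged
  one factor at a time, using commutativity for the second.\<close>

lemma bousfield_smash_class:
  assumes "E \<in> Ob C" "F \<in> Ob C"
  shows "bousfield_smash C (bousfield_class C E) (bousfield_class C F) = bousfield_class C (E \<odot> F)"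
  unfolding bousfield_smash_def
proof (rule the_equality)
  show "\<exists>E'\<in>Ob C. \<exists>F'\<in>Ob C. bousfield_class C E = bousfield_class C E' \<and>
      bousfield_class C F = bousfield_class C F' \<and> bousfield_class C (E \<odot> F) = bousfield_class C (E' \<odot> F')"
    using assms by blast
  fix d assume "\<exists>E'\<in>Ob C. \<exists>F'\<in>Ob C. bousfield_class C E = bousfield_class C E' \<and>
      bousfield_class C F = bousfield_class C F' \<and> d = bousfield_class C (E' \<odot> F')"
  then obtain E' F' where E': "E' \<in> Ob C" "F' \<in> Ob C" "bousfield_class C E = bousfield_class C E'"
      "bousfield_class C F = bousfield_class C F'" "d = bousfield_class C (E' \<odot> F')" by blast
  have "bousfield_class C (E' \<odot> F') = bousfield_class C (E \<odot> F')"
    using bousfield_class_smash_mono[OF assms(1) E'(1) E'(2)] bousfield_class_smash_mono[OF E'(1) assms(1) E'(2)] E' by auto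
  also have "\<dots> = bousfield_class C (F' \<odot> E)" using bousfield_class_smash_commute assms E' by blast
  also have "\<dots> = bousfield_class C (F \<odot> E)"
    using bousfield_class_smash_mono[OF assms(2) E'(2) assms(1)] bousfield_class_smash_mono[OF E'(2) assms(2) assms(1)] E' by auto
  also have "\<dots> = bousfield_class C (E \<odot> F)" using bousfield_class_smash_commute assms by blast
  finally show "d = bousfield_class C (E \<odot> F)" using E' by simp
qed

text \<open>The coproduct over a two-element index set: smashing commutes with coproducts, and a
  coproduct vanishes exactly if its summands do.\<close>

lemma binary_wedge:
  assumes "E \<in> Ob C" "F \<in> Ob C"
  obtains V where "V \<in> Ob C" "bousfield_class C V = bousfield_class C E \<inter> bousfield_class C F"
proof -
  obtain e :: "nat \<Rightarrow> 'i" where e: "inj e" "Small C (range e)" by (rule small_sequence)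
  define I where "I = {e 0, e 1}"
  have I: "Small C I" unfolding I_def using small_lepoll[OF e(2) subset_imp_lepoll] by auto
  have ne: "e 1 \<noteq> e 0" using e(1) by (simp add: inj_eq)
  define D where "D i = (if i = e 0 then E else F)" for i
  have D: "D i \<in> Ob C" for i using assms by (simp add: D_def)
  obtain V j where cop: "is_coproduct C I D V j" using coproducts[OF I, of D] D by blast
  have V: "V \<in> Ob C" using coproduct_Ob[OF cop] .
  have "zero_object C (V \<odot> Z) \<longleftrightarrow> (\<forall>i\<in>I. zero_object C (D i \<odot> Z))" if Z: "Z \<in> Ob C" for Z
  proof
    note copZ = smash_coproduct[OF I D cop Z]
    show "zero_object C (V \<odot> Z)" if "\<forall>i\<in>I. zero_object C (D i \<odot> Z)"
      using coproduct_zero[OF copZ] that by blast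
    assume 0: "zero_object C (V \<odot> Z)"
    show "\<forall>i\<in>I. zero_object C (D i \<odot> Z)"
    proof
      fix i assume i: "i \<in> I"
      obtain q where "q \<in> hom (V \<odot> Z) (D i \<odot> Z)" "q \<cdot> (j i \<star> Id C Z) = Id C (D i \<odot> Z)"
        by (rule coproduct_projection[OF copZ i]) (use smash_ob D Z in auto)
      then show "zero_object C (D i \<odot> Z)" using zero_object_retract[OF 0 coproduct_inj[OF copZ i]] by blast
    qed
  qed
  then have "bousfield_class C V = bousfield_class C E \<inter> bousfield_class C F"
    using ne by (auto simp: mem_class I_def D_def)
  then show ?thesis using that V by blast
qed

text \<open>The order reverses inclusion of acyclics, so the join is their intersection once this is
  realised by an object; antisymmetry makes it unique.\<close>

lemma bousfield_join_class:
  assumes "E \<in> Ob C" "F \<in> Ob C"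
  shows "bousfield_Join C {bousfield_class C E, bousfield_class C F} = bousfield_class C E \<inter> bousfield_class C F"
  unfolding bousfield_Join_def
proof (rule the_equality)
  obtain V where V: "V \<in> Ob C" "bousfield_class C V = bousfield_class C E \<inter> bousfield_class C F"
    by (rule binary_wedge[OF assms])
  show j: "is_bousfield_join C {bousfield_class C E, bousfield_class C F} (bousfield_class C E \<inter> bousfield_class C F)"
    unfolding is_bousfield_join_def bousfield_le_def bousfield_lattice_def using V by blast
  show "b = bousfield_class C E \<inter> bousfield_class C F"
    if b: "is_bousfield_join C {bousfield_class C E, bousfield_class C F} b" for b
  proof -
    have "bousfield_le b (bousfield_class C E \<inter> bousfield_class C F)"
      "bousfield_le (bousfield_class C E \<inter> bousfield_class C F) b"
      using b j unfolding is_bousfield_join_def by simp_all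
    then show ?thesis unfolding bousfield_le_def by blast
  qed
qed

lemma strange_smash_zero:
  assumes z: "bousfield_class C S \<in> strange_ideal C H" and S: "S \<in> Ob C"
  shows "zero_object C (H \<odot> S)"
proof (rule ccontr)
  assume nz: "\<not> zero_object C (H \<odot> S)"
  have "bousfield_class C S \<subseteq> bousfield_class C H"
    using bousfield_minimal[OF S _ nz] by (auto simp: mem_class)
  moreover have "bousfield_class C H \<subseteq> bousfield_class C S"
    using z unfolding strange_ideal_def bousfield_le_def by blast
  ultimately show False using z unfolding strange_ideal_def by blast
qed

lemma cong_DL_le:
  assumes X: "X \<in> Ob C" and Y: "Y \<in> Ob C" and z: "z \<in> strange_ideal C H"
    and eq: "bousfield_Join C {bousfield_class C X, z} = bousfield_Join C {bousfield_class C Y, z}"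
    and c: "c \<in> bousfield_DL C" and le: "bousfield_le c (bousfield_class C X)"
  shows "bousfield_le c (bousfield_class C Y)"
proof -
  obtain S where S: "S \<in> Ob C" "z = bousfield_class C S"
    using z unfolding strange_ideal_def bousfield_lattice_def by blast
  obtain E where E: "E \<in> Ob C" "c = bousfield_class C E"
    using c unfolding bousfield_DL_def bousfield_lattice_def by blast
  have idem: "bousfield_class C E = bousfield_class C (E \<odot> E)"
    using c bousfield_smash_class[OF E(1,1)] unfolding bousfield_DL_def E(2) by simp
  have YS: "bousfield_class C Y \<inter> bousfield_class C S \<subseteq> bousfield_class C E"
    using eq le bousfield_join_class[OF X S(1)] bousfield_join_class[OF Y S(1)]
    unfolding S(2) E(2) bousfield_le_def by auto
  have HS: "bousfield_class C H \<subseteq> bousfield_class C S"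
    using z unfolding strange_ideal_def bousfield_le_def S(2) by blast
  have SH: "zero_object C (H \<odot> S)" using strange_smash_zero z S by blast
  have "bousfield_class C Y \<subseteq> bousfield_class C E"
  proof (cases "zero_object C (H \<odot> E)")
    case True
    \<comment> \<open>Here \<open>E\<close> itself is an acyclic object for \<open>H\<close>, hence
      for the smaller class of \<open>S\<close>.\<close>
    then have SE: "zero_object C (S \<odot> E)" using HS E by (auto simp: mem_class)
    show ?thesis
    proof
      fix Z assume Z: "Z \<in> bousfield_class C Y"
      then have ZO: "Z \<in> Ob C" and YZ: "zero_object C (Y \<odot> Z)" by (auto simp: mem_class)
      \<comment> \<open>The test object is \<open>Z \<odot> E\<close>: acyclic for \<open>Y\<close>
        because \<open>Z\<close> is, and for \<open>S\<close> because \<open>E\<close> is.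
        Idempotence of \<open>E\<close> afterwards absorbs the additional factor.\<close>
      note ZE = smash_ob[OF ZO E(1)] and EZ = smash_ob[OF E(1) ZO]
      have "zero_object C ((Y \<odot> Z) \<odot> E)" using smash_zero_object_left[OF YZ E(1)] .
      then have 1: "zero_object C (Y \<odot> (Z \<odot> E))" using smash_zero_assoc[OF Y ZO E(1)] by simp
      have "zero_object C ((S \<odot> E) \<odot> Z)" using smash_zero_object_left[OF SE ZO] .
      then have "zero_object C (S \<odot> (E \<odot> Z))" using smash_zero_assoc[OF S(1) E(1) ZO] by simp
      then have 2: "zero_object C (S \<odot> (Z \<odot> E))"
        using isomorphic_zero[OF smash_isomorphic[OF isomorphic_refl[OF S(1)] smash_sym_isomorphic[OF E(1) ZO]]] by blast
      have "Z \<odot> E \<in> bousfield_class C E" using YS 1 2 ZE by (auto simp: mem_class)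
      then have "zero_object C (E \<odot> (Z \<odot> E))" by (simp add: mem_class)
      then have "zero_object C (E \<odot> (E \<odot> Z))"
        using isomorphic_zero[OF smash_isomorphic[OF isomorphic_refl[OF E(1)] smash_sym_isomorphic[OF ZO E(1)]]] by blast
      then have "Z \<in> bousfield_class C (E \<odot> E)" using smash_zero_assoc[OF E(1) E(1) ZO] ZO by (simp add: mem_class)
      then show "Z \<in> bousfield_class C E" using idem by simp
    qed
  next
    case False
    have "\<not> zero_object C (H \<odot> Y)"
    proof
      assume HY: "zero_object C (H \<odot> Y)"
      \<comment> \<open>Now \<open>H\<close> serves as test object: were it acyclic for
        \<open>Y\<close>, then, being acyclic for \<open>S\<close>, it would be acyclic for
        \<open>E\<close>.\<close>
      have "H \<in> bousfield_class C E"
        using YS smash_zero_commute[OF H_Ob Y HY] smash_zero_commute[OF H_Ob S(1) SH] H_Ob by (auto simp: mem_class)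
      then show False using False smash_zero_commute[OF E(1) H_Ob] by (simp add: mem_class)
    qed
    then have "bousfield_class C Y \<subseteq> bousfield_class C H"
      using bousfield_minimal[OF Y] by (auto simp: mem_class)
    then show ?thesis using HS YS by blast
  qed
  then show ?thesis unfolding bousfield_le_def E(2) by blast
qed

lemma cong_imp_r_eq:
  assumes "X \<in> Ob C" "Y \<in> Ob C"
    and "bousfield_cong C (strange_ideal C H) (bousfield_class C X) (bousfield_class C Y)"
  shows "bousfield_r C (bousfield_class C X) = bousfield_r C (bousfield_class C Y)"
proof -
  obtain z where z: "z \<in> strange_ideal C H"
    "bousfield_Join C {bousfield_class C X, z} = bousfield_Join C {bousfield_class C Y, z}"
    using assms(3) unfolding bousfield_cong_def by blast
  have "{c \<in> bousfield_DL C. bousfield_le c (bousfield_class C X)} = {c \<in> bousfield_DL C. bousfield_le c (bousfield_class C Y)}"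
    using cong_DL_le[OF assms(1,2) z] cong_DL_le[OF assms(2,1) z(1) z(2)[symmetric]] by blast
  then show ?thesis unfolding bousfield_r_def by simp
qed

end

section \<open>Low-dimensional maps into spheres\<close>

text \<open>The point set of \<open>nsphere n\<close> as a subset of a function type with its
  product topology, so that compactness and continuity of the type-based analysis apply.\<close>

definition unit_sphere :: "nat \<Rightarrow> (nat \<Rightarrow> real) set" where
  "unit_sphere n = {x. (\<Sum>i\<le>n. x i ^ 2) = 1 \<and> (\<forall>i>n. x i = 0)}"

definition pole :: "nat \<Rightarrow> real" where
  "pole = (\<lambda>i. if i = 0 then 1 else 0)"

lemma nsphere_unit_sphere: "nsphere n = top_of_set (unit_sphere n)"
  by (simp add: nsphere unit_sphere_def euclidean_product_topology)

lemma Euclidean_space_top: "Euclidean_space n = top_of_set {x. \<forall>i\<ge>n. x i = 0}"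
  by (simp add: Euclidean_space_def euclidean_product_topology)

lemma pole_in_unit_sphere: "pole \<in> unit_sphere n"
  using in_topspace_nsphere[of n] by (simp add: nsphere_unit_sphere pole_def)

lemma continuous_on_coordinate:
  "continuous_on S f \<Longrightarrow> continuous_on S (\<lambda>x. f x i :: real)" for f :: "'a::topological_space \<Rightarrow> nat \<Rightarrow> real"
  by (rule continuous_on_product_then_coordinatewise)

lemma continuous_on_coordinates:
  "(\<And>i. continuous_on S (\<lambda>x. f x i)) \<Longrightarrow> continuous_on S f" for f :: "'a::topological_space \<Rightarrow> nat \<Rightarrow> real"
  by (rule continuous_on_coordinatewise_then_product)

lemma unit_sphere_coordinate_le:
  assumes "x \<in> unit_sphere n" shows "\<bar>x i\<bar> \<le> 1"
proof (cases "i \<le> n")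
  case True
  then have "x i ^ 2 \<le> (\<Sum>i\<le>n. x i ^ 2)" by (intro member_le_sum) auto
  then show ?thesis using assms by (simp add: unit_sphere_def abs_square_le_1)
qed (use assms in \<open>simp add: unit_sphere_def\<close>)

lemma closed_unit_sphere: "closed (unit_sphere n)"
proof -
  have "unit_sphere n = {x. (\<Sum>i\<le>n. x i ^ 2) = 1} \<inter> (\<Inter>i\<in>{n<..}. {x. x i = 0})"
    by (auto simp: unit_sphere_def)
  moreover have "closed {x :: nat \<Rightarrow> real. (\<Sum>i\<le>n. x i ^ 2) = 1}"
    by (intro closed_Collect_eq continuous_intros continuous_on_coordinate[OF continuous_on_id])
  moreover have "closed {x :: nat \<Rightarrow> real. x i = 0}" for i
    by (intro closed_Collect_eq continuous_intros continuous_on_coordinate[OF continuous_on_id])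
  ultimately show ?thesis by (metis closed_INT closed_Int)
qed

text \<open>A closed subset of the cube, which is compact by Tychonoff's theorem.\<close>

lemma compact_of_bounded_coordinates:
  fixes S :: "(nat \<Rightarrow> real) set"
  assumes "closed S" "\<And>x i. x \<in> S \<Longrightarrow> \<bar>x i\<bar> \<le> 1"
  shows "compact S"
proof -
  have "compactin (powertop_real UNIV) (PiE UNIV (\<lambda>_ :: nat. {-1..1 :: real}))"
    by (simp add: compactin_PiE)
  then have "compact (PiE UNIV (\<lambda>_ :: nat. {-1..1 :: real}))"
    by (simp add: euclidean_product_topology)
  moreover have "S \<subseteq> PiE UNIV (\<lambda>_. {-1..1})"
    using assms(2) by (force simp: abs_le_iff)
  ultimately show ?thesis
    using assms(1) by (metis compact_Int_closed inf.absorb_iff2)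
qed

lemma compact_unit_sphere: "compact (unit_sphere n)"
  by (rule compact_of_bounded_coordinates[OF closed_unit_sphere]) (rule unit_sphere_coordinate_le)

text \<open>Stone-Weierstrass for the algebra of Lipschitz functions: the coordinates separate
  points, and products remain Lipschitz because continuous functions on the sphere are
  bounded.\<close>

lemma lipschitz_approximation:
  assumes f: "continuous_on (unit_sphere k) f" and e: "0 < e"
  obtains g L where "continuous_on (unit_sphere k) g" "0 \<le> L"
    "\<And>x y. x \<in> unit_sphere k \<Longrightarrow> y \<in> unit_sphere k \<Longrightarrow> \<bar>g x - g y\<bar> \<le> L * (\<Sum>j\<le>k. \<bar>x j - y j\<bar>)"
    "\<And>x. x \<in> unit_sphere k \<Longrightarrow> \<bar>f x - g x\<bar> < e"
proof -
  define lip where "lip g \<longleftrightarrow> (\<exists>L\<ge>0. \<forall>x\<in>unit_sphere k. \<forall>y\<in>unit_sphere k. \<bar>g x - g y\<bar> \<le> L * (\<Sum>j\<le>k. \<bar>x j - y j\<bar>))"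
    for g :: "(nat \<Rightarrow> real) \<Rightarrow> real"
  define R where "R = {g. continuous_on (unit_sphere k) g \<and> lip g}"
  have "function_ring_on R (unit_sphere k)"
  proof unfold_locales
    show "compact (unit_sphere k)" by (rule compact_unit_sphere)
    show "continuous_on (unit_sphere k) g" if "g \<in> R" for g using that by (simp add: R_def)
    show "(\<lambda>_. c) \<in> R" for c unfolding R_def lip_def by (auto intro!: exI[of _ 0])
    show "\<exists>f\<in>R. f x \<noteq> f y" if xy: "x \<in> unit_sphere k" "y \<in> unit_sphere k" "x \<noteq> y" for x y
    proof -
      obtain i where i: "x i \<noteq> y i" using xy by blast
      then have ik: "i \<le> k" using xy by (force simp: unit_sphere_def)
      have le: "\<bar>v i - w i\<bar> \<le> 1 * (\<Sum>j\<le>k. \<bar>v j - w j\<bar>)" for v w :: "nat \<Rightarrow> real"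
        using member_le_sum[of i "{..k}" "\<lambda>j. \<bar>v j - w j\<bar>"] ik by simp
      have "lip (\<lambda>x. x i)" unfolding lip_def by (intro exI[of _ 1] conjI ballI zero_le_one le)
      then have "(\<lambda>x. x i) \<in> R"
        unfolding R_def mem_Collect_eq by (intro conjI continuous_on_coordinate[OF continuous_on_id])
      then show ?thesis using i by (intro bexI[of _ "\<lambda>x. x i"])
    qed
    fix g h assume g: "g \<in> R" and h: "h \<in> R"
    obtain L where L: "0 \<le> L" "\<And>x y. x \<in> unit_sphere k \<Longrightarrow> y \<in> unit_sphere k \<Longrightarrow> \<bar>g x - g y\<bar> \<le> L * (\<Sum>j\<le>k. \<bar>x j - y j\<bar>)"
      using g unfolding R_def lip_def by blast
    obtain M where M: "0 \<le> M" "\<And>x y. x \<in> unit_sphere k \<Longrightarrow> y \<in> unit_sphere k \<Longrightarrow> \<bar>h x - h y\<bar> \<le> M * (\<Sum>j\<le>k. \<bar>x j - y j\<bar>)"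
      using h unfolding R_def lip_def by blast
    have gh: "continuous_on (unit_sphere k) g" "continuous_on (unit_sphere k) h" using g h by (auto simp: R_def)
    have "lip (\<lambda>x. g x + h x)"
      unfolding lip_def
    proof (intro exI[of _ "L + M"] conjI ballI)
      fix x y assume xy: "x \<in> unit_sphere k" "y \<in> unit_sphere k"
      have "\<bar>g x + h x - (g y + h y)\<bar> \<le> \<bar>g x - g y\<bar> + \<bar>h x - h y\<bar>" by linarith
      then show "\<bar>g x + h x - (g y + h y)\<bar> \<le> (L + M) * (\<Sum>j\<le>k. \<bar>x j - y j\<bar>)"
        using L(2)[OF xy] M(2)[OF xy] by (simp add: distrib_right)
    qed (use L M in simp)
    then show "(\<lambda>x. g x + h x) \<in> R" using gh by (auto simp: R_def intro: continuous_intros)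
    have bd: "\<exists>b. \<forall>x\<in>unit_sphere k. \<bar>q x\<bar> \<le> b" if "continuous_on (unit_sphere k) q" for q :: "(nat \<Rightarrow> real) \<Rightarrow> real"
      using compact_imp_bounded[OF compact_continuous_image[OF that compact_unit_sphere]]
      by (auto simp: bounded_iff)
    obtain a b where ab: "\<And>x. x \<in> unit_sphere k \<Longrightarrow> \<bar>g x\<bar> \<le> a" "\<And>x. x \<in> unit_sphere k \<Longrightarrow> \<bar>h x\<bar> \<le> b"
      using bd[OF gh(1)] bd[OF gh(2)] by blast
    have pos: "0 \<le> a" "0 \<le> b" using ab[OF pole_in_unit_sphere] by linarith+
    have "lip (\<lambda>x. g x * h x)"
      unfolding lip_def
    proof (intro exI[of _ "a * M + b * L"] conjI ballI)
      fix x y assume xy: "x \<in> unit_sphere k" "y \<in> unit_sphere k"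
      have "g x * h x - g y * h y = g x * (h x - h y) + h y * (g x - g y)" by (simp add: algebra_simps)
      then have "\<bar>g x * h x - g y * h y\<bar> \<le> \<bar>g x\<bar> * \<bar>h x - h y\<bar> + \<bar>h y\<bar> * \<bar>g x - g y\<bar>"
        by (metis abs_mult abs_triangle_ineq)
      also have "\<dots> \<le> a * (M * (\<Sum>j\<le>k. \<bar>x j - y j\<bar>)) + b * (L * (\<Sum>j\<le>k. \<bar>x j - y j\<bar>))"
        using L(2)[OF xy] M(2)[OF xy] ab(1)[OF xy(1)] ab(2)[OF xy(2)] pos by (intro add_mono mult_mono) auto
      finally show "\<bar>g x * h x - g y * h y\<bar> \<le> (a * M + b * L) * (\<Sum>j\<le>k. \<bar>x j - y j\<bar>)" by (simp add: algebra_simps)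
    qed (use L M pos in simp)
    then show "(\<lambda>x. g x * h x) \<in> R" using gh by (auto simp: R_def intro: continuous_intros)
  qed
  from function_ring_on.Stone_Weierstrass_basic[OF this f e]
  obtain g where "g \<in> R" "\<And>x. x \<in> unit_sphere k \<Longrightarrow> \<bar>f x - g x\<bar> < e" by blast
  then show ?thesis using that unfolding R_def lip_def by blast
qed

text \<open>The cell of a point records the index and the sign of a large coordinate, and the integer parts
  of the others, scaled by \<open>M\<close>; these determine the large coordinate up to \<open>O(1 / M)\<close>.\<close>

lemma unit_sphere_cells:
  obtains A :: "(nat \<times> bool \<times> (nat \<Rightarrow> int)) set" and cell
  where "finite A" "card A \<le> (k + 1) * 2 * (2 * M + 1) ^ k" "cell ` unit_sphere k \<subseteq> A"
    "\<And>x y. \<lbrakk>x \<in> unit_sphere k; y \<in> unit_sphere k; cell x = cell y; 0 < M\<rbrakk>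
        \<Longrightarrow> (\<Sum>j\<le>k. \<bar>x j - y j\<bar>) \<le> real (k + k * (k + 1)) / real M"
proof -
  define A where "A = (SIGMA i:{..k}. (UNIV :: bool set) \<times> PiE ({..k} - {i}) (\<lambda>_. {- int M..int M}))"
  \<comment> \<open>Such a coordinate exists because \<open>k + 1\<close> squares add up to
    1.\<close>
  define big where "big x = (SOME i. i \<le> k \<and> 1 / real (k + 1) \<le> x i ^ 2)" for x :: "nat \<Rightarrow> real"
  define cell where "cell x = (big x, 0 < x (big x), restrict (\<lambda>j. \<lfloor>real M * x j\<rfloor>) ({..k} - {big x}))" for x :: "nat \<Rightarrow> real"
  have big: "big x \<le> k" "1 / real (k + 1) \<le> x (big x) ^ 2" if x: "x \<in> unit_sphere k" for x
  proof -
    have "\<exists>i\<le>k. 1 / real (k + 1) \<le> x i ^ 2"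
    proof (rule ccontr)
      assume "\<not> (\<exists>i\<le>k. 1 / real (k + 1) \<le> x i ^ 2)"
      then have "(\<Sum>i\<le>k. x i ^ 2) < (\<Sum>i\<le>k. 1 / real (k + 1))" by (intro sum_strict_mono) auto
      then show False using x by (simp add: unit_sphere_def)
    qed
    then have "big x \<le> k \<and> 1 / real (k + 1) \<le> x (big x) ^ 2" unfolding big_def by (rule someI_ex)
    then show "big x \<le> k" "1 / real (k + 1) \<le> x (big x) ^ 2" by auto
  qed
  show ?thesis
  proof (rule that[of A cell])
    show "finite A" unfolding A_def by (intro finite_SigmaI finite_cartesian_product finite_PiE) auto
    have "card A = (\<Sum>i\<in>{..k}. card ((UNIV :: bool set) \<times> PiE ({..k} - {i}) (\<lambda>_. {- int M..int M})))"
      unfolding A_def by (intro card_SigmaI) (auto intro!: finite_PiE)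
    also have "\<dots> = (\<Sum>i\<in>{..k}. 2 * (2 * M + 1) ^ k)"
    proof (intro sum.cong refl)
      fix i assume "i \<in> {..k}"
      moreover have "nat (1 + 2 * int M) = 2 * M + 1" by linarith
      ultimately show "card ((UNIV :: bool set) \<times> PiE ({..k} - {i}) (\<lambda>_. {- int M..int M})) = 2 * (2 * M + 1) ^ k"
        by (simp add: card_cartesian_product card_PiE algebra_simps)
    qed
    \<comment> \<open>There are \<open>k + 1\<close> positions and 2 signs for the large coordinate,
      and \<open>2 * M + 1\<close> integer parts for each of the \<open>k\<close> others.\<close>
    finally show "card A \<le> (k + 1) * 2 * (2 * M + 1) ^ k" by simp
    show "cell ` unit_sphere k \<subseteq> A"
    proof (intro image_subsetI)
      fix x assume x: "x \<in> unit_sphere k"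
      have "- int M \<le> \<lfloor>real M * x j\<rfloor> \<and> \<lfloor>real M * x j\<rfloor> \<le> int M" for j
      proof -
        have "\<bar>real M * x j\<bar> \<le> real M" using unit_sphere_coordinate_le[OF x, of j]
          by (simp add: abs_mult mult_left_le)
        then show ?thesis by (auto simp: le_floor_iff floor_le_iff abs_le_iff)
      qed
      then show "cell x \<in> A" unfolding cell_def A_def using big(1)[OF x] by auto
    qed
    fix x y assume x: "x \<in> unit_sphere k" and y: "y \<in> unit_sphere k" and eq: "cell x = cell y" and M: "0 < M"
    define b where "b = big x"
    have b: "b \<le> k" "big y = b" "0 < x b \<longleftrightarrow> 0 < y b"
      using big[OF x] eq unfolding b_def cell_def by auto
    have fl: "\<lfloor>real M * x j\<rfloor> = \<lfloor>real M * y j\<rfloor>" if "j \<in> {..k} - {b}" for j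
    proof -
      have "restrict (\<lambda>j. \<lfloor>real M * x j\<rfloor>) ({..k} - {b}) j = restrict (\<lambda>j. \<lfloor>real M * y j\<rfloor>) ({..k} - {b}) j"
        using eq b unfolding cell_def b_def by simp
      then show ?thesis using that by simp
    qed
    have near: "\<bar>x j - y j\<bar> \<le> 1 / real M" if "j \<in> {..k} - {b}" for j
    proof -
      have "\<bar>real M * x j - real M * y j\<bar> \<le> 1" using fl[OF that] by linarith
      then have "real M * \<bar>x j - y j\<bar> \<le> 1" by (simp add: abs_mult right_diff_distrib[symmetric])
      then show ?thesis using M by (simp add: field_simps)
    qed
    have card: "card ({..k} - {b}) = k" using b by simp
    have split: "(\<Sum>j\<le>k. h j) = h b + (\<Sum>j\<in>{..k} - {b}. h j)" for h :: "nat \<Rightarrow> real"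
      using b(1) by (intro sum.remove) auto
    have s1: "(\<Sum>j\<in>{..k} - {b}. \<bar>x j - y j\<bar>) \<le> real k / real M"
      using sum_bounded_above[of "{..k} - {b}" "\<lambda>j. \<bar>x j - y j\<bar>" "1 / real M"] near card by simp
    \<comment> \<open>Both points have norm 1, so the difference of the squares at \<open>b\<close>
      is determined by the remaining coordinates.\<close>
    have "(x b - y b) * (x b + y b) = (\<Sum>j\<in>{..k} - {b}. y j ^ 2 - x j ^ 2)"
      using x y split[of "\<lambda>j. x j ^ 2"] split[of "\<lambda>j. y j ^ 2"]
      by (simp add: unit_sphere_def sum_subtractf power2_eq_square algebra_simps)
    then have "\<bar>x b - y b\<bar> * \<bar>x b + y b\<bar> = \<bar>\<Sum>j\<in>{..k} - {b}. y j ^ 2 - x j ^ 2\<bar>"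
      by (simp only: abs_mult[symmetric])
    also have "\<dots> \<le> (\<Sum>j\<in>{..k} - {b}. \<bar>y j ^ 2 - x j ^ 2\<bar>)" by (rule sum_abs)
    finally have "\<bar>x b - y b\<bar> * \<bar>x b + y b\<bar> \<le> (\<Sum>j\<in>{..k} - {b}. \<bar>y j ^ 2 - x j ^ 2\<bar>)" .
    also have "\<dots> \<le> (\<Sum>j\<in>{..k} - {b}. 2 * \<bar>x j - y j\<bar>)"
    proof (intro sum_mono)
      fix j
      have "\<bar>y j ^ 2 - x j ^ 2\<bar> = \<bar>y j + x j\<bar> * \<bar>x j - y j\<bar>"
        by (simp add: abs_mult[symmetric] power2_eq_square algebra_simps abs_minus_commute)
      also have "\<dots> \<le> 2 * \<bar>x j - y j\<bar>"
        using unit_sphere_coordinate_le[OF x, of j] unit_sphere_coordinate_le[OF y, of j]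
        by (intro mult_right_mono) auto
      finally show "\<bar>y j ^ 2 - x j ^ 2\<bar> \<le> 2 * \<bar>x j - y j\<bar>" .
    qed
    also have "\<dots> \<le> 2 * (real k / real M)" using s1 by (simp add: sum_distrib_left[symmetric])
    finally have prod: "\<bar>x b - y b\<bar> * \<bar>x b + y b\<bar> \<le> 2 * (real k / real M)" .
    \<comment> \<open>The square is at least \<open>1 / (k + 1)\<close>; the weaker bound on the
      coordinate itself needs no root.\<close>
    have low: "1 / real (k + 1) \<le> \<bar>z b\<bar>" if z: "z \<in> unit_sphere k" "big z = b" for z
    proof -
      have "(1 / real (k + 1)) ^ 2 \<le> 1 / real (k + 1)"
        by (simp add: power2_eq_square divide_simps)
      also have "\<dots> \<le> \<bar>z b\<bar> ^ 2" using big(2)[OF z(1)] z(2) by simp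
      finally show ?thesis by (rule power2_le_imp_le) simp
    qed
    \<comment> \<open>The recorded signs agree, so no cancellation occurs and the factor
      \<open>x b + y b\<close> can be divided out.\<close>
    have "\<bar>x b + y b\<bar> = \<bar>x b\<bar> + \<bar>y b\<bar>" using b(3) low[OF x] low[OF y b(2)] by (auto simp: abs_if)
    then have "2 / real (k + 1) \<le> \<bar>x b + y b\<bar>" using low[OF x] low[OF y b(2)] by (simp add: b_def)
    then have "\<bar>x b - y b\<bar> * (2 / real (k + 1)) \<le> 2 * (real k / real M)"
      using prod mult_left_mono[of "2 / real (k + 1)" "\<bar>x b + y b\<bar>" "\<bar>x b - y b\<bar>"] by linarith
    then have "\<bar>x b - y b\<bar> * 2 \<le> (2 * (real k / real M)) * real (k + 1)"
      by (simp only: times_divide_eq_right pos_divide_le_eq[of "real (k + 1)"] of_nat_0_less_iff)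
    moreover have "(2 * (real k / real M)) * real (k + 1) = 2 * (real (k * (k + 1)) / real M)"
      by (simp add: distrib_left add_divide_distrib)
    ultimately have "\<bar>x b - y b\<bar> * 2 \<le> 2 * (real (k * (k + 1)) / real M)" by (rule ord_le_eq_trans)
    then have s2: "\<bar>x b - y b\<bar> \<le> real (k * (k + 1)) / real M"
      by (simp only: mult.commute[of _ 2] mult_le_cancel_left_pos zero_less_numeral)
    show "(\<Sum>j\<le>k. \<bar>x j - y j\<bar>) \<le> real (k + k * (k + 1)) / real M"
      using s1 s2 split[of "\<lambda>j. \<bar>x j - y j\<bar>"] by (simp add: add_divide_distrib)
  qed
qed

text \<open>The conclusion says that \<open>g\<close> misses the ray through \<open>(-1, v)\<close>.  Otherwise, by the pigeonhole
  principle, two points \<open>v\<close> of a grid in the unit cube would be hit from the same cell of the sphere.\<close>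

lemma lipschitz_misses_ray:
  assumes kN: "k < N" and c: "0 < c" and L: "0 \<le> L"
    and lip: "\<And>x y i. x \<in> unit_sphere k \<Longrightarrow> y \<in> unit_sphere k \<Longrightarrow> \<bar>g x i - g y i\<bar> \<le> L * (\<Sum>j\<le>k. \<bar>x j - y j\<bar>)"
    and low: "\<And>x. x \<in> unit_sphere k \<Longrightarrow> \<exists>i\<le>N. c \<le> \<bar>g x i\<bar>"
  obtains v :: "nat \<Rightarrow> real" where
    "\<And>x. x \<in> unit_sphere k \<Longrightarrow> g x 0 < 0 \<Longrightarrow> \<exists>i\<in>{1..N}. g x i + g x 0 * v i \<noteq> 0"
proof -
  have False if neg: "\<And>v :: nat \<Rightarrow> real. \<exists>x\<in>unit_sphere k. g x 0 < 0 \<and> (\<forall>i\<in>{1..N}. g x i + g x 0 * v i = 0)"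
  proof -
    define d where "d = real (k + k * (k + 1))"
    \<comment> \<open>\<open>K\<close> is the resolution of the cells relative to the grid; the
      final estimate would give \<open>c * K \<le> 2 * L * d\<close>, contradicting this
      choice.\<close>
    obtain K :: nat where K: "2 * L * d / c < real K" using reals_Archimedean2 by blast
    have K0: "0 < K" using K c L by (metis d_def divide_nonneg_pos mult_nonneg_nonneg of_nat_0_le_iff
          gr0I linorder_not_le of_nat_0 zero_le_numeral)
    \<comment> \<open>With mesh \<open>1 / m\<close> on the grid and scale \<open>K * m\<close> on
      the sphere there are at most \<open>m * (m + 1) ^ k\<close> cells, fewer than the
      \<open>(m + 1) ^ N\<close> grid points since \<open>k < N\<close>.\<close>
    define m where "m = (k + 1) * 2 * (2 * K + 1) ^ k"
    have m0: "0 < m" unfolding m_def by simp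
    obtain A :: "(nat \<times> bool \<times> (nat \<Rightarrow> int)) set" and cell where
      A: "finite A" "card A \<le> (k + 1) * 2 * (2 * (K * m) + 1) ^ k" "cell ` unit_sphere k \<subseteq> A"
      and cell: "\<And>x y. \<lbrakk>x \<in> unit_sphere k; y \<in> unit_sphere k; cell x = cell y; 0 < K * m\<rbrakk>
        \<Longrightarrow> (\<Sum>j\<le>k. \<bar>x j - y j\<bar>) \<le> real (k + k * (k + 1)) / real (K * m)"
      by (rule unit_sphere_cells[where M = "K * m" and k = k], rule that) assumption+
    define V where "V = PiE {1..N} (\<lambda>_. {0..m})"
    have "2 * (K * m) + 1 \<le> (2 * K + 1) * (m + 1)" by (simp add: algebra_simps)
    then have "(2 * (K * m) + 1) ^ k \<le> (2 * K + 1) ^ k * (m + 1) ^ k"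
      by (metis power_mono power_mult_distrib zero_le)
    then have "(k + 1) * 2 * (2 * (K * m) + 1) ^ k \<le> (k + 1) * 2 * ((2 * K + 1) ^ k * (m + 1) ^ k)"
      by (rule mult_le_mono2)
    also have "\<dots> = m * (m + 1) ^ k" by (simp only: m_def mult.assoc)
    finally have "card A \<le> m * (m + 1) ^ k" using A(2) by linarith
    also have "\<dots> < (m + 1) ^ (k + 1)" by simp
    also have "\<dots> \<le> (m + 1) ^ N" using kN by (intro power_increasing) auto
    also have "\<dots> = card V" unfolding V_def by (simp add: card_PiE)
    finally have AV: "card A < card V" .
    obtain X where X: "\<And>w. X w \<in> unit_sphere k" "\<And>w. g (X w) 0 < 0"
      "\<And>w i. i \<in> {1..N} \<Longrightarrow> g (X w) i + g (X w) 0 * (real (w i) / real m) = 0"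
      using neg[of "\<lambda>i. real (w i) / real m" for w :: "nat \<Rightarrow> nat"] by metis
    have "(\<lambda>w. cell (X w)) ` V \<subseteq> A" using A(3) X(1) by blast
    then have "card ((\<lambda>w. cell (X w)) ` V) < card V" using AV card_mono[OF A(1)] by (meson le_less_trans)
    then have "\<not> inj_on (\<lambda>w. cell (X w)) V" by (rule pigeonhole)
    then obtain w w' where w: "w \<in> V" "w' \<in> V" "w \<noteq> w'" "cell (X w) = cell (X w')" unfolding inj_on_def by blast
    obtain i where i: "i \<in> {1..N}" "w i \<noteq> w' i" using PiE_ext[OF w(1,2)[unfolded V_def]] w(3) by blast
    define x where "x = X w" define y where "y = X w'"
    define a where "a = real (w i) / real m" define b where "b = real (w' i) / real m"
    have b1: "0 \<le> b" "b \<le> 1" using w(2) i(1) m0 unfolding V_def b_def by (auto simp: PiE_iff)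
    have gx: "g x i = - g x 0 * a" and gy: "g y i = - g y 0 * b"
      using X(3)[OF i(1), of w] X(3)[OF i(1), of w'] by (auto simp: x_def y_def a_def b_def)
    define \<Delta> where "\<Delta> = L * (d / real (K * m))"
    have xy: "x \<in> unit_sphere k" "y \<in> unit_sphere k" using X(1) unfolding x_def y_def by auto
    have \<Delta>: "\<bar>g x l - g y l\<bar> \<le> \<Delta>" for l
      using lip[OF xy, of l] cell[OF xy] w(4) K0 m0 L mult_left_mono[of _ "d / real (K * m)" L]
      unfolding \<Delta>_def d_def x_def y_def by fastforce
    \<comment> \<open>On a ray with \<open>v\<close> in the unit cube the coordinate of index 0
      dominates the others, so it inherits the lower bound \<open>c\<close>.\<close>
    have \<mu>: "c \<le> - g x 0"
    proof -
      obtain l where l: "l \<le> N" "c \<le> \<bar>g x l\<bar>" using low[OF xy(1)] by blast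
      show ?thesis
      proof (cases "l = 0")
        case True
        then show ?thesis using l X(2)[of w] by (simp add: x_def)
      next
        case False
        then have "l \<in> {1..N}" using l by auto
        then have "g x l = - g x 0 * (real (w l) / real m)" "real (w l) / real m \<le> 1"
          using X(3)[of l w] w(1) m0 unfolding V_def x_def by (auto simp: PiE_iff)
        moreover define t where "t = real (w l) / real m"
        ultimately have t: "g x l = - g x 0 * t" "t \<le> 1" "0 \<le> t" by auto
        have "g x 0 * 1 \<le> g x 0 * t" "g x 0 * t \<le> 0"
          using X(2)[of w] t by (auto simp: x_def mult_left_mono_neg mult_nonpos_nonneg)
        then have "\<bar>g x l\<bar> \<le> - g x 0" using t(1) by simp
        then show ?thesis using l by linarith
      qed
    qed
    \<comment> \<open>The rays through distinct grid values \<open>a\<close> and \<open>b\<close>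
      are separated by a multiple of \<open>1 / m\<close>, whereas the values of \<open>g\<close> on
      one cell differ by at most \<open>\<Delta>\<close>, of order
      \<open>1 / (K * m)\<close>.\<close>
    have "- g x 0 * (a - b) = (g x i - g y i) + b * (g x 0 - g y 0)"
      using gx gy by (simp add: algebra_simps)
    then have "- g x 0 * \<bar>a - b\<bar> = \<bar>(g x i - g y i) + b * (g x 0 - g y 0)\<bar>"
      using \<mu> c by (metis abs_mult abs_of_nonneg less_eq_real_def order_trans)
    also have "\<dots> \<le> \<bar>g x i - g y i\<bar> + b * \<bar>g x 0 - g y 0\<bar>"
      using b1 by (metis abs_mult abs_of_nonneg abs_triangle_ineq)
    also have "\<dots> \<le> \<Delta> + 1 * \<Delta>" using \<Delta> b1 by (intro add_mono mult_mono) auto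
    finally have "- g x 0 * \<bar>a - b\<bar> \<le> 2 * \<Delta>" by simp
    moreover have "1 / real m \<le> \<bar>a - b\<bar>"
    proof -
      have "1 \<le> \<bar>real (w i) - real (w' i)\<bar>" using i(2) by linarith
      then show ?thesis unfolding a_def b_def using m0 by (simp add: diff_divide_distrib[symmetric] divide_right_mono)
    qed
    then have "c * (1 / real m) \<le> - g x 0 * \<bar>a - b\<bar>" using \<mu> c m0 by (intro mult_mono) auto
    ultimately have "c * (1 / real m) \<le> 2 * \<Delta>" by linarith
    then have "c * real K \<le> 2 * L * d" unfolding \<Delta>_def using m0 K0 by (simp add: field_simps)
    then show False using K c by (simp add: field_simps)
  qed
  then show ?thesis using that by blast
qed

section \<open>Radial projection and contraction of maps into a sphere\<close>

definition radial :: "nat \<Rightarrow> (nat \<Rightarrow> real) \<Rightarrow> nat \<Rightarrow> real" where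
  "radial N z = (\<lambda>i. z i / sqrt (\<Sum>j\<le>N. z j ^ 2))"

lemma sum_squares_pos: "(\<exists>i\<le>N. z i \<noteq> 0) \<Longrightarrow> 0 < (\<Sum>j\<le>N. z j ^ 2)" for z :: "nat \<Rightarrow> real"
  by (auto intro!: sum_pos2)

lemma radial_in_unit_sphere:
  assumes "\<exists>i\<le>N. z i \<noteq> 0" "\<And>i. N < i \<Longrightarrow> z i = 0" shows "radial N z \<in> unit_sphere N"
proof -
  have "(\<Sum>i\<le>N. (radial N z i) ^ 2) = (\<Sum>i\<le>N. z i ^ 2 / (\<Sum>j\<le>N. z j ^ 2))"
    using sum_squares_pos[OF assms(1)] by (simp add: radial_def power_divide)
  also have "\<dots> = (\<Sum>i\<le>N. z i ^ 2) / (\<Sum>j\<le>N. z j ^ 2)" by (rule sum_divide_distrib[symmetric])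
  finally have "(\<Sum>i\<le>N. (radial N z i) ^ 2) = (\<Sum>i\<le>N. z i ^ 2) / (\<Sum>j\<le>N. z j ^ 2)" .
  then show ?thesis using sum_squares_pos[OF assms(1)] assms(2) by (simp add: unit_sphere_def radial_def)
qed

lemma radial_unit_sphere: "z \<in> unit_sphere N \<Longrightarrow> radial N z = z"
  by (simp add: radial_def unit_sphere_def)

text \<open>The segments between \<open>f x\<close> and \<open>g x\<close> avoid the origin, so they
  can be projected to the sphere; both maps fix \<open>pole\<close>, and so do all stages in
  between.\<close>

lemma homotopic_radial_linear:
  fixes f g :: "(nat \<Rightarrow> real) \<Rightarrow> nat \<Rightarrow> real"
  assumes f: "continuous_on (unit_sphere k) f" and g: "continuous_on (unit_sphere k) g"
    and z: "\<And>x i. x \<in> unit_sphere k \<Longrightarrow> N < i \<Longrightarrow> f x i = 0" "\<And>x i. x \<in> unit_sphere k \<Longrightarrow> N < i \<Longrightarrow> g x i = 0"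
    and nz: "\<And>x t. x \<in> unit_sphere k \<Longrightarrow> 0 \<le> t \<Longrightarrow> t \<le> 1 \<Longrightarrow> \<exists>i\<le>N. (1 - t) * f x i + t * g x i \<noteq> 0"
    and p: "f pole = pole" "g pole = pole"
  shows "homotopic_with (\<lambda>h. h pole = pole) (nsphere k) (nsphere N) (\<lambda>x. radial N (f x)) (\<lambda>x. radial N (g x))"
proof -
  define h where "h q = radial N (\<lambda>i. (1 - fst q) * f (snd q) i + fst q * g (snd q) i)" for q
  have "continuous_on ({0..1} \<times> unit_sphere k) h"
  proof (rule continuous_on_coordinates)
    fix i
    have c: "continuous_on ({0..1} \<times> unit_sphere k) (\<lambda>q. u (snd q) i)" if "continuous_on (unit_sphere k) u"
      for u :: "(nat \<Rightarrow> real) \<Rightarrow> nat \<Rightarrow> real" and i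
      by (rule continuous_on_coordinate[OF continuous_on_compose2[OF that continuous_on_snd[OF continuous_on_id]]]) auto
    note fg = c[OF f] c[OF g]
    have "(\<Sum>j\<le>N. ((1 - fst q) * f (snd q) j + fst q * g (snd q) j)\<^sup>2) \<noteq> 0" if "q \<in> {0..1} \<times> unit_sphere k" for q
      using sum_squares_pos[OF nz[of "snd q" "fst q"]] that by force
    then show "continuous_on ({0..1} \<times> unit_sphere k) (\<lambda>q. h q i)"
      unfolding h_def radial_def by (intro continuous_intros fg) auto
  qed
  moreover have "h q \<in> unit_sphere N" if "q \<in> {0..1} \<times> unit_sphere k" for q
    unfolding h_def using that nz z by (intro radial_in_unit_sphere) auto
  ultimately have "continuous_map (prod_topology (top_of_set {0..1}) (nsphere k)) (nsphere N) h"
    by (auto simp: nsphere_unit_sphere simp flip: subtopology_Times)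
  moreover have "h (t, pole) = pole" for t
  proof -
    have "(\<lambda>i. (1 - t) * f pole i + t * g pole i) = pole" by (simp add: p algebra_simps)
    then show ?thesis unfolding h_def using radial_unit_sphere[OF pole_in_unit_sphere] by simp
  qed
  ultimately show ?thesis
    unfolding homotopic_with_def by (intro exI[of _ h]) (auto simp: h_def)
qed

text \<open>Deform to a Lipschitz map missing a ray through \<open>(-1, v)\<close>, shear this ray to the antipode of
  the base point, and contract along straight lines.\<close>

lemma nullhomotopic_low_dim:
  assumes kN: "k < N" and F: "continuous_map (nsphere k) (nsphere N) F" and F0: "F pole = pole"
  shows "homotopic_with (\<lambda>h. h pole = pole) (nsphere k) (nsphere N) F (\<lambda>_. pole)"
proof -
  have Fc: "continuous_on (unit_sphere k) F" and FS: "\<And>x. x \<in> unit_sphere k \<Longrightarrow> F x \<in> unit_sphere N"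
    using F by (auto simp: nsphere_unit_sphere)
  \<comment> \<open>A point of the \<open>N\<close>-sphere has a coordinate of absolute value at
    least \<open>1 / (N + 1) = 2 * c\<close>; an approximation within \<open>c\<close> keeps a
    coordinate of size at least \<open>c\<close>.\<close>
  define c where "c = 1 / (2 * real (N + 1))"
  have c0: "0 < c" by (simp add: c_def)
  have "\<exists>g L. continuous_on (unit_sphere k) g \<and> 0 \<le> L \<and>
      (\<forall>x\<in>unit_sphere k. \<forall>y\<in>unit_sphere k. \<bar>g x - g y\<bar> \<le> L * (\<Sum>j\<le>k. \<bar>x j - y j\<bar>)) \<and>
      (\<forall>x\<in>unit_sphere k. \<bar>F x i - g x\<bar> < c / 2)" for i
  proof -
    have "0 < c / 2" using c0 by simp
    then obtain h M where "continuous_on (unit_sphere k) h" "0 \<le> M"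
      "\<And>x y. x \<in> unit_sphere k \<Longrightarrow> y \<in> unit_sphere k \<Longrightarrow> \<bar>h x - h y\<bar> \<le> M * (\<Sum>j\<le>k. \<bar>x j - y j\<bar>)"
      "\<And>x. x \<in> unit_sphere k \<Longrightarrow> \<bar>F x i - h x\<bar> < c / 2"
      using lipschitz_approximation[OF continuous_on_coordinate[OF Fc]] by blast
    then show ?thesis by blast
  qed
  then have "\<forall>i. \<exists>g L. continuous_on (unit_sphere k) g \<and> 0 \<le> L \<and>
      (\<forall>x\<in>unit_sphere k. \<forall>y\<in>unit_sphere k. \<bar>g x - g y\<bar> \<le> L * (\<Sum>j\<le>k. \<bar>x j - y j\<bar>)) \<and>
      (\<forall>x\<in>unit_sphere k. \<bar>F x i - g x\<bar> < c / 2)" by blast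
  from this[unfolded choice_iff] obtain g0 L0 where g0: "\<And>i. continuous_on (unit_sphere k) (g0 i)" "\<And>i. 0 \<le> L0 i"
    "\<And>i x y. x \<in> unit_sphere k \<Longrightarrow> y \<in> unit_sphere k \<Longrightarrow> \<bar>g0 i x - g0 i y\<bar> \<le> L0 i * (\<Sum>j\<le>k. \<bar>x j - y j\<bar>)"
    "\<And>i x. x \<in> unit_sphere k \<Longrightarrow> \<bar>F x i - g0 i x\<bar> < c / 2" by blast
  \<comment> \<open>The constant correction makes the approximation pointed; it costs a second error
    of at most \<open>c / 2\<close>.\<close>
  define g where "g x i = (if i \<le> N then g0 i x - g0 i pole + pole i else 0)" for x and i :: nat
  define L where "L = (\<Sum>i\<le>N. L0 i)"
  have L: "0 \<le> L" "\<And>i. i \<le> N \<Longrightarrow> L0 i \<le> L"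
    unfolding L_def using g0(2) by (auto intro!: sum_nonneg member_le_sum)
  have gc: "continuous_on (unit_sphere k) g"
  proof (rule continuous_on_coordinates)
    fix i show "continuous_on (unit_sphere k) (\<lambda>x. g x i)"
      unfolding g_def using g0(1) by (cases "i \<le> N") (auto intro!: continuous_intros)
  qed
  have g_pole: "g pole = pole" by (auto simp: g_def pole_def)
  have lip: "\<bar>g x i - g y i\<bar> \<le> L * (\<Sum>j\<le>k. \<bar>x j - y j\<bar>)" if "x \<in> unit_sphere k" "y \<in> unit_sphere k" for x y i
  proof (cases "i \<le> N")
    case True
    have "L0 i * (\<Sum>j\<le>k. \<bar>x j - y j\<bar>) \<le> L * (\<Sum>j\<le>k. \<bar>x j - y j\<bar>)"
      using L(2)[OF True] by (intro mult_right_mono) (auto intro: sum_nonneg)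
    then show ?thesis using g0(3)[OF that, of i] True by (simp add: g_def)
  next
    case False
    then show ?thesis using L(1) by (simp add: g_def sum_nonneg)
  qed
  have close: "\<bar>F x i - g x i\<bar> < c" if x: "x \<in> unit_sphere k" and i: "i \<le> N" for x i
  proof -
    have "\<bar>F x i - g0 i x\<bar> < c / 2" "\<bar>pole i - g0 i pole\<bar> < c / 2"
      using g0(4)[OF x, of i] g0(4)[OF pole_in_unit_sphere, of i] F0 by auto
    then show ?thesis using i by (simp add: g_def abs_if split: if_splits)
  qed
  have big: "\<exists>i\<le>N. 2 * c \<le> \<bar>F x i\<bar>" if x: "x \<in> unit_sphere k" for x
  proof (rule ccontr)
    assume "\<not> ?thesis"
    then have *: "\<bar>F x i\<bar> < 2 * c" if "i \<le> N" for i using that by force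
    have "(F x i) ^ 2 < (2 * c) ^ 2" if "i \<le> N" for i
      using *[OF that] by (metis abs_ge_zero power2_abs power_strict_mono zero_less_numeral)
    then have "(\<Sum>i\<le>N. (F x i) ^ 2) < (\<Sum>i\<le>N. (2 * c) ^ 2)" by (intro sum_strict_mono) auto
    also have "\<dots> = real (Suc N) * (2 * c) ^ 2" by simp
    also have "2 * c = 1 / real (Suc N)" by (simp add: c_def field_simps)
    also have "real (Suc N) * (1 / real (Suc N)) ^ 2 = 1 / real (Suc N)"
      by (simp add: power2_eq_square del: of_nat_Suc)
    also have "\<dots> \<le> 1" by simp
    finally show False using FS[OF x] by (simp add: unit_sphere_def)
  qed
  have low: "\<exists>i\<le>N. c \<le> \<bar>g x i\<bar>" if x: "x \<in> unit_sphere k" for x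
    using big[OF x] close[OF x] by force
  obtain v :: "nat \<Rightarrow> real" where v: "\<And>x. x \<in> unit_sphere k \<Longrightarrow> g x 0 < 0 \<Longrightarrow> \<exists>i\<in>{1..N}. g x i + g x 0 * v i \<noteq> 0"
    using lipschitz_misses_ray[OF kN c0 L(1) lip low] by metis
  \<comment> \<open>A piecewise linear shear, trivial on the half space where coordinate 0 is
    nonnegative, which takes the ray through \<open>(-1, v)\<close> to the negative axis.\<close>
  define s where "s x i = g x i + (if 1 \<le> i \<and> i \<le> N then min 0 (g x 0) * v i else 0)" for x i
  have sc: "continuous_on (unit_sphere k) s"
  proof (rule continuous_on_coordinates)
    fix i
    have cg: "continuous_on (unit_sphere k) (\<lambda>x. g x j)" for j using gc by (rule continuous_on_coordinate)
    have "continuous_on (unit_sphere k) (\<lambda>x. g x i + min 0 (g x 0) * v i)"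
      by (intro continuous_on_add continuous_on_mult_right continuous_on_min continuous_on_const cg)
    then show "continuous_on (unit_sphere k) (\<lambda>x. s x i)"
      using cg[of i] unfolding s_def by (cases "1 \<le> i \<and> i \<le> N") (simp_all only: if_True if_False simp_thms add_0_right)
  qed
  have "min 0 (pole 0) = 0" by (simp add: pole_def)
  then have s_pole: "s pole = pole" by (simp add: fun_eq_iff s_def g_pole)
  have pc: "continuous_on (unit_sphere k) (\<lambda>_. pole)" by simp
  let ?P = "\<lambda>h. h pole = pole"
  have 1: "homotopic_with ?P (nsphere k) (nsphere N) (\<lambda>x. radial N (F x)) (\<lambda>x. radial N (g x))"
  proof (rule homotopic_radial_linear[OF Fc gc _ _ _ F0 g_pole])
    fix x assume x: "x \<in> unit_sphere k"
    show "F x i = 0" if "N < i" for i using FS[OF x] that by (simp add: unit_sphere_def)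
    show "g x i = 0" if "N < i" for i using that by (simp add: g_def)
    fix t :: real assume t: "0 \<le> t" "t \<le> 1"
    obtain i where i: "i \<le> N" "2 * c \<le> \<bar>F x i\<bar>" using big[OF x] by blast
    have "\<bar>t * (F x i - g x i)\<bar> \<le> 1 * \<bar>F x i - g x i\<bar>" unfolding abs_mult using t by (intro mult_right_mono) auto
    also have "\<dots> < c" using close[OF x i(1)] by simp
    also have "\<dots> \<le> 2 * c" using c0 by simp
    also note i(2)
    finally have "\<bar>t * (F x i - g x i)\<bar> < \<bar>F x i\<bar>" .
    moreover have "(1 - t) * F x i + t * g x i = F x i - t * (F x i - g x i)" by (simp add: algebra_simps)
    ultimately have "(1 - t) * F x i + t * g x i \<noteq> 0" by auto
    then show "\<exists>i\<le>N. (1 - t) * F x i + t * g x i \<noteq> 0" using i by blast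
  qed
  have g_nz: "\<exists>i\<le>N. g x i \<noteq> 0" if "x \<in> unit_sphere k" for x using low[OF that] c0 by force
  have 2: "homotopic_with ?P (nsphere k) (nsphere N) (\<lambda>x. radial N (g x)) (\<lambda>x. radial N (s x))"
  proof (rule homotopic_radial_linear[OF gc sc _ _ _ g_pole s_pole])
    fix x assume x: "x \<in> unit_sphere k"
    show "g x i = 0" "s x i = 0" if "N < i" for i using that by (auto simp: g_def s_def)
    fix t :: real
    \<comment> \<open>The shear preserves coordinate 0 and is trivial where that coordinate
      vanishes, so the segment cannot pass through the origin.\<close>
    show "\<exists>i\<le>N. (1 - t) * g x i + t * s x i \<noteq> 0"
    proof (cases "g x 0 = 0")
      case True
      then have "s x i = g x i" for i by (simp add: s_def)
      then show ?thesis using g_nz[OF x] by (simp add: algebra_simps)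
    next
      case False
      then have "(1 - t) * g x 0 + t * s x 0 \<noteq> 0" by (simp add: s_def algebra_simps)
      then show ?thesis by blast
    qed
  qed
  have 3: "homotopic_with ?P (nsphere k) (nsphere N) (\<lambda>x. radial N (s x)) (\<lambda>x. radial N pole)"
  proof (rule homotopic_radial_linear[OF sc pc _ _ _ s_pole refl])
    fix x assume x: "x \<in> unit_sphere k"
    show "s x i = 0" "pole i = 0" if "N < i" for i using that by (auto simp: g_def s_def pole_def)
    fix t :: real assume t: "0 \<le> t" "t \<le> 1"
    \<comment> \<open>A zero on the segment to \<open>pole\<close> would put \<open>s x\<close> on
      the negative axis, that is, \<open>g x\<close> on the ray that is missed.\<close>
    show "\<exists>i\<le>N. (1 - t) * s x i + t * pole i \<noteq> 0"
    proof (rule ccontr)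
      assume "\<not> ?thesis"
      then have 0: "(1 - t) * s x i + t * pole i = 0" if "i \<le> N" for i using that by blast
      have t1: "t < 1" using 0[of 0] t by (cases "t = 1") (auto simp: pole_def)
      have "s x i = 0" if "1 \<le> i" "i \<le> N" for i using 0[OF that(2)] that t1 by (simp add: pole_def)
      then have sz: "g x i + min 0 (g x 0) * v i = 0" if "1 \<le> i" "i \<le> N" for i using that by (force simp: s_def)
      have "(1 - t) * g x 0 = - t" using 0[of 0] by (simp add: s_def pole_def)
      then have "g x 0 \<le> 0" using t t1 by (smt (verit) mult_pos_pos)
      show False
      proof (cases "g x 0 = 0")
        case True
        then have "g x i = 0" if "i \<le> N" for i using sz[of i] that by (cases "i = 0") auto
        then show False using g_nz[OF x] by blast
      next
        case False
        then show False using v[OF x] sz \<open>g x 0 \<le> 0\<close> by force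
      qed
    qed
  qed
  have "homotopic_with ?P (nsphere k) (nsphere N) (\<lambda>x. radial N (F x)) (\<lambda>x. radial N pole)"
    using homotopic_with_trans[OF homotopic_with_trans[OF 1 2] 3] .
  moreover have "homotopic_with ?P (nsphere k) (nsphere N) F (\<lambda>x. radial N (F x))"
  proof (rule homotopic_with_equal[OF _ _ F])
    show "F x = radial N (F x)" if "x \<in> topspace (nsphere k)" for x
      using radial_unit_sphere[OF FS] that by (simp add: nsphere_unit_sphere)
    show "F pole = pole" "radial N (F pole) = pole" using F0 radial_unit_sphere[OF pole_in_unit_sphere] by auto
  qed
  ultimately show ?thesis
    using homotopic_with_trans radial_unit_sphere[OF pole_in_unit_sphere] by fastforce
qed

section \<open>Smash products of spheres\<close>

text \<open>In stereographic coordinates \<open>a = (x\<^sub>1, \<dots>) / (1 - x\<^sub>0)\<close> and \<open>b = (y\<^sub>1, \<dots>) / (1 - y\<^sub>0)\<close>, this is the map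
  to the point with coordinates \<open>(a, b)\<close>.  The common denominator only vanishes at \<open>(pole, pole)\<close>, where
  division by zero gives the right value.\<close>

definition smash_denom :: "(nat \<Rightarrow> real) \<Rightarrow> (nat \<Rightarrow> real) \<Rightarrow> real" where
  "smash_denom x y = 2 * (1 - x 0) + 2 * (1 - y 0) - (1 - x 0) * (1 - y 0)"

definition smash_map :: "nat \<Rightarrow> nat \<Rightarrow> (nat \<Rightarrow> real) \<times> (nat \<Rightarrow> real) \<Rightarrow> nat \<Rightarrow> real" where
  "smash_map k n = (\<lambda>(x, y) i.
     if i = 0 then 1 - 2 * ((1 - x 0) * (1 - y 0)) / smash_denom x y
     else if i \<le> k then 2 * ((1 - y 0) * x i) / smash_denom x y
     else if i \<le> k + n then 2 * ((1 - x 0) * y (i - k)) / smash_denom x y else 0)"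

lemma sum_split_spheres: "(\<Sum>i\<le>k + n. h i) = h 0 + (\<Sum>i<k. h (Suc i)) + (\<Sum>j<n. h (Suc (k + j)))"
  for h :: "nat \<Rightarrow> real"
  by (induction n) (simp_all add: sum.atMost_shift)

text \<open>In stereographic coordinates this reads \<open>|a|^2 + 1 = 2 / (1 - x 0)\<close>.
  Combined for two factors, \<open>|a|^2 + |b|^2 + 1\<close> is \<open>smash_denom x y\<close>
  divided by \<open>(1 - x 0) * (1 - y 0)\<close>, which explains the denominator.\<close>

lemma unit_sphere_sum:
  assumes "x \<in> unit_sphere k"
  shows "(\<Sum>i<k. x (Suc i) ^ 2) = (1 - x 0) * (2 - (1 - x 0))"
  using assms sum_split_spheres[of "\<lambda>i. x i ^ 2" k 0]
  by (simp add: unit_sphere_def power2_eq_square algebra_simps)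

lemma unit_sphere_height: "x \<in> unit_sphere k \<Longrightarrow> 0 \<le> 1 - x 0 \<and> 1 - x 0 \<le> 2"
  using unit_sphere_coordinate_le[of x k 0] by (auto simp: abs_le_iff)

lemma unit_sphere_pole_iff:
  assumes "x \<in> unit_sphere k" shows "1 - x 0 = 0 \<longleftrightarrow> x = pole"
proof
  assume 0: "1 - x 0 = 0"
  have "(\<Sum>i<k. x (Suc i) ^ 2) = 0" using unit_sphere_sum[OF assms] 0 by simp
  then have "x (Suc i) = 0" if "i < k" for i using that by (simp add: sum_nonneg_eq_0_iff)
  moreover have "x i = 0" if "k < i" for i using assms that by (simp add: unit_sphere_def)
  ultimately have "x i = 0" if "i \<noteq> 0" for i
    using that by (metis Suc_le_eq linorder_not_le not0_implies_Suc)
  then show "x = pole" using 0 by (auto simp: pole_def)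
qed (simp add: pole_def)

text \<open>The differences are \<open>(1 - y 0) * (2 - (1 - x 0))\<close> and its mirror image.
  These bounds control the quotients near \<open>(pole, pole)\<close>.\<close>

lemma smash_denom_ge:
  assumes "x \<in> unit_sphere k" "y \<in> unit_sphere n"
  shows "2 * (1 - x 0) \<le> smash_denom x y" "2 * (1 - y 0) \<le> smash_denom x y"
proof -
  note h = unit_sphere_height[OF assms(1)] unit_sphere_height[OF assms(2)]
  have "0 \<le> (1 - y 0) * (2 - (1 - x 0))" "0 \<le> (1 - x 0) * (2 - (1 - y 0))" using h by (auto intro!: mult_nonneg_nonneg)
  then show "2 * (1 - x 0) \<le> smash_denom x y" "2 * (1 - y 0) \<le> smash_denom x y"
    by (auto simp: smash_denom_def algebra_simps)
qed

lemma smash_map_in_sphere: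
  assumes x: "x \<in> unit_sphere k" and y: "y \<in> unit_sphere n"
  shows "smash_map k n (x, y) \<in> unit_sphere (k + n)"
proof -
  define s where "s = 1 - x 0" define t where "t = 1 - y 0" define M where "M = smash_denom x y"
  have M: "M = 2 * s + 2 * t - s * t" by (simp add: M_def smash_denom_def s_def t_def)
  have "smash_map k n (x, y) (Suc i) = 2 * t / M * x (Suc i)" if "i < k" for i
    using that by (simp add: smash_map_def M_def t_def)
  then have "(\<Sum>i<k. (smash_map k n (x, y) (Suc i))\<^sup>2) = (\<Sum>i<k. (2 * t / M)\<^sup>2 * x (Suc i) ^ 2)"
    by (intro sum.cong) (simp_all only: power_mult_distrib lessThan_iff)
  also have "\<dots> = (2 * t / M)\<^sup>2 * (s * (2 - s))"
    unfolding sum_distrib_left[symmetric] using unit_sphere_sum[OF x] by (simp add: s_def)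
  finally have 1: "(\<Sum>i<k. (smash_map k n (x, y) (Suc i))\<^sup>2) = (2 * t / M)\<^sup>2 * (s * (2 - s))" .
  have "smash_map k n (x, y) (Suc (k + j)) = 2 * s / M * y (Suc j)" if "j < n" for j
    using that by (simp add: smash_map_def M_def s_def Suc_diff_le)
  then have "(\<Sum>j<n. (smash_map k n (x, y) (Suc (k + j)))\<^sup>2) = (\<Sum>j<n. (2 * s / M)\<^sup>2 * y (Suc j) ^ 2)"
    by (intro sum.cong) (simp_all only: power_mult_distrib lessThan_iff)
  also have "\<dots> = (2 * s / M)\<^sup>2 * (t * (2 - t))"
    unfolding sum_distrib_left[symmetric] using unit_sphere_sum[OF y] by (simp add: t_def)
  finally have 2: "(\<Sum>j<n. (smash_map k n (x, y) (Suc (k + j)))\<^sup>2) = (2 * s / M)\<^sup>2 * (t * (2 - t))" .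
  have 0: "smash_map k n (x, y) 0 = 1 - 2 * (s * t) / M" by (simp add: smash_map_def M_def s_def t_def)
  have "(\<Sum>i\<le>k + n. (smash_map k n (x, y) i)\<^sup>2) = 1"
  proof (cases "M = 0")
    case True
    then show ?thesis unfolding sum_split_spheres 0 1 2 by simp
  next
    case False
    have "(1 - 2 * (s * t) / M)\<^sup>2 + (2 * t / M)\<^sup>2 * (s * (2 - s)) + (2 * s / M)\<^sup>2 * (t * (2 - t))
        = ((M - 2 * (s * t))\<^sup>2 + (2 * t)\<^sup>2 * (s * (2 - s)) + (2 * s)\<^sup>2 * (t * (2 - t))) / M\<^sup>2"
      using False by (simp add: field_simps power2_eq_square)
    also have "(M - 2 * (s * t))\<^sup>2 + (2 * t)\<^sup>2 * (s * (2 - s)) + (2 * s)\<^sup>2 * (t * (2 - t)) = M\<^sup>2"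
      unfolding M by (simp add: power2_eq_square algebra_simps)
    finally show ?thesis unfolding sum_split_spheres 0 1 2 using False by simp
  qed
  then show ?thesis by (auto simp: unit_sphere_def smash_map_def)
qed

lemma smash_map_wedge: "x = pole \<or> y = pole \<Longrightarrow> smash_map k n (x, y) = pole"
  by (auto simp: smash_map_def pole_def fun_eq_iff)

lemma smash_denom_pos:
  assumes "x \<in> unit_sphere k" "y \<in> unit_sphere n" "x \<noteq> pole" "y \<noteq> pole"
  shows "0 < 1 - x 0" "0 < 1 - y 0" "0 < smash_denom x y"
proof -
  show x: "0 < 1 - x 0" "0 < 1 - y 0"
    using assms unit_sphere_pole_iff unit_sphere_height by (metis order_le_less)+
  have "0 < 2 * (1 - x 0)" using x by simp
  then show "0 < smash_denom x y" using smash_denom_ge(1)[OF assms(1,2)] by (rule less_le_trans)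
qed

lemma smash_map_stereographic:
  assumes x: "x \<in> unit_sphere k" and y: "y \<in> unit_sphere n" and "x \<noteq> pole" "y \<noteq> pole"
  defines "r \<equiv> 1 - smash_map k n (x, y) 0"
  shows "0 < r" "\<And>i. 1 \<le> i \<Longrightarrow> i \<le> k \<Longrightarrow> smash_map k n (x, y) i = r * (x i / (1 - x 0))"
    "\<And>i. 1 \<le> i \<Longrightarrow> i \<le> n \<Longrightarrow> smash_map k n (x, y) (k + i) = r * (y i / (1 - y 0))"
proof -
  note p = smash_denom_pos[OF assms(1-4)]
  have r: "r = 2 * ((1 - x 0) * (1 - y 0)) / smash_denom x y" by (simp add: r_def smash_map_def)
  show "0 < r" unfolding r using p by simp
  show "smash_map k n (x, y) i = r * (x i / (1 - x 0))" if "1 \<le> i" "i \<le> k" for i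
    unfolding r using p that by (simp add: smash_map_def)
  show "smash_map k n (x, y) (k + i) = r * (y i / (1 - y 0))" if "1 \<le> i" "i \<le> n" for i
    unfolding r using p that by (simp add: smash_map_def)
qed

text \<open>The norm of the stereographic coordinates determines the height \<open>x 0\<close>, and
  then the remaining coordinates.\<close>

lemma stereographic_inject:
  assumes x: "x \<in> unit_sphere k" and y: "y \<in> unit_sphere k" and xp: "x \<noteq> pole" and yp: "y \<noteq> pole"
    and eq: "\<And>i. 1 \<le> i \<Longrightarrow> i \<le> k \<Longrightarrow> x i / (1 - x 0) = y i / (1 - y 0)"
  shows "x = y"
proof -
  have q: "(\<Sum>i<k. (z (Suc i) / (1 - z 0))\<^sup>2) = 2 / (1 - z 0) - 1" and z0: "1 - z 0 \<noteq> 0"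
    if z: "z \<in> unit_sphere k" "z \<noteq> pole" for z
  proof -
    show z0: "1 - z 0 \<noteq> 0" using unit_sphere_pole_iff[OF z(1)] z(2) by blast
    have "(\<Sum>i<k. (z (Suc i) / (1 - z 0))\<^sup>2) = (\<Sum>i<k. z (Suc i) ^ 2) / (1 - z 0)\<^sup>2"
      by (simp add: power_divide sum_divide_distrib)
    also have "\<dots> = 2 / (1 - z 0) - 1"
    proof -
      have "d * (2 - d) / d\<^sup>2 = 2 / d - 1" if "d \<noteq> 0" for d :: real
        using that by (simp add: power2_eq_square diff_divide_distrib)
      then show ?thesis unfolding unit_sphere_sum[OF z(1)] using z0 by blast
    qed
    finally show "(\<Sum>i<k. (z (Suc i) / (1 - z 0))\<^sup>2) = 2 / (1 - z 0) - 1" .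
  qed
  have "(\<Sum>i<k. (x (Suc i) / (1 - x 0))\<^sup>2) = (\<Sum>i<k. (y (Suc i) / (1 - y 0))\<^sup>2)"
    by (intro sum.cong) (simp_all add: eq)
  then have "2 / (1 - x 0) = 2 / (1 - y 0)" using q[OF x xp] q[OF y yp] by simp
  then have h: "x 0 = y 0" using z0[OF x xp] z0[OF y yp] by (simp add: field_simps)
  then have "x i = y i" if "1 \<le> i" "i \<le> k" for i using eq[OF that] z0[OF x xp] z0[OF y yp] by simp
  moreover have "x i = y i" if "k < i" for i using x y that by (simp add: unit_sphere_def)
  ultimately show ?thesis using h by (metis One_nat_def Suc_leI ext gr0I linorder_not_le)
qed

text \<open>The wedge is the locus where the image has height 1; off the wedge the stereographic
  coordinates of both factors are recovered from the image.\<close>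

lemma smash_map_eq_iff:
  assumes x: "x \<in> unit_sphere k" "x' \<in> unit_sphere k" and y: "y \<in> unit_sphere n" "y' \<in> unit_sphere n"
  shows "smash_map k n (x, y) = smash_map k n (x', y') \<longleftrightarrow>
    (x, y) = (x', y') \<or> ((x = pole \<or> y = pole) \<and> (x' = pole \<or> y' = pole))"
proof
  assume eq: "smash_map k n (x, y) = smash_map k n (x', y')"
  have p: "smash_map k n (pole, pole) 0 = 1" by (simp add: smash_map_def pole_def)
  have w: "v = pole \<or> w = pole \<longleftrightarrow> smash_map k n (v, w) 0 = 1" if "v \<in> unit_sphere k" "w \<in> unit_sphere n" for v w
  proof (cases "v = pole \<or> w = pole")
    case True
    then show ?thesis using smash_map_wedge[OF True, of k n] by (simp add: pole_def)
  next
    case False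
    then show ?thesis using smash_map_stereographic(1)[OF that] by auto
  qed
  show "(x, y) = (x', y') \<or> ((x = pole \<or> y = pole) \<and> (x' = pole \<or> y' = pole))"
  proof (cases "x = pole \<or> y = pole")
    case True
    then show ?thesis using w[OF x(1) y(1)] w[OF x(2) y(2)] eq by simp
  next
    case False
    then have n: "x \<noteq> pole" "y \<noteq> pole" "x' \<noteq> pole" "y' \<noteq> pole" using w[OF x(1) y(1)] w[OF x(2) y(2)] eq by auto
    note a = smash_map_stereographic[OF x(1) y(1) n(1,2)] and b = smash_map_stereographic[OF x(2) y(2) n(3,4)]
    define r where "r = 1 - smash_map k n (x, y) 0"
    have r: "r \<noteq> 0" "1 - smash_map k n (x', y') 0 = r" using a(1) eq by (auto simp: r_def)
    have "x = x'"
    proof (rule stereographic_inject[OF x n(1,3)])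
      fix i assume i: "1 \<le> i" "i \<le> k"
      have "r * (x i / (1 - x 0)) = r * (x' i / (1 - x' 0))"
        using a(2)[OF i] b(2)[OF i] unfolding eq r(2) r_def[symmetric] by simp
      then show "x i / (1 - x 0) = x' i / (1 - x' 0)" by (rule iffD1[OF mult_left_cancel[OF r(1)]])
    qed
    moreover have "y = y'"
    proof (rule stereographic_inject[OF y n(2,4)])
      fix i assume i: "1 \<le> i" "i \<le> n"
      have "r * (y i / (1 - y 0)) = r * (y' i / (1 - y' 0))"
        using a(3)[OF i] b(3)[OF i] unfolding eq r(2) r_def[symmetric] by simp
      then show "y i / (1 - y 0) = y' i / (1 - y' 0)" by (rule iffD1[OF mult_left_cancel[OF r(1)]])
    qed
    ultimately show ?thesis by simp
  qed
next
  assume "(x, y) = (x', y') \<or> ((x = pole \<or> y = pole) \<and> (x' = pole \<or> y' = pole))"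
  then show "smash_map k n (x, y) = smash_map k n (x', y')" using smash_map_wedge by metis
qed

section \<open>Surjectivity by inverse stereographic projection\<close>

definition inverse_stereographic :: "nat \<Rightarrow> (nat \<Rightarrow> real) \<Rightarrow> nat \<Rightarrow> real" where
  "inverse_stereographic k a = (\<lambda>i. if i = 0 then 1 - 2 / ((\<Sum>j<k. a (Suc j) ^ 2) + 1)
     else if i \<le> k then 2 / ((\<Sum>j<k. a (Suc j) ^ 2) + 1) * a i else 0)"

lemma inverse_stereographic:
  fixes k a
  defines "x \<equiv> inverse_stereographic k a"
  shows "x \<in> unit_sphere k" "x \<noteq> pole" "1 - x 0 = 2 / ((\<Sum>j<k. a (Suc j) ^ 2) + 1)"
    "\<And>i. 1 \<le> i \<Longrightarrow> i \<le> k \<Longrightarrow> x i / (1 - x 0) = a i"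
proof -
  define A where "A = (\<Sum>j<k. a (Suc j) ^ 2)"
  have A: "0 \<le> A" unfolding A_def by (intro sum_nonneg) simp
  show h: "1 - x 0 = 2 / ((\<Sum>j<k. a (Suc j) ^ 2) + 1)" by (simp add: x_def inverse_stereographic_def)
  have "(\<Sum>i<k. x (Suc i) ^ 2) = (\<Sum>i<k. (2 / (A + 1))\<^sup>2 * a (Suc i) ^ 2)"
    by (intro sum.cong) (auto simp: x_def inverse_stereographic_def A_def power_mult_distrib power_divide)
  also have "\<dots> = (2 / (A + 1))\<^sup>2 * A" by (simp add: A_def sum_distrib_left)
  finally have "(\<Sum>i\<le>k. x i ^ 2) = (1 - 2 / (A + 1))\<^sup>2 + (2 / (A + 1))\<^sup>2 * A"
    using sum_split_spheres[of "\<lambda>i. x i ^ 2" k 0] by (simp add: x_def inverse_stereographic_def A_def)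
  also have "1 - 2 / (A + 1) = (A - 1) / (A + 1)" using A by (simp add: field_simps)
  also have "((A - 1) / (A + 1))\<^sup>2 + (2 / (A + 1))\<^sup>2 * A = ((A - 1)\<^sup>2 + 4 * A) / (A + 1)\<^sup>2"
    by (simp add: power_divide add_divide_distrib)
  also have "(A - 1)\<^sup>2 + 4 * A = (A + 1)\<^sup>2" by (simp add: power2_eq_square algebra_simps)
  finally have "(\<Sum>i\<le>k. x i ^ 2) = 1" using A by simp
  then show xs: "x \<in> unit_sphere k" by (simp add: unit_sphere_def) (simp add: x_def inverse_stereographic_def)
  have "1 - x 0 \<noteq> 0" unfolding h A_def[symmetric] using A by simp
  then show "x \<noteq> pole" using unit_sphere_pole_iff[OF xs] by blast
  show "x i / (1 - x 0) = a i" if "1 \<le> i" "i \<le> k" for i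
    unfolding h using that A by (simp add: x_def inverse_stereographic_def A_def[symmetric])
qed

text \<open>The stereographic coordinates of \<open>z\<close> are cut into the first
  \<open>k\<close> and the last \<open>n\<close>, and each block is projected back to its own
  sphere.\<close>

lemma smash_map_surj:
  assumes z: "z \<in> unit_sphere (k + n)"
  shows "\<exists>x\<in>unit_sphere k. \<exists>y\<in>unit_sphere n. smash_map k n (x, y) = z"
proof (cases "z = pole")
  case True
  then show ?thesis using smash_map_wedge pole_in_unit_sphere by metis
next
  case False
  then have z0: "1 - z 0 \<noteq> 0" using unit_sphere_pole_iff[OF z] by blast
  define a where "a i = z i / (1 - z 0)" for i
  define b where "b j = z (k + j) / (1 - z 0)" for j
  define A where "A = (\<Sum>j<k. a (Suc j) ^ 2)" define B where "B = (\<Sum>j<n. b (Suc j) ^ 2)"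
  have AB: "0 \<le> A" "0 \<le> B" unfolding A_def B_def by (auto intro: sum_nonneg)
  have "z 0 ^ 2 + (\<Sum>i<k. z (Suc i) ^ 2) + (\<Sum>j<n. z (Suc (k + j)) ^ 2) = 1"
    using z sum_split_spheres[of "\<lambda>i. z i ^ 2" k n] by (simp add: unit_sphere_def)
  moreover have "(\<Sum>i<k. z (Suc i) ^ 2) = (1 - z 0)\<^sup>2 * A"
    unfolding A_def sum_distrib_left using z0 by (intro sum.cong) (auto simp: a_def power_divide)
  moreover have "(\<Sum>j<n. z (Suc (k + j)) ^ 2) = (1 - z 0)\<^sup>2 * B"
    unfolding B_def sum_distrib_left using z0 by (intro sum.cong) (auto simp: b_def power_divide)
  ultimately have "(1 - z 0) * ((1 - z 0) * (A + B + 1)) = (1 - z 0) * 2"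
    by (simp add: power2_eq_square algebra_simps)
  then have zAB: "(1 - z 0) * (A + B + 1) = 2" by (rule iffD1[OF mult_left_cancel[OF z0]])
  define x where "x = inverse_stereographic k a" define y where "y = inverse_stereographic n b"
  note xi = inverse_stereographic[where k = k and a = a, folded x_def]
    and yi = inverse_stereographic[where k = n and a = b, folded y_def]
  define r where "r = 1 - smash_map k n (x, y) 0"
  note st = smash_map_stereographic[OF xi(1) yi(1) xi(2) yi(2), folded r_def]
  have x0: "1 - x 0 = 2 / (A + 1)" and y0: "1 - y 0 = 2 / (B + 1)" using xi(3) yi(3) by (auto simp: A_def B_def)
  have "smash_denom x y = 4 * (A + B + 1) / ((A + 1) * (B + 1))"
    unfolding smash_denom_def x0 y0 using AB by (simp add: divide_simps)
  then have "r = 2 / (A + B + 1)"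
    unfolding r_def using AB x0 y0 by (simp add: smash_map_def) (simp add: field_simps)
  moreover have "1 - z 0 = 2 / (A + B + 1)" using zAB AB by (simp add: eq_divide_eq)
  ultimately have r: "r = 1 - z 0" by simp
  have "smash_map k n (x, y) i = z i" for i
  proof -
    consider "i = 0" | "1 \<le> i" "i \<le> k" | "k < i" "i \<le> k + n" | "k + n < i" by linarith
    then show ?thesis
    proof cases
      case 1
      then show ?thesis using r by (simp add: r_def)
    next
      case 2
      then show ?thesis using st(2)[of i] xi(4)[of i] r z0 by (simp add: a_def)
    next
      case 3
      then have "smash_map k n (x, y) (k + (i - k)) = r * b (i - k)"
        using st(3)[of "i - k"] yi(4)[of "i - k"] by simp
      then show ?thesis using 3 r z0 by (simp add: b_def)
    next
      case 4
      then show ?thesis using z by (simp add: smash_map_def unit_sphere_def)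
    qed
  qed
  then show ?thesis using xi(1) yi(1) by blast
qed

text \<open>Where \<open>M\<close> vanishes, the bound of the quotient by \<open>b\<close> squeezes
  it to 0, which is also the value given by division by zero.\<close>

lemma continuous_on_dominated_quotient:
  fixes a b M :: "'a::topological_space \<Rightarrow> real"
  assumes a: "continuous_on S a" and b: "continuous_on S b" and M: "continuous_on S M"
    and le: "\<And>x. x \<in> S \<Longrightarrow> \<bar>a x\<bar> \<le> M x * \<bar>b x\<bar>" and 0: "\<And>x. x \<in> S \<Longrightarrow> M x = 0 \<Longrightarrow> b x = 0"
    and M0: "\<And>x. x \<in> S \<Longrightarrow> 0 \<le> M x"
  shows "continuous_on S (\<lambda>x. a x / M x)"
  unfolding continuous_on_def
proof
  fix x assume x: "x \<in> S"
  show "((\<lambda>x. a x / M x) \<longlongrightarrow> a x / M x) (at x within S)"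
  proof (cases "M x = 0")
    case False
    then show ?thesis using a M x by (intro tendsto_divide) (auto simp: continuous_on_def)
  next
    case True
    have q: "\<bar>a y / M y\<bar> \<le> \<bar>b y\<bar>" if "y \<in> S" for y
    proof (cases "M y = 0")
      case False
      then have "0 < M y" using M0[OF that] by simp
      then show ?thesis using le[OF that] by (simp add: abs_divide pos_divide_le_eq mult.commute)
    qed simp
    have "(b \<longlongrightarrow> b x) (at x within S)" using b x by (auto simp: continuous_on_def)
    then have "(b \<longlongrightarrow> 0) (at x within S)" using 0[OF x True] by simp
    then have "((\<lambda>x. \<bar>b x\<bar>) \<longlongrightarrow> 0) (at x within S)" by (rule tendsto_rabs_zero)
    moreover have "\<forall>\<^sub>F y in at x within S. norm (a y / M y) \<le> \<bar>b y\<bar>"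
      using q by (simp add: eventually_at_filter)
    ultimately have "((\<lambda>x. a x / M x) \<longlongrightarrow> 0) (at x within S)"
      by (rule Lim_null_comparison[rotated])
    then show ?thesis using True by simp
  qed
qed

text \<open>Each numerator is dominated by the denominator times a function that vanishes at
  \<open>(pole, pole)\<close>: a height difference for coordinate 0, the coordinate itself
  otherwise.\<close>

lemma continuous_on_smash_map: "continuous_on (unit_sphere k \<times> unit_sphere n) (smash_map k n)"
proof (rule continuous_on_coordinates)
  let ?S = "unit_sphere k \<times> unit_sphere n"
  have f: "continuous_on ?S (\<lambda>q. fst q i)" "continuous_on ?S (\<lambda>q. snd q i)" for i
    by (auto intro!: continuous_on_coordinate continuous_on_fst continuous_on_snd continuous_on_id)
  define M where "M q = smash_denom (fst q) (snd q)" for q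
  have M: "continuous_on ?S M" unfolding M_def smash_denom_def by (intro continuous_on_add continuous_on_diff continuous_on_mult continuous_on_const f)
  have ge: "2 * (1 - fst q 0) \<le> M q" "2 * (1 - snd q 0) \<le> M q" "0 \<le> 1 - fst q 0" "0 \<le> 1 - snd q 0" if "q \<in> ?S" for q
    using smash_denom_ge[of "fst q" k "snd q" n] unit_sphere_height[of "fst q" k] unit_sphere_height[of "snd q" n] that
    by (auto simp: M_def)
  have M0: "0 \<le> M q" if "q \<in> ?S" for q using ge(1,3)[OF that] by (simp add: algebra_simps)
  have z: "fst q = pole" "snd q = pole" if q: "q \<in> ?S" "M q = 0" for q
  proof -
    have "1 - fst q 0 = 0" "1 - snd q 0 = 0" using ge[OF q(1)] q(2) by auto
    then show "fst q = pole" "snd q = pole" using unit_sphere_pole_iff q(1) by fastforce+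
  qed
  have dom: "\<bar>2 * (t * c)\<bar> \<le> m * \<bar>c\<bar>" if "2 * t \<le> m" "0 \<le> t" for t m c :: real
    using mult_right_mono[OF that(1) abs_ge_zero[of c]] that(2) by (simp add: abs_mult mult.assoc)
  have c0: "continuous_on ?S (\<lambda>q. (2 * ((1 - fst q 0) * (1 - snd q 0))) / M q)"
  proof (rule continuous_on_dominated_quotient[OF _ _ M _ _ M0, where b = "\<lambda>q. 1 - fst q 0"])
    show "\<bar>2 * ((1 - fst q 0) * (1 - snd q 0))\<bar> \<le> M q * \<bar>1 - fst q 0\<bar>" if "q \<in> ?S" for q
      using dom[OF ge(2)[OF that] ge(4)[OF that], of "1 - fst q 0"] by (simp only: mult.commute)
    show "1 - fst q 0 = 0" if "q \<in> ?S" "M q = 0" for q using z[OF that] by (simp add: pole_def)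
  qed (intro continuous_on_diff continuous_on_mult continuous_on_const f)+
  have c1: "continuous_on ?S (\<lambda>q. (2 * ((1 - snd q 0) * fst q i)) / M q)" if "1 \<le> i" for i
  proof (rule continuous_on_dominated_quotient[OF _ _ M _ _ M0, where b = "\<lambda>q. fst q i"])
    show "\<bar>2 * ((1 - snd q 0) * fst q i)\<bar> \<le> M q * \<bar>fst q i\<bar>" if "q \<in> ?S" for q
      using dom[OF ge(2)[OF that] ge(4)[OF that]] .
    show "fst q i = 0" if "q \<in> ?S" "M q = 0" for q using z[OF that] \<open>1 \<le> i\<close> by (simp add: pole_def)
  qed (intro continuous_on_diff continuous_on_mult continuous_on_const f)+
  have c2: "continuous_on ?S (\<lambda>q. (2 * ((1 - fst q 0) * snd q i)) / M q)" if "1 \<le> i" for i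
  proof (rule continuous_on_dominated_quotient[OF _ _ M _ _ M0, where b = "\<lambda>q. snd q i"])
    show "\<bar>2 * ((1 - fst q 0) * snd q i)\<bar> \<le> M q * \<bar>snd q i\<bar>" if "q \<in> ?S" for q
      using dom[OF ge(1)[OF that] ge(3)[OF that]] .
    show "snd q i = 0" if "q \<in> ?S" "M q = 0" for q using z[OF that] \<open>1 \<le> i\<close> by (simp add: pole_def)
  qed (intro continuous_on_diff continuous_on_mult continuous_on_const f)+
  fix i
  consider "i = 0" | "1 \<le> i" "i \<le> k" | "k < i" "i \<le> k + n" | "k + n < i" by linarith
  then show "continuous_on ?S (\<lambda>q. smash_map k n q i)"
  proof cases
    case 1
    then show ?thesis using continuous_on_diff[OF continuous_on_const c0, of 1] by (simp add: smash_map_def case_prod_beta M_def)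
  next
    case 2
    then show ?thesis using c1[of i] by (simp add: smash_map_def case_prod_beta M_def)
  next
    case 3
    then show ?thesis using c2[of "i - k"] by (simp add: smash_map_def case_prod_beta M_def)
  next
    case 4
    then show ?thesis by (simp add: smash_map_def case_prod_beta)
  qed
qed

section \<open>Smash products of spheres up to homeomorphism\<close>

lemma pointed_sphere_pole: "pointed_sphere n = (nsphere n, pole)"
  by (simp add: pointed_sphere_def pole_def)

text \<open>The maps \<open>q\<close> and \<open>smash_map\<close> have the same fibres, so the
  latter descends to a continuous bijection from a compact space onto a Hausdorff space.\<close>

lemma smash_sphere_homeomorphic:
  assumes sm: "is_smash (pointed_sphere k) (pointed_sphere n) P q"
  obtains h where "homeomorphic_map (fst P) (nsphere (k + n)) h" "h (snd P) = pole"
proof -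
  let ?X = "prod_topology (nsphere k) (nsphere n)"
  have X: "?X = top_of_set (unit_sphere k \<times> unit_sphere n)" by (simp add: nsphere_unit_sphere flip: subtopology_Times)
  have T: "topspace (nsphere i) = unit_sphere i" for i by (simp add: nsphere_unit_sphere)
  note sm' = sm[unfolded is_smash_def pointed_sphere_pole fst_conv snd_conv T]
  have q: "quotient_map ?X (fst P) q" and q0: "q (pole, pole) = snd P" using sm' by blast+
  have fib: "q v = q w \<longleftrightarrow> v = w \<or> ((fst v = pole \<or> snd v = pole) \<and> (fst w = pole \<or> snd w = pole))"
    if "v \<in> unit_sphere k \<times> unit_sphere n" "w \<in> unit_sphere k \<times> unit_sphere n" for v w
    using sm' that by blast
  have fib': "q v = q w \<longleftrightarrow> smash_map k n v = smash_map k n w"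
    if "v \<in> unit_sphere k \<times> unit_sphere n" "w \<in> unit_sphere k \<times> unit_sphere n" for v w
    using fib[OF that] smash_map_eq_iff[of "fst v" k "fst w" "snd v" n "snd w"] that by (auto simp: mem_Times_iff)
  have c: "continuous_map ?X (nsphere (k + n)) (smash_map k n)"
    unfolding X unfolding nsphere_unit_sphere using continuous_on_smash_map smash_map_in_sphere by auto
  have topX: "topspace ?X = unit_sphere k \<times> unit_sphere n" by (simp add: nsphere_unit_sphere)
  obtain h where h: "continuous_map (fst P) (nsphere (k + n)) h" "h ` topspace (fst P) = smash_map k n ` topspace ?X"
    "\<And>v. v \<in> topspace ?X \<Longrightarrow> h (q v) = smash_map k n v"
    by (rule quotient_map_lift_exists[OF q c]) (use fib' topX in blast)+
  have "homeomorphic_map (fst P) (nsphere (k + n)) h"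
  proof (rule continuous_imp_homeomorphic_map[OF h(1)])
    have "compact_space ?X" unfolding X by (simp add: compact_space_subtopology compact_Times compact_unit_sphere)
    then show "compact_space (fst P)"
      using image_compactin[OF _ quotient_imp_continuous_map[OF q]] quotient_imp_surjective_map[OF q]
      by (metis compact_space_def)
    show "Hausdorff_space (nsphere (k + n))"
      unfolding nsphere_unit_sphere by (simp add: Hausdorff_space_subtopology)
    have "smash_map k n ` topspace ?X = unit_sphere (k + n)"
      using smash_map_in_sphere smash_map_surj[of _ k n] unfolding topX by force
    then show "h ` topspace (fst P) = topspace (nsphere (k + n))" using h(2) by (simp add: nsphere_unit_sphere)
    show "inj_on h (topspace (fst P))"
    proof (rule inj_onI)
      fix a b assume ab: "a \<in> topspace (fst P)" "b \<in> topspace (fst P)" and eq: "h a = h b"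
      have surj: "topspace (fst P) = q ` topspace ?X" using quotient_imp_surjective_map[OF q] by (rule sym)
      obtain v w where vw: "v \<in> topspace ?X" "a = q v" "w \<in> topspace ?X" "b = q w"
        using ab unfolding surj image_iff by blast
      then have "smash_map k n v = smash_map k n w" using h(3)[OF vw(1)] h(3)[OF vw(3)] eq by simp
      then show "a = b" using fib' vw unfolding topX by simp
    qed
  qed
  moreover have "h (snd P) = pole"
    using h(3)[of "(pole, pole)", unfolded topX] q0 pole_in_unit_sphere smash_map_wedge[of pole pole] by simp
  ultimately show ?thesis using that by blast
qed

text \<open>Through the homeomorphisms with spheres, \<open>f\<close> becomes a pointed map from
  dimension \<open>k + m\<close> to the larger dimension \<open>k + n\<close>.\<close>

lemma smash_sphere_nullhomotopic:
  assumes mn: "m < n" and P: "is_smash (pointed_sphere k) (pointed_sphere m) P q"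
    and P': "is_smash (pointed_sphere k) (pointed_sphere n) P' q'" and f: "pointed_map P P' f"
  shows "pointed_homotopic P P' f (\<lambda>_. snd P')"
proof -
  obtain g where g: "homeomorphic_map (fst P) (nsphere (k + m)) g" "g (snd P) = pole"
    by (rule smash_sphere_homeomorphic[OF P])
  obtain h where h: "homeomorphic_map (fst P') (nsphere (k + n)) h" "h (snd P') = pole"
    by (rule smash_sphere_homeomorphic[OF P'])
  have X: "prod_topology (nsphere k) (nsphere i) = top_of_set (unit_sphere k \<times> unit_sphere i)" for i
    by (simp add: nsphere_unit_sphere flip: subtopology_Times)
  have base: "snd R \<in> topspace (fst R)" if "is_smash (pointed_sphere k) (pointed_sphere i) R r" for R r i
  proof -
    have "quotient_map (prod_topology (nsphere k) (nsphere i)) (fst R) r" "r (pole, pole) = snd R"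
      using that unfolding is_smash_def pointed_sphere_pole by auto
    moreover have "(pole, pole) \<in> topspace (prod_topology (nsphere k) (nsphere i))"
      unfolding X using pole_in_unit_sphere by simp
    ultimately show ?thesis using quotient_imp_surjective_map by (metis imageI)
  qed
  obtain g' where g': "homeomorphic_maps (fst P) (nsphere (k + m)) g g'" using g(1) homeomorphic_map_maps by blast
  obtain h' where h': "homeomorphic_maps (fst P') (nsphere (k + n)) h h'" using h(1) homeomorphic_map_maps by blast
  have gg: "\<And>x. x \<in> topspace (fst P) \<Longrightarrow> g' (g x) = x" "continuous_map (fst P) (nsphere (k + m)) g" "continuous_map (nsphere (k + m)) (fst P) g'"
    and hh: "\<And>x. x \<in> topspace (fst P') \<Longrightarrow> h' (h x) = x" "continuous_map (fst P') (nsphere (k + n)) h" "continuous_map (nsphere (k + n)) (fst P') h'"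
    using g' h' unfolding homeomorphic_maps_def by auto
  have fc: "continuous_map (fst P) (fst P') f" and f0: "f (snd P) = snd P'" using f unfolding pointed_map_def by auto
  have g'0: "g' pole = snd P" and h'0: "h' pole = snd P'" using gg(1)[OF base[OF P]] hh(1)[OF base[OF P']] g h by auto
  define F where "F = h \<circ> (f \<circ> g')"
  have F: "continuous_map (nsphere (k + m)) (nsphere (k + n)) F" "F pole = pole"
    unfolding F_def using continuous_map_compose[OF continuous_map_compose[OF gg(3) fc] hh(2)] g'0 f0 h(2) by auto
  have "homotopic_with (\<lambda>w. w pole = pole) (nsphere (k + m)) (nsphere (k + n)) F (\<lambda>_. pole)"
    by (rule nullhomotopic_low_dim[OF _ F]) (use mn in simp)
  then have "homotopic_with (\<lambda>w. w (snd P) = pole) (fst P) (nsphere (k + n)) (F \<circ> g) ((\<lambda>_. pole) \<circ> g)"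
    by (rule homotopic_with_compose_continuous_map_right[OF _ gg(2)]) (simp add: g(2))
  then have "homotopic_with (\<lambda>w. w (snd P) = snd P') (fst P) (fst P') (h' \<circ> (F \<circ> g)) (h' \<circ> ((\<lambda>_. pole) \<circ> g))"
    by (rule homotopic_with_compose_continuous_map_left[OF _ hh(3)]) (simp add: h'0)
  moreover have "h' \<circ> ((\<lambda>_. pole) \<circ> g) = (\<lambda>_. snd P')" using h'0 by auto
  ultimately have null: "homotopic_with (\<lambda>w. w (snd P) = snd P') (fst P) (fst P') (h' \<circ> (F \<circ> g)) (\<lambda>_. snd P')" by simp
  have "homotopic_with (\<lambda>w. w (snd P) = snd P') (fst P) (fst P') f (h' \<circ> (F \<circ> g))"
  proof (rule homotopic_with_equal[where P = "\<lambda>w. w (snd P) = snd P'", OF f0 _ fc])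
    show e: "f x = (h' \<circ> (F \<circ> g)) x" if "x \<in> topspace (fst P)" for x
      using gg(1)[OF that] hh(1)[of "f x"] continuous_map_image_subset_topspace[OF fc] that unfolding F_def by auto
    show "(h' \<circ> (F \<circ> g)) (snd P) = snd P'" using e[OF base[OF P]] f0 by simp
  qed
  from homotopic_with_trans[OF this null] show ?thesis unfolding pointed_homotopic_def .
qed

section \<open>Spheres and discs as finite complexes\<close>

definition unit_disc :: "nat \<Rightarrow> (nat \<Rightarrow> real) set" where
  "unit_disc n = {x. (\<Sum>i<n. x i ^ 2) \<le> 1 \<and> (\<forall>i\<ge>n. x i = 0)}"

lemma unit_sphere_Suc_subset: "unit_sphere n \<subseteq> unit_disc (Suc n)"
  by (auto simp: unit_sphere_def unit_disc_def lessThan_Suc_atMost)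

lemma disc_topology: "subtopology (Euclidean_space n) {x. (\<Sum>i<n. x i ^ 2) \<le> 1} = top_of_set (unit_disc n)"
proof -
  have "{x :: nat \<Rightarrow> real. \<forall>i\<ge>n. x i = 0} \<inter> {x. (\<Sum>i<n. x i ^ 2) \<le> 1} = unit_disc n" by (auto simp: unit_disc_def)
  then show ?thesis by (simp add: Euclidean_space_top subtopology_subtopology)
qed

lemma topspace_Euclidean: "topspace (Euclidean_space n) = {x. \<forall>i\<ge>n. x i = 0}"
  by (simp add: topspace_Euclidean_space)

text \<open>The centre goes to the antipode of \<open>pole\<close> and the boundary to
  \<open>pole\<close>; the height grows with the square of the radius.\<close>

definition disc_collapse :: "nat \<Rightarrow> (nat \<Rightarrow> real) \<Rightarrow> nat \<Rightarrow> real" where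
  "disc_collapse n x i = (if i = 0 then 2 * (\<Sum>j<n. x j ^ 2) - 1
     else if i \<le> n then 2 * sqrt (1 - (\<Sum>j<n. x j ^ 2)) * x (i - 1) else 0)"

lemma continuous_on_disc_collapse: "continuous_on S (disc_collapse n)"
proof (rule continuous_on_coordinates)
  fix i
  have c: "continuous_on S (\<lambda>x :: nat \<Rightarrow> real. x j)" for j by (rule continuous_on_coordinate[OF continuous_on_id])
  consider "i = 0" | "1 \<le> i" "i \<le> n" | "n < i" by linarith
  then show "continuous_on S (\<lambda>x. disc_collapse n x i)"
  proof cases
    case 1
    have "continuous_on S (\<lambda>x :: nat \<Rightarrow> real. 2 * (\<Sum>j<n. x j ^ 2) - 1)"
      by (intro continuous_on_diff continuous_on_mult continuous_on_sum continuous_on_power continuous_on_const c)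
    then show ?thesis using 1 by (simp add: disc_collapse_def)
  next
    case 2
    have "continuous_on S (\<lambda>x :: nat \<Rightarrow> real. 2 * sqrt (1 - (\<Sum>j<n. x j ^ 2)) * x (i - 1))"
      by (intro continuous_on_diff continuous_on_mult continuous_on_sum continuous_on_power continuous_on_real_sqrt continuous_on_const c)
    then show ?thesis using 2 by (simp add: disc_collapse_def)
  next
    case 3
    then show ?thesis by (simp add: disc_collapse_def)
  qed
qed

lemma disc_collapse_in_sphere:
  assumes "x \<in> unit_disc n" shows "disc_collapse n x \<in> unit_sphere n"
proof -
  define r where "r = (\<Sum>j<n. x j ^ 2)"
  have r: "r \<le> 1" using assms by (simp add: unit_disc_def r_def)
  have "(\<Sum>i\<le>n. (disc_collapse n x i)\<^sup>2) = (2 * r - 1)\<^sup>2 + (\<Sum>i<n. (2 * sqrt (1 - r) * x i)\<^sup>2)"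
    using sum_split_spheres[of "\<lambda>i. (disc_collapse n x i)\<^sup>2" n 0] by (simp add: disc_collapse_def r_def)
  also have "(\<Sum>i<n. (2 * sqrt (1 - r) * x i)\<^sup>2) = 4 * (1 - r) * r"
    using r by (simp add: power_mult_distrib r_def sum_distrib_left)
  finally show ?thesis by (simp add: unit_sphere_def power2_eq_square algebra_simps) (simp add: disc_collapse_def)
qed

lemma disc_collapse_pole_iff:
  assumes "x \<in> unit_disc n" shows "disc_collapse n x = pole \<longleftrightarrow> (\<Sum>i<n. x i ^ 2) = 1"
proof
  assume "disc_collapse n x = pole"
  then have "disc_collapse n x 0 = pole 0" by simp
  then show "(\<Sum>i<n. x i ^ 2) = 1" by (simp add: disc_collapse_def pole_def)
qed (auto simp: disc_collapse_def pole_def fun_eq_iff)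

lemma disc_collapse_inj:
  assumes x: "x \<in> unit_disc n" and y: "y \<in> unit_disc n" and lt: "(\<Sum>i<n. x i ^ 2) < 1"
    and eq: "disc_collapse n x = disc_collapse n y"
  shows "x = y"
proof
  fix i
  have r: "(\<Sum>i<n. x i ^ 2) = (\<Sum>i<n. y i ^ 2)"
    using fun_cong[OF eq, of 0] by (simp add: disc_collapse_def)
  show "x i = y i"
  proof (cases "i < n")
    case True
    then show ?thesis using fun_cong[OF eq, of "Suc i"] lt r by (simp add: disc_collapse_def)
  next
    case False
    then show ?thesis using x y by (simp add: unit_disc_def)
  qed
qed

lemma disc_collapse_surj:
  assumes z: "z \<in> unit_sphere n" "z \<noteq> pole"
  shows "\<exists>x \<in> unit_disc n. (\<Sum>i<n. x i ^ 2) < 1 \<and> disc_collapse n x = z"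
proof -
  have s: "0 < 1 - z 0" using unit_sphere_pole_iff[OF z(1)] z unit_sphere_height[OF z(1)] by linarith
  \<comment> \<open>Solving the height equation gives \<open>(1 - z 0) / 2\<close> for one minus the
    squared radius, whence the scaling factor.\<close>
  define x where "x i = (if i < n then z (Suc i) / (2 * sqrt ((1 - z 0) / 2)) else 0)" for i
  have sq: "(2 * sqrt ((1 - z 0) / 2))\<^sup>2 = 2 * (1 - z 0)" using s by (simp add: power_mult_distrib)
  have "(\<Sum>i<n. x i ^ 2) = (\<Sum>i<n. z (Suc i) ^ 2 / (2 * (1 - z 0)))"
    by (intro sum.cong refl) (simp only: x_def lessThan_iff if_True power_divide sq)
  also have "\<dots> = (1 - z 0) * (2 - (1 - z 0)) / (2 * (1 - z 0))"
    unfolding sum_divide_distrib[symmetric] unit_sphere_sum[OF z(1)] ..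
  also have "\<dots> = (1 + z 0) / 2"
  proof -
    have "d * (2 - d) / (2 * d) = (2 - d) / 2" if "0 < d" for d :: real using that by simp
    from this[OF s] show ?thesis by simp
  qed
  finally have r: "(\<Sum>i<n. x i ^ 2) = (1 + z 0) / 2" .
  have xd: "x \<in> unit_disc n" using r s by (auto simp: unit_disc_def x_def)
  have e: "1 - (\<Sum>j<n. x j ^ 2) = (1 - z 0) / 2" unfolding r by (simp add: field_simps)
  have "disc_collapse n x i = z i" for i
  proof -
    consider "i = 0" | "1 \<le> i" "i \<le> n" | "n < i" by linarith
    then show ?thesis
    proof cases
      case 1
      then show ?thesis by (simp add: disc_collapse_def r field_simps)
    next
      case 2
      then have "x (i - 1) = z i / (2 * sqrt ((1 - z 0) / 2))" by (simp add: x_def)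
      then show ?thesis using 2 s unfolding disc_collapse_def e by simp
    next
      case 3
      then show ?thesis using z(1) by (simp add: disc_collapse_def unit_sphere_def)
    qed
  qed
  then show ?thesis using xd r s by (intro bexI[of _ x] conjI) auto
qed

lemma Hausdorff_top_of_set: "Hausdorff_space (top_of_set (S :: (nat \<Rightarrow> real) set))"
  by (simp add: Hausdorff_space_subtopology)

lemma finite_cell_complex_point: "finite_cell_complex (top_of_set {a})"
proof (rule finite_cell_complex.attach[of _ "{}" 0 "\<lambda>_. a"])
  show "finite_cell_complex (subtopology (top_of_set {a}) {})" by (rule finite_cell_complex.empty) simp
  show "bij_betw (\<lambda>_. a) {x \<in> topspace (Euclidean_space 0). (\<Sum>i<0. x i ^ 2) < 1} (topspace (top_of_set {a}) - {})"
    by (auto simp: bij_betw_def inj_on_def topspace_Euclidean)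
qed (auto simp: Hausdorff_top_of_set)

text \<open>One point and one \<open>n\<close>-cell, attached by collapsing the boundary of the
  disc.\<close>

lemma finite_cell_complex_sphere: "finite_cell_complex (nsphere n)"
proof (rule finite_cell_complex.attach[of _ "{pole}" n "disc_collapse n"])
  show "Hausdorff_space (nsphere n)" unfolding nsphere_unit_sphere by (rule Hausdorff_top_of_set)
  have "{pole} \<subseteq> unit_sphere n" using pole_in_unit_sphere by blast
  then show "closedin (nsphere n) {pole}" unfolding nsphere_unit_sphere
    by (simp add: closedin_closed_eq closed_unit_sphere)
  have "subtopology (nsphere n) {pole} = top_of_set {pole}"
    using \<open>{pole} \<subseteq> unit_sphere n\<close> by (simp add: nsphere_unit_sphere subtopology_subtopology Int_absorb1)
  then show "finite_cell_complex (subtopology (nsphere n) {pole})" using finite_cell_complex_point by simp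
  show "continuous_map (subtopology (Euclidean_space n) {x. (\<Sum>i<n. x i ^ 2) \<le> 1}) (nsphere n) (disc_collapse n)"
    unfolding disc_topology nsphere_unit_sphere
    using continuous_on_disc_collapse disc_collapse_in_sphere by auto
  show "disc_collapse n ` {x \<in> topspace (Euclidean_space n). (\<Sum>i<n. x i ^ 2) = 1} \<subseteq> {pole}"
    using disc_collapse_pole_iff[of _ n] by (auto simp: topspace_Euclidean unit_disc_def)
  have E: "{x \<in> topspace (Euclidean_space n). (\<Sum>i<n. x i ^ 2) < 1} = {x \<in> unit_disc n. (\<Sum>i<n. x i ^ 2) < 1}"
    by (auto simp: topspace_Euclidean unit_disc_def)
  show "bij_betw (disc_collapse n) {x \<in> topspace (Euclidean_space n). (\<Sum>i<n. x i ^ 2) < 1} (topspace (nsphere n) - {pole})"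
    unfolding E bij_betw_def
  proof
    show "inj_on (disc_collapse n) {x \<in> unit_disc n. (\<Sum>i<n. x i ^ 2) < 1}"
      using disc_collapse_inj by (auto intro: inj_onI)
    show "disc_collapse n ` {x \<in> unit_disc n. (\<Sum>i<n. x i ^ 2) < 1} = topspace (nsphere n) - {pole}"
    proof
      show "disc_collapse n ` {x \<in> unit_disc n. (\<Sum>i<n. x i ^ 2) < 1} \<subseteq> topspace (nsphere n) - {pole}"
        using disc_collapse_in_sphere disc_collapse_pole_iff by (auto simp: nsphere_unit_sphere)
      show "topspace (nsphere n) - {pole} \<subseteq> disc_collapse n ` {x \<in> unit_disc n. (\<Sum>i<n. x i ^ 2) < 1}"
        using disc_collapse_surj[of _ n] by (fastforce simp: nsphere_unit_sphere)
    qed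
  qed
qed

lemma disc_sphere_subtopology: "subtopology (top_of_set (unit_disc (Suc n))) (unit_sphere n) = nsphere n"
  using unit_sphere_Suc_subset[of n] by (simp add: nsphere_unit_sphere subtopology_subtopology Int_absorb1)

lemma closedin_disc_sphere: "closedin (top_of_set (unit_disc (Suc n))) (unit_sphere n)"
  using unit_sphere_Suc_subset closed_unit_sphere by (auto simp: closedin_closed)

text \<open>The boundary sphere with one further cell attached along the identity.\<close>

lemma finite_cell_complex_disc: "finite_cell_complex (top_of_set (unit_disc (Suc n)))"
proof (rule finite_cell_complex.attach[of _ "unit_sphere n" "Suc n" "\<lambda>x. x"])
  show "finite_cell_complex (subtopology (top_of_set (unit_disc (Suc n))) (unit_sphere n))"
    unfolding disc_sphere_subtopology by (rule finite_cell_complex_sphere)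
  show "continuous_map (subtopology (Euclidean_space (Suc n)) {x. (\<Sum>i<Suc n. x i ^ 2) \<le> 1}) (top_of_set (unit_disc (Suc n))) (\<lambda>x. x)"
    unfolding disc_topology by simp
  show "(\<lambda>x. x) ` {x \<in> topspace (Euclidean_space (Suc n)). (\<Sum>i<Suc n. x i ^ 2) = 1} \<subseteq> unit_sphere n"
    by (auto simp: topspace_Euclidean unit_sphere_def lessThan_Suc_atMost)
  show "bij_betw (\<lambda>x. x) {x \<in> topspace (Euclidean_space (Suc n)). (\<Sum>i<Suc n. x i ^ 2) < 1} (topspace (top_of_set (unit_disc (Suc n))) - unit_sphere n)"
    by (auto simp: bij_betw_def topspace_Euclidean unit_sphere_def unit_disc_def lessThan_Suc_atMost)
qed (auto simp: Hausdorff_top_of_set closedin_disc_sphere)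

section \<open>Pointed discs and the collapse onto a sphere\<close>

definition pointed_disc :: "nat \<Rightarrow> pspace" where
  "pointed_disc n = (top_of_set (unit_disc (Suc n)), pole)"

definition pointed_point :: pspace where
  "pointed_point = (top_of_set {pole}, pole)"

lemma finite_pointed_sphere: "finite_pointed (pointed_sphere n)"
  using finite_cell_complex_sphere pole_in_unit_sphere
  by (simp add: finite_pointed_def pointed_sphere_pole) (simp add: nsphere_unit_sphere)

lemma pole_in_disc: "pole \<in> unit_disc (Suc n)"
  using pole_in_unit_sphere unit_sphere_Suc_subset by blast

lemma finite_pointed_disc: "finite_pointed (pointed_disc n)"
  using finite_cell_complex_disc pole_in_disc by (simp add: finite_pointed_def pointed_disc_def)

lemma finite_pointed_point: "finite_pointed pointed_point"
  using finite_cell_complex_point by (simp add: finite_pointed_def pointed_point_def)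

lemma disc_convex:
  assumes x: "x \<in> unit_disc n" and y: "y \<in> unit_disc n" and t: "0 \<le> t" "t \<le> 1"
  shows "(\<lambda>i. (1 - t) * x i + t * y i) \<in> unit_disc n"
proof -
  have "((1 - t) * a + t * b)\<^sup>2 \<le> (1 - t) * a\<^sup>2 + t * b\<^sup>2" for a b :: real
  proof -
    have "(1 - t) * a\<^sup>2 + t * b\<^sup>2 - ((1 - t) * a + t * b)\<^sup>2 = (1 - t) * t * (a - b)\<^sup>2"
      by (simp add: power2_eq_square algebra_simps)
    also have "\<dots> \<ge> 0" using t by simp
    finally show ?thesis by linarith
  qed
  then have "(\<Sum>i<n. ((1 - t) * x i + t * y i)\<^sup>2) \<le> (\<Sum>i<n. (1 - t) * x i ^ 2 + t * y i ^ 2)" by (intro sum_mono)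
  also have "\<dots> = (1 - t) * (\<Sum>i<n. x i ^ 2) + t * (\<Sum>i<n. y i ^ 2)" by (simp add: sum.distrib sum_distrib_left)
  also have "\<dots> \<le> (1 - t) * 1 + t * 1" using x y t by (intro add_mono mult_left_mono) (auto simp: unit_disc_def)
  finally show ?thesis using x y by (simp add: unit_disc_def)
qed

lemma disc_contractible: "pointed_homotopic (pointed_disc n) (pointed_disc n) (\<lambda>x. x) (\<lambda>_. pole)"
proof -
  let ?D = "unit_disc (Suc n)"
  define h where "h q = (\<lambda>i. (1 - fst q) * snd q i + fst q * pole i)" for q :: "real \<times> (nat \<Rightarrow> real)"
  have "continuous_on ({0..1} \<times> ?D) h"
  proof (rule continuous_on_coordinates)
    fix i
    have "continuous_on ({0..1} \<times> ?D) (\<lambda>q. snd q i)"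
      by (rule continuous_on_coordinate[OF continuous_on_snd[OF continuous_on_id]])
    then show "continuous_on ({0..1} \<times> ?D) (\<lambda>q. h q i)"
      unfolding h_def by (intro continuous_on_add continuous_on_mult continuous_on_diff continuous_on_const continuous_on_fst continuous_on_id)
  qed
  moreover have "h q \<in> ?D" if "q \<in> {0..1} \<times> ?D" for q
    unfolding h_def using that by (intro disc_convex pole_in_disc) auto
  ultimately have "continuous_map (prod_topology (top_of_set {0..1}) (top_of_set ?D)) (top_of_set ?D) h"
    by (auto simp flip: subtopology_Times)
  moreover have "h (t, pole) = pole" for t by (simp add: h_def algebra_simps)
  ultimately show ?thesis
    unfolding pointed_homotopic_def pointed_disc_def homotopic_with_def
    by (intro exI[of _ h]) (auto simp: h_def)
qed

text \<open>A continuous surjection from a compact to a Hausdorff space is closed, hence a quotient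
  map; its only nontrivial fibre is the boundary sphere.\<close>

lemma disc_collapse_is_collapse: "is_collapse (pointed_disc n) (unit_sphere n) (pointed_sphere (Suc n)) (disc_collapse (Suc n))"
proof -
  let ?D = "unit_disc (Suc n)"
  have compact: "compact ?D"
  proof (rule compact_of_bounded_coordinates)
    fix x i assume x: "x \<in> ?D"
    show "\<bar>x i\<bar> \<le> 1"
    proof (cases "i < Suc n")
      case True
      then have "x i ^ 2 \<le> (\<Sum>i<Suc n. x i ^ 2)" by (intro member_le_sum) auto
      then show ?thesis using x unfolding unit_disc_def abs_square_le_1[symmetric] mem_Collect_eq by linarith
    qed (use x in \<open>simp add: unit_disc_def\<close>)
  next
    show "closed ?D"
    proof -
      have "?D = {x. (\<Sum>i<Suc n. x i ^ 2) \<le> 1} \<inter> (\<Inter>i\<in>{Suc n..}. {x. x i = 0})" by (auto simp: unit_disc_def)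
      moreover have "closed {x :: nat \<Rightarrow> real. (\<Sum>i<Suc n. x i ^ 2) \<le> 1}"
        by (intro closed_Collect_le continuous_on_sum continuous_on_power continuous_on_const continuous_on_coordinate[OF continuous_on_id])
      moreover have "closed {x :: nat \<Rightarrow> real. x i = 0}" for i
        by (intro closed_Collect_eq continuous_on_const continuous_on_coordinate[OF continuous_on_id])
      ultimately show ?thesis by (metis closed_INT closed_Int)
    qed
  qed
  have surj: "disc_collapse (Suc n) ` ?D = unit_sphere (Suc n)"
  proof
    show "unit_sphere (Suc n) \<subseteq> disc_collapse (Suc n) ` ?D"
    proof
      fix z assume z: "z \<in> unit_sphere (Suc n)"
      show "z \<in> disc_collapse (Suc n) ` ?D"
      proof (cases "z = pole")
        case True
        have "(\<Sum>i<Suc n. pole i ^ 2) = 1" using pole_in_unit_sphere[of n] by (simp add: unit_sphere_def lessThan_Suc_atMost)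
        then have "disc_collapse (Suc n) pole = pole" using disc_collapse_pole_iff[OF pole_in_disc] by blast
        then show ?thesis using True pole_in_disc by (metis imageI)
      next
        case False
        then show ?thesis using disc_collapse_surj[OF z] by blast
      qed
    qed
  qed (use disc_collapse_in_sphere in blast)
  have q: "quotient_map (top_of_set ?D) (nsphere (Suc n)) (disc_collapse (Suc n))"
  proof (rule continuous_closed_imp_quotient_map)
    show c: "continuous_map (top_of_set ?D) (nsphere (Suc n)) (disc_collapse (Suc n))"
      unfolding nsphere_unit_sphere using continuous_on_disc_collapse disc_collapse_in_sphere by auto
    show "closed_map (top_of_set ?D) (nsphere (Suc n)) (disc_collapse (Suc n))"
      by (rule continuous_imp_closed_map[OF c])
        (auto simp: nsphere_unit_sphere Hausdorff_top_of_set compact_space_subtopology compact)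
    show "disc_collapse (Suc n) ` topspace (top_of_set ?D) = topspace (nsphere (Suc n))"
      using surj by (simp add: nsphere_unit_sphere)
  qed
  have S: "x \<in> unit_sphere n \<longleftrightarrow> disc_collapse (Suc n) x = pole" if "x \<in> ?D" for x
    unfolding disc_collapse_pole_iff[OF that] using that by (auto simp: unit_sphere_def unit_disc_def lessThan_Suc_atMost)
  have "disc_collapse (Suc n) x = disc_collapse (Suc n) y \<longleftrightarrow> x = y \<or> (x \<in> unit_sphere n \<and> y \<in> unit_sphere n)"
    if x: "x \<in> ?D" and y: "y \<in> ?D" for x y
  proof (cases "x \<in> unit_sphere n")
    case True
    then show ?thesis using S[OF x] S[OF y] by auto
  next
    case False
    then have "(\<Sum>i<Suc n. x i ^ 2) < 1" using x S[OF x] disc_collapse_pole_iff[OF x] by (force simp: unit_disc_def)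
    then show ?thesis using disc_collapse_inj[OF x y] False by blast
  qed
  moreover have "disc_collapse (Suc n) pole = pole" using S[OF pole_in_disc] pole_in_unit_sphere by blast
  ultimately show ?thesis unfolding is_collapse_def pointed_disc_def pointed_sphere_pole using q by simp
qed

section \<open>Connectivity of the sphere spectrum\<close>

context suspension_spectrum_functor
begin

text \<open>Collapsing a point onto itself is a cofibre sequence in which both maps are the
  identity. Consecutive arrows compose to zero, so the identity is zero.\<close>

lemma T_point_zero: "zero_object C (T pointed_point)"
proof -
  let ?K = "pointed_point"
  have "subtopology (fst ?K) {pole} = fst ?K" by (simp add: pointed_point_def subtopology_subtopology)
  then have sub: "(subtopology (fst ?K) {pole}, snd ?K) = ?K" by simp
  have "is_collapse ?K {pole} ?K (\<lambda>x. x)"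
    unfolding is_collapse_def using homeomorphic_map_id[of "top_of_set {pole}" "top_of_set {pole}"]
    by (simp add: pointed_point_def homeomorphic_map_def id_def)
  moreover have "closedin (fst ?K) {pole}" by (simp add: pointed_point_def)
  ultimately have "\<exists>h. (TM ?K ?K (\<lambda>x. x), TM ?K ?K (\<lambda>x. x), h) \<in> Tri C"
    using T_cofibre[OF finite_pointed_point _ _ finite_pointed_point, of "{pole}" "\<lambda>x. x", unfolded sub] finite_pointed_point
    by simp
  then obtain h where "(TM ?K ?K (\<lambda>x. x), TM ?K ?K (\<lambda>x. x), h) \<in> Tri C" by blast
  then have tri: "(Id C (T ?K), Id C (T ?K), h) \<in> Tri C"
    using T_id[OF finite_pointed_point] by simp
  have K: "T ?K \<in> Ob C" using T_ob finite_pointed_point by blast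
  note I = id_hom[OF K]
  have h: "h \<in> hom (T ?K) (Sus C (T ?K))" using tri_typed[OF tri] I by (simp add: homset_iff)
  have "Id C (T ?K) \<cdot> Id C (T ?K) = zero (T ?K) (T ?K)" by (rule tri_zero1[OF tri I I h])
  then show ?thesis using comp_id[OF I] K by (simp add: zero_object_iff)
qed

text \<open>A constant map factors through a point.\<close>

lemma T_constant:
  assumes K: "finite_pointed K" and L: "finite_pointed L"
  shows "TM K L (\<lambda>_. snd L) = zero (T K) (T L)"
proof -
  have kl: "snd L \<in> topspace (fst L)" using L by (simp add: finite_pointed_def)
  have 1: "pointed_map K pointed_point (\<lambda>_. pole)" "pointed_map pointed_point L (\<lambda>_. snd L)"
    using kl by (auto simp: pointed_map_def pointed_point_def)
  note P = finite_pointed_point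
  have "TM K L (\<lambda>_. snd L) = TM pointed_point L (\<lambda>_. snd L) \<cdot> TM K pointed_point (\<lambda>_. pole)"
    using T_comp[OF K P L 1] by (simp add: o_def)
  also have "TM K pointed_point (\<lambda>_. pole) = zero (T K) (T pointed_point)"
    using orthD[OF zero_object_target[OF T_point_zero] T_hom[OF K P 1(1)]] .
  also have "TM pointed_point L (\<lambda>_. snd L) \<cdot> \<dots> = zero (T K) (T L)"
    using comp_zero_right[OF T_hom[OF P L 1(2)] T_ob[OF K]] .
  finally show ?thesis .
qed

lemma T_null_homotopic:
  "finite_pointed K \<Longrightarrow> finite_pointed L \<Longrightarrow> pointed_homotopic K L f (\<lambda>_. snd L) \<Longrightarrow> TM K L f = zero (T K) (T L)"
  using T_homotopic T_constant by metis

lemma T_disc_zero: "zero_object C (T (pointed_disc n))"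
  using T_null_homotopic[OF finite_pointed_disc finite_pointed_disc, of n n "\<lambda>x. x"] disc_contractible[of n]
    T_id[OF finite_pointed_disc, of n] T_ob[OF finite_pointed_disc, of n]
  by (simp add: zero_object_iff pointed_disc_def)

text \<open>The cofibre sequence of the boundary inclusion of a disc has a contractible middle term,
  so its connecting arrow is an isomorphism.\<close>

lemma T_sphere_Suc: "isomorphic (T (pointed_sphere (Suc n))) (Sus C (T (pointed_sphere n)))"
proof -
  have sub: "(subtopology (fst (pointed_disc n)) (unit_sphere n), snd (pointed_disc n)) = pointed_sphere n"
    unfolding pointed_disc_def pointed_sphere_pole fst_conv snd_conv disc_sphere_subtopology ..
  have "closedin (fst (pointed_disc n)) (unit_sphere n)"
    unfolding pointed_disc_def using closedin_disc_sphere by simp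
  then obtain h where tri: "(TM (pointed_sphere n) (pointed_disc n) (\<lambda>x. x),
      TM (pointed_disc n) (pointed_sphere (Suc n)) (disc_collapse (Suc n)), h) \<in> Tri C"
    using T_cofibre[OF finite_pointed_disc _ _ finite_pointed_sphere disc_collapse_is_collapse, of n, unfolded sub]
      finite_pointed_sphere by blast
  have 1: "pointed_map (pointed_sphere n) (pointed_disc n) (\<lambda>x. x)"
    unfolding pointed_map_def pointed_disc_def pointed_sphere_pole
    using unit_sphere_Suc_subset[of n] by (auto simp: nsphere_unit_sphere)
  have 2: "pointed_map (pointed_disc n) (pointed_sphere (Suc n)) (disc_collapse (Suc n))"
    using disc_collapse_is_collapse[of n] quotient_imp_continuous_map
    unfolding is_collapse_def pointed_map_def by blast
  note f = T_hom[OF finite_pointed_sphere finite_pointed_disc 1] and g = T_hom[OF finite_pointed_disc finite_pointed_sphere 2]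
  have h: "h \<in> hom (T (pointed_sphere (Suc n))) (Sus C (T (pointed_sphere n)))"
    using tri_typed[OF tri] f g by (simp add: homset_iff)
  have "iso_in C h (T (pointed_sphere (Suc n))) (Sus C (T (pointed_sphere n)))"
    by (rule tri_iso_of_zero_middle[OF tri f g h T_disc_zero])
  then show ?thesis unfolding isomorphic_def by blast
qed

lemma T_sphere: "isomorphic (T (pointed_sphere n)) ((Sus C ^^ n) (Sph C))"
proof (induction n)
  case 0
  have "isomorphic (Sph C) (T (pointed_sphere 0))" using \<epsilon>_iso unfolding isomorphic_def by blast
  then show ?case using isomorphic_sym by simp
next
  case (Suc n)
  then show ?case using isomorphic_trans[OF T_sphere_Suc sus_isomorphic] by simp
qed

text \<open>Maps of spaces represent arrows only after smashing with a sphere; this property undoes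
  the smashing once the result is known to be zero.\<close>

definition smash_faithful where
  "smash_faithful A \<longleftrightarrow> A \<in> Ob C \<and> (\<forall>X Y. \<forall>a \<in> hom X Y. Id C A \<star> a = zero (A \<odot> X) (A \<odot> Y) \<longrightarrow> a = zero X Y)"

lemma smash_faithful_Sph: "smash_faithful (Sph C)"
  unfolding smash_faithful_def
proof (intro conjI sph_ob allI ballI impI)
  fix X Y a assume a: "a \<in> hom X Y" and 0: "Id C (Sph C) \<star> a = zero (Sph C \<odot> X) (Sph C \<odot> Y)"
  have XY: "X \<in> Ob C" "Y \<in> Ob C" using hom_Ob[OF a] by auto
  have "a \<cdot> Lun C X = zero (Sph C \<odot> X) Y"
    using lun_nat[OF a] 0 comp_zero_right[OF iso_hom[OF lun_iso[OF XY(2)]]] smash_ob sph_ob XY by simp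
  then show "a = zero X Y" by (rule iso_zero_right[OF lun_iso[OF XY(1)] a])
qed

lemma smash_faithful_iso:
  assumes "isomorphic A B" "smash_faithful A" shows "smash_faithful B"
proof -
  obtain e where "iso_in C e A B" using assms isomorphic_def by blast
  then obtain e' where e: "e \<in> hom A B" "e' \<in> hom B A" "e' \<cdot> e = Id C A" "A \<in> Ob C" "B \<in> Ob C" by (rule iso_inE)
  have "a = zero X Y" if a: "a \<in> hom X Y" and 0: "Id C B \<star> a = zero (B \<odot> X) (B \<odot> Y)" for X Y a
  proof -
    have XY: "X \<in> Ob C" "Y \<in> Ob C" using hom_Ob[OF a] by auto
    have "(e' \<star> Id C Y) \<cdot> ((Id C B \<star> a) \<cdot> (e \<star> Id C X)) = (e' \<star> Id C Y) \<cdot> (e \<star> a)"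
      using smash_split(2)[OF e(1) a] by simp
    also have "\<dots> = Id C A \<star> a"
      using smash_comp[OF e(1,2) a id_hom[OF XY(2)]] e(3) comp_id[OF a] by simp
    finally have "Id C A \<star> a = (e' \<star> Id C Y) \<cdot> ((Id C B \<star> a) \<cdot> (e \<star> Id C X))" by simp
    also have "(Id C B \<star> a) \<cdot> (e \<star> Id C X) = zero (A \<odot> X) (B \<odot> Y)"
      unfolding 0 using comp_zero_left[OF smash_hom[OF e(1) id_hom[OF XY(1)]]] smash_ob e XY by simp
    also have "(e' \<star> Id C Y) \<cdot> \<dots> = zero (A \<odot> X) (A \<odot> Y)"
      using comp_zero_right[OF smash_hom[OF e(2) id_hom[OF XY(2)]]] smash_ob e XY by simp
    finally show ?thesis using assms(2) a unfolding smash_faithful_def by blast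
  qed
  then show ?thesis unfolding smash_faithful_def using e by blast
qed

lemma smash_faithful_Sus:
  assumes "smash_faithful A" shows "smash_faithful (Sus C A)"
proof -
  have A: "A \<in> Ob C" using assms unfolding smash_faithful_def by blast
  have "a = zero X Y" if a: "a \<in> hom X Y" and 0: "Id C (Sus C A) \<star> a = zero (Sus C A \<odot> X) (Sus C A \<odot> Y)" for X Y a
  proof -
    have XY: "X \<in> Ob C" "Y \<in> Ob C" using hom_Ob[OF a] by auto
    note Ia = smash_hom[OF id_hom[OF A] a]
    have "SusM C (Id C A \<star> a) \<cdot> Sex C A X = Sex C A Y \<cdot> (SusM C (Id C A) \<star> a)"
      using sex_nat[OF id_hom[OF A] a] by simp
    also have "\<dots> = zero (Sus C A \<odot> X) (Sus C (A \<odot> Y))"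
      using sus_id[OF A] 0 comp_zero_right[OF iso_hom[OF sex_iso[OF A XY(2)]]] smash_ob sus_ob A XY by simp
    finally have "SusM C (Id C A \<star> a) = zero (Sus C (A \<odot> X)) (Sus C (A \<odot> Y))"
      by (rule iso_zero_right[OF sex_iso[OF A XY(1)] sus_hom[OF Ia]])
    then have "Id C A \<star> a = zero (A \<odot> X) (A \<odot> Y)" by (rule sus_eq_zero[OF Ia])
    then show ?thesis using assms a unfolding smash_faithful_def by blast
  qed
  then show ?thesis unfolding smash_faithful_def using A sus_ob by blast
qed

lemma smash_faithful_T_sphere: "smash_faithful (T (pointed_sphere n))"
proof -
  have "smash_faithful ((Sus C ^^ n) (Sph C))"
    by (induction n) (auto simp: smash_faithful_Sph smash_faithful_Sus)
  then show ?thesis using smash_faithful_iso[OF isomorphic_sym[OF T_sphere]] by blast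
qed

text \<open>By fullness a multiple prime to \<open>p\<close>, smashed with a sphere, is represented
  by a map of spaces. That map is null-homotopic for dimensional reasons, and the sphere is removed
  by faithfulness.\<close>

lemma T_sphere_multiple_zero:
  assumes mn: "m < n" and a: "a \<in> hom (T (pointed_sphere m)) (T (pointed_sphere n))"
  obtains k where "\<not> p dvd k" "multiple C k a = zero (T (pointed_sphere m)) (T (pointed_sphere n))"
proof -
  let ?m = "pointed_sphere m" and ?n = "pointed_sphere n"
  note fm = finite_pointed_sphere[of m] and fn = finite_pointed_sphere[of n]
  obtain k l P q P' q' f where k: "\<not> p dvd k" and P: "finite_pointed P" "is_smash (pointed_sphere l) ?m P q"
    "finite_pointed P'" "is_smash (pointed_sphere l) ?n P' q'" "pointed_map P P' f"
    and eq: "TM P P' f \<cdot> \<mu> (pointed_sphere l) ?m P q =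
      \<mu> (pointed_sphere l) ?n P' q' \<cdot> (Id C (T (pointed_sphere l)) \<star> multiple C k a)"
    using full[OF fm fn a] by blast
  let ?l = "pointed_sphere l"
  note fl = finite_pointed_sphere[of l]
  have Ob: "T ?l \<in> Ob C" "T ?m \<in> Ob C" "T ?n \<in> Ob C" "T P \<in> Ob C" "T P' \<in> Ob C"
    using T_ob fl fm fn P by auto
  note \<mu> = iso_hom[OF \<mu>_iso[OF fl fm P(1,2)]] and \<mu>' = \<mu>_iso[OF fl fn P(3,4)]
  note ka = multiple_hom[OF a, of k]
  have "TM P P' f = zero (T P) (T P')"
    using T_null_homotopic[OF P(1,3)] smash_sphere_nullhomotopic[OF mn P(2,4,5)] by blast
  then have "\<mu> ?l ?n P' q' \<cdot> (Id C (T ?l) \<star> multiple C k a) = zero (T ?l \<odot> T ?m) (T P')"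
    using eq comp_zero_left[OF \<mu> Ob(5)] by simp
  then have "Id C (T ?l) \<star> multiple C k a = zero (T ?l \<odot> T ?m) (T ?l \<odot> T ?n)"
    by (rule iso_zero_left[OF \<mu>' smash_hom[OF id_hom[OF Ob(1)] ka]])
  then have "multiple C k a = zero (T ?m) (T ?n)"
    using smash_faithful_T_sphere[of l] ka unfolding smash_faithful_def by blast
  then show ?thesis using that k by blast
qed

text \<open>Some multiple of \<open>a\<close> prime to \<open>p\<close> vanishes. Locality makes
  multiplication by every prime other than \<open>p\<close> injective, so the factors of the
  multiple can be stripped off one by one.\<close>

lemma unit_connective_of_local:
  assumes p: "prime p"
    and local: "\<And>X n q. X \<in> Ob C \<Longrightarrow> prime q \<Longrightarrow> q \<noteq> p \<Longrightarrow>
        inj_on (\<lambda>a. a [^]\<^bsub>homotopy_group C n X\<^esub> q) (carrier (homotopy_group C n X))"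
    and j: "0 < j"
  shows "orth (Sph C) ((Sus C ^^ j) (Sph C))"
  unfolding orth_def
proof
  let ?S = "Sph C" and ?Y = "(Sus C ^^ j) (Sph C)"
  fix a assume a: "a \<in> hom ?S ?Y"
  have Y: "?Y \<in> Ob C" using hom_Ob a by blast
  obtain e1 where e1: "iso_in C e1 (T (pointed_sphere 0)) ?S" using T_sphere[of 0] isomorphic_def by auto
  obtain e2 where e2: "iso_in C e2 ?Y (T (pointed_sphere j))" using isomorphic_sym[OF T_sphere[of j]] isomorphic_def by auto
  note h1 = iso_hom[OF e1] and h2 = iso_hom[OF e2]
  have a1: "a \<cdot> e1 \<in> hom (T (pointed_sphere 0)) ?Y" using comp_hom[OF h1 a] .
  obtain k where k: "\<not> p dvd k" "multiple C k (e2 \<cdot> (a \<cdot> e1)) = zero (T (pointed_sphere 0)) (T (pointed_sphere j))"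
    by (rule T_sphere_multiple_zero[OF j comp_hom[OF a1 h2]])
  have "e2 \<cdot> (multiple C k a \<cdot> e1) = zero (T (pointed_sphere 0)) (T (pointed_sphere j))"
    using k(2) multiple_comp_right[OF a1 h2] multiple_comp_left[OF h1 a] by simp
  then have "multiple C k a \<cdot> e1 = zero (T (pointed_sphere 0)) ?Y"
    by (rule iso_zero_left[OF e2 comp_hom[OF h1 multiple_hom[OF a]]])
  then have ka: "multiple C k a = zero ?S ?Y" by (rule iso_zero_right[OF e1 multiple_hom[OF a]])
  \<comment> \<open>Degree \<open>- int j\<close> is where the homotopy group is formed by
    suspending the target \<open>j\<close> times, so locality applies literally to these
    arrows.\<close>
  have hg: "homotopy_group C (- int j) ?S = hom_group C ?S ?Y" using j by (simp add: homotopy_group_def)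
  interpret G: comm_group "hom_group C ?S ?Y" using hom_group[OF sph_ob Y] .
  have inj: "x = zero ?S ?Y" if "prime q" "q \<noteq> p" "x \<in> hom ?S ?Y" "x [^]\<^bsub>hom_group C ?S ?Y\<^esub> q = zero ?S ?Y" for q :: nat and x
    using inj_onD[OF local[OF sph_ob that(1,2), of "- int j", unfolded hg], of x "zero ?S ?Y"] that(3,4)
      G.nat_pow_one[of q] zero_hom[OF sph_ob Y] by simp
  have "x = zero ?S ?Y" if "\<not> p dvd k" "x \<in> hom ?S ?Y" "x [^]\<^bsub>hom_group C ?S ?Y\<^esub> k = zero ?S ?Y" for k :: nat and x
    using that
  proof (induction k arbitrary: x rule: less_induct)
    case (less k)
    show ?case
    proof (cases "k = 1")
      case True
      then show ?thesis using less.prems plus_zero(2)[of x] by simp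
    next
      case False
      then obtain q where q: "prime q" "q dvd k" using prime_factor_nat by blast
      then obtain k' where k': "k = k' * q" by (metis dvd_def mult.commute)
      have "q \<noteq> p" using q less.prems by blast
      have k0: "k \<noteq> 0" using less.prems(1) by (cases "k = 0") simp_all
      have "k' < k" using k' k0 prime_gt_1_nat[OF q(1)] by simp
      have c: "x [^]\<^bsub>hom_group C ?S ?Y\<^esub> k' \<in> hom ?S ?Y" using G.nat_pow_closed[of x k'] less.prems by simp
      have "(x [^]\<^bsub>hom_group C ?S ?Y\<^esub> k') [^]\<^bsub>hom_group C ?S ?Y\<^esub> q = zero ?S ?Y"
        using less.prems k' G.nat_pow_pow[of x k' q] by simp
      then have "x [^]\<^bsub>hom_group C ?S ?Y\<^esub> k' = zero ?S ?Y" using inj[OF q(1) \<open>q \<noteq> p\<close> c] by blast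
      moreover have "\<not> p dvd k'" using less.prems(1) k' by auto
      ultimately show ?thesis using less.IH[OF \<open>k' < k\<close>] less.prems(2) by blast
    qed
  qed
  then show "a = zero ?S ?Y" using k(1) a ka multiple_eq[OF a] by simp
qed

end

theorem proposition3p11:
  fixes C :: "('o, 'm, 'i) stable_data" and p :: nat and H X Y :: 'o
  assumes "prime p"
    and "p_local_stable_homotopy_category p C"
    and "mod_p_eilenberg_maclane p C H"
    and "X \<in> Ob C" and "Y \<in> Ob C"
    and "bousfield_cong C (strange_ideal C H) (bousfield_class C X) (bousfield_class C Y)"
  shows "bousfield_r C (bousfield_class C X) = bousfield_r C (bousfield_class C Y)"
proof -
  obtain T TM \<epsilon> \<mu> where T: "suspension_spectrum_functor C p T TM \<epsilon> \<mu>"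
    using assms(2) unfolding p_local_stable_homotopy_category_def by blast
  interpret T: suspension_spectrum_functor C p T TM \<epsilon> \<mu> by (rule T)
  have local: "inj_on (\<lambda>a. a [^]\<^bsub>homotopy_group C n X\<^esub> q) (carrier (homotopy_group C n X))"
    if "X \<in> Ob C" "prime q" "q \<noteq> p" for X n q
    using assms(2) that unfolding p_local_stable_homotopy_category_def by (blast intro: bij_betw_imp_inj_on)
  have H: "H \<in> Ob C" and H0: "homotopy_group C 0 H \<cong> integer_mod_group p"
    and Hn: "\<And>n. n \<noteq> 0 \<Longrightarrow> trivial_group (homotopy_group C n H)"
    using assms(3) unfolding mod_p_eilenberg_maclane_def by auto
  have hg: "homotopy_group C 0 H = hom_group C (Sph C) H" by (simp add: homotopy_group_def)
  interpret G: comm_group "hom_group C (Sph C) H" using T.hom_group[OF T.sph_ob H] .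
  have p0: "0 < p" using prime_gt_0_nat[OF assms(1)] .
  have p1: "1 < p" using prime_gt_1_nat[OF assms(1)] .
  interpret Z: group "integer_mod_group p" by simp
  \<comment> \<open>The isomorphism is taken out of the residues modulo \<open>p\<close>: the image
    of 1 is the generator \<open>u\<close>, and its multiples are the images of residues.\<close>
  obtain \<phi> where \<phi>: "\<phi> \<in> iso (integer_mod_group p) (hom_group C (Sph C) H)"
    using G.iso_sym[OF H0[unfolded hg]] unfolding is_iso_def by blast
  have \<phi>h: "\<phi> \<in> hom (integer_mod_group p) (hom_group C (Sph C) H)" using \<phi> by (simp add: iso_def)
  have carr: "carrier (integer_mod_group p) = {0..<int p}" using p0 by (simp add: carrier_integer_mod_group)
  have pow: "1 [^]\<^bsub>integer_mod_group p\<^esub> k = int k mod int p" for k :: nat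
    by simp
  have c1: "1 \<in> carrier (integer_mod_group p)" using carr p1 by simp
  define u where "u = \<phi> 1"
  have u: "u \<in> homset C (Sph C) H" using hom_in_carrier[OF \<phi>h c1] by (simp add: u_def T.hom_carrier)
  have uk: "multiple C k u = \<phi> (int k mod int p)" for k
  proof -
    have "\<phi> (1 [^]\<^bsub>integer_mod_group p\<^esub> k) = \<phi> 1 [^]\<^bsub>hom_group C (Sph C) H\<^esub> k"
      using hom_nat_pow[OF \<phi>h c1 Z.group_axioms G.group_axioms] by simp
    then show ?thesis using pow T.multiple_eq[OF u] by (simp add: u_def)
  qed
  interpret E: eilenberg_maclane C p H u
  proof unfold_locales
    show "T.orth (Sph C) ((Sus C ^^ k) (Sph C))" if "0 < k" for k
      by (rule T.unit_connective_of_local[OF assms(1) local that])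
    show "prime p" by fact
    show "u \<in> homset C (Sph C) H" by fact
    show "\<exists>k. f = multiple C k u" if "f \<in> homset C (Sph C) H" for f
    proof -
      have "f \<in> \<phi> ` {0..<int p}"
        using that \<phi> carr T.hom_carrier by (auto simp: iso_def bij_betw_def)
      then obtain i where i: "0 \<le> i" "i < int p" "f = \<phi> i" by auto
      then show ?thesis using uk[of "nat i"] by (intro exI[of _ "nat i"]) simp
    qed
    show "multiple C p u = Zer C (Sph C) H"
      using uk[of p] hom_one[OF \<phi>h Z.group_axioms G.group_axioms] T.hom_one by simp
    show "T.orth (T.sphere n) H" if "n \<noteq> 0" for n
      using Hn[OF that] T.homotopy_group_trivial[OF H] by blast
  qed
  show ?thesis by (rule E.cong_imp_r_eq[OF assms(4-6)])
qed

end
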